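(* Let $\alpha>0$, $\gamma>0$, $\sigma>0$, $d>\alpha/\gamma$, and let $Z$ be the Ornstein-Uhlenbeck process doubly reflected at $0$ and $d$, $$\mathrm{d}Z_{t}=(\alpha-\gamma Z_{t})\,\mathrm{d}t+\sigma\, \mathrm{d}B_{t}+\mathrm{d}L_{t}-\mathrm{d}U_{t},\qquad Z_0=x\in[0,d],$$ with loss process $U$ at the boundary $d$. Put $$W(v):=\exp\left(\frac{2\alpha v}{\sigma^2}-\frac{\gamma v^2}{\sigma^2}\right),\qquad q_U:=\frac{\sigma^2}{2}\,\frac{W(d)}{\int_0^dW(v)\,\mathrm{d}v},$$ $$h(x)=\frac{2q_U}{\sigma^2}\int_0^x\int_0^u\frac{W(v)}{W(u)}\,\mathrm{d}v\,\mathrm{d}u,\qquad \eta_U^2:=\sigma^2\int_0^d h'(x)^2\,\pi(\mathrm{d}x),$$ where $\pi$ is the stationary distribution of $Z$. Then the loss process $U$ satisfies the central limit theorem $$\frac{U_t-q_Ut}{\sqrt t}\Rightarrow\mathcal{N}(0,\eta_U^2)\qquad\text{as } t\to\infty.$$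
   Context: $B$ is a standard Brownian motion. $L$ and $U$ are the minimal nondecreasing continuous processes, started at $0$, that keep $Z_t\in[0,d]$ for all $t\geqslant 0$; they satisfy $\int_{[0,T]}\mathbf{1}_{\{Z_t>0\}}\,\mathrm{d}L_t=0$ and $\int_{[0,T]}\mathbf{1}_{\{Z_t<d\}}\,\mathrm{d}U_t=0$ for every $T>0$. The doubly reflected equation has a unique strong solution. The stationary distribution $\pi$ of $Z$ is the Normal distribution with mean $\alpha/\gamma$ and variance $\sigma^2/(2\gamma)$ conditioned to lie in $[0,d]$, i.e. it has density $$\pi(x)=\sqrt{\frac{2\gamma}{\sigma^{2}}}\,\frac{\varphi\left((x-\frac{\alpha}{\gamma})\sqrt{2\gamma/\sigma^{2}}\right)}{\Phi\left((d-\frac{\alpha}{\gamma})\sqrt{2\gamma/\sigma^{2}}\right)-\Phi\left(-\frac{\alpha}{\gamma}\sqrt{2\gamma/\sigma^{2}}\right)},\qquad 0\leqslant x\leqslant d,$$ with $\varphi,\Phi$ the standard Normal density and distribution function. $\Rightarrow$ denotes convergence in distribution and $\mathcal{N}(0,\eta^2)$ the Normal law with mean $0$ and variance $\eta^2$. *)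

theory Defs
  imports "HOL-Probability.Probability"
begin

section \<open>Brownian motion\<close>

text \<open>Processes are functions of time and sample point; only times \<open>t \<ge> 0\<close> matter.\<close>

definition standard_brownian_motion :: "'a measure \<Rightarrow> (real \<Rightarrow> 'a \<Rightarrow> real) \<Rightarrow> bool" where
  "standard_brownian_motion M B \<longleftrightarrow>
     prob_space M \<and>
     (\<forall>t\<ge>0. B t \<in> borel_measurable M) \<and>
     (AE \<omega> in M. B 0 \<omega> = 0) \<and>
     (\<forall>s t. 0 \<le> s \<and> s < t \<longrightarrow>
        distributed M lborel (\<lambda>\<omega>. B t \<omega> - B s \<omega>) (normal_density 0 (sqrt (t - s)))) \<and>
     (\<forall>(\<tau> :: nat \<Rightarrow> real) n. 0 \<le> \<tau> 0 \<and> (\<forall>i<n. \<tau> i \<le> \<tau> (Suc i)) \<longrightarrow>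
        prob_space.indep_vars M (\<lambda>_. borel) (\<lambda>i \<omega>. B (\<tau> (Suc i)) \<omega> - B (\<tau> i) \<omega>) {..<n}) \<and>
     (AE \<omega> in M. continuous_on {0..} (\<lambda>t. B t \<omega>))"

text \<open>The natural filtration of \<open>B\<close>, augmented by the null sets of \<open>M\<close>.\<close>

definition brownian_filtration :: "'a measure \<Rightarrow> (real \<Rightarrow> 'a \<Rightarrow> real) \<Rightarrow> real \<Rightarrow> 'a measure" where
  "brownian_filtration M B t =
     sigma (space M)
       ({B s -` A \<inter> space M | s A. 0 \<le> s \<and> s \<le> t \<and> A \<in> sets borel} \<union> null_sets M)"

definition adapted_process ::
  "(real \<Rightarrow> 'a measure) \<Rightarrow> (real \<Rightarrow> 'a \<Rightarrow> real) \<Rightarrow> bool" where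
  "adapted_process F X \<longleftrightarrow> (\<forall>t\<ge>0. X t \<in> borel_measurable (F t))"

section \<open>The doubly reflected Ornstein-Uhlenbeck process\<close>

text \<open>
  The Lebesgue-Stieltjes measure of a nondecreasing continuous function on \<open>[0,\<infinity>)\<close>.
  Extending the function by its value at \<open>0\<close> to negative times gives the measure no
  mass on \<open>(-\<infinity>,0]\<close>.
\<close>

definition stieltjes :: "(real \<Rightarrow> real) \<Rightarrow> real measure" where
  "stieltjes f = interval_measure (\<lambda>t. f (max 0 t))"

definition regulator_path :: "(real \<Rightarrow> real) \<Rightarrow> bool" where
  "regulator_path f \<longleftrightarrow> f 0 = 0 \<and> mono_on {0..} f \<and> continuous_on {0..} f"

text \<open>
  The noise is additive, so the stochastic integral of the constant \<open>\<sigma>\<close> over \<open>[0,t]\<close> is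
  \<open>\<sigma> * B t\<close> and the equation is a pathwise one. The minimality of \<open>L\<close> and \<open>U\<close> is
  expressed by the two complementarity conditions: \<open>L\<close> grows only while \<open>Z\<close> is at \<open>0\<close>
  and \<open>U\<close> only while \<open>Z\<close> is at \<open>d\<close>.
\<close>

definition doubly_reflected_OU ::
  "'a measure \<Rightarrow> (real \<Rightarrow> 'a \<Rightarrow> real) \<Rightarrow> real \<Rightarrow> real \<Rightarrow> real \<Rightarrow> real \<Rightarrow> real \<Rightarrow>
   (real \<Rightarrow> 'a \<Rightarrow> real) \<Rightarrow> (real \<Rightarrow> 'a \<Rightarrow> real) \<Rightarrow> (real \<Rightarrow> 'a \<Rightarrow> real) \<Rightarrow> bool" where
  "doubly_reflected_OU M B \<alpha> \<gamma> \<sigma> d x Z L U \<longleftrightarrow>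
     adapted_process (brownian_filtration M B) Z \<and>
     adapted_process (brownian_filtration M B) L \<and>
     adapted_process (brownian_filtration M B) U \<and>
     (AE \<omega> in M.
        continuous_on {0..} (\<lambda>t. Z t \<omega>) \<and>
        regulator_path (\<lambda>t. L t \<omega>) \<and>
        regulator_path (\<lambda>t. U t \<omega>) \<and>
        (\<forall>t\<ge>0. Z t \<omega> \<in> {0..d}) \<and>
        (\<forall>t\<ge>0. Z t \<omega> = x + (LBINT s:{0..t}. \<alpha> - \<gamma> * Z s \<omega>) + \<sigma> * B t \<omega> + L t \<omega> - U t \<omega>) \<and>
        (\<forall>T>0. (\<integral>\<^sup>+ t\<in>{0..T}. indicator {t. Z t \<omega> > 0} t \<partial>stieltjes (\<lambda>t. L t \<omega>)) = 0) \<and>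
        (\<forall>T>0. (\<integral>\<^sup>+ t\<in>{0..T}. indicator {t. Z t \<omega> < d} t \<partial>stieltjes (\<lambda>t. U t \<omega>)) = 0))"

text \<open>
  A law \<open>\<pi>\<close> on \<open>[0,d]\<close> is stationary if it is invariant under the transition kernels
  \<open>P\<^sub>t(y,A) = P(Z\<^sub>t \<in> A | Z\<^sub>0 = y)\<close>. These are obtained from the solutions
  started at the points \<open>y\<close> and driven by \<open>B\<close>; by pathwise uniqueness they do not depend
  on the choice of the family \<open>Z\<close>.
\<close>

definition stationary_distribution ::
  "'a measure \<Rightarrow> (real \<Rightarrow> 'a \<Rightarrow> real) \<Rightarrow> real \<Rightarrow> real \<Rightarrow> real \<Rightarrow> real \<Rightarrow> real measure \<Rightarrow> bool" where
  "stationary_distribution M B \<alpha> \<gamma> \<sigma> d \<pi> \<longleftrightarrow>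
     prob_space \<pi> \<and> sets \<pi> = sets borel \<and> (AE y in \<pi>. y \<in> {0..d}) \<and>
     (\<exists>Z :: real \<Rightarrow> real \<Rightarrow> 'a \<Rightarrow> real.
        (\<forall>y\<in>{0..d}. \<exists>L U. doubly_reflected_OU M B \<alpha> \<gamma> \<sigma> d y (Z y) L U) \<and>
        (\<forall>t\<ge>0. \<forall>A\<in>sets borel.
           (\<integral>\<^sup>+ y\<in>{0..d}. emeasure M {\<omega>\<in>space M. Z y t \<omega> \<in> A} \<partial>\<pi>) = emeasure \<pi> A))"

section \<open>The constants of the central limit theorem\<close>

definition W :: "real \<Rightarrow> real \<Rightarrow> real \<Rightarrow> real \<Rightarrow> real" where
  "W \<alpha> \<gamma> \<sigma> v = exp (2 * \<alpha> * v / \<sigma>\<^sup>2 - \<gamma> * v\<^sup>2 / \<sigma>\<^sup>2)"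

definition q_U :: "real \<Rightarrow> real \<Rightarrow> real \<Rightarrow> real \<Rightarrow> real" where
  "q_U \<alpha> \<gamma> \<sigma> d = \<sigma>\<^sup>2 / 2 * (W \<alpha> \<gamma> \<sigma> d / (LBINT v=0..d. W \<alpha> \<gamma> \<sigma> v))"

definition h :: "real \<Rightarrow> real \<Rightarrow> real \<Rightarrow> real \<Rightarrow> real \<Rightarrow> real" where
  "h \<alpha> \<gamma> \<sigma> d x =
     2 * q_U \<alpha> \<gamma> \<sigma> d / \<sigma>\<^sup>2 * (LBINT u=0..x. (LBINT v=0..u. W \<alpha> \<gamma> \<sigma> v / W \<alpha> \<gamma> \<sigma> u))"

text \<open>
  The oriented integrals make \<open>h\<close> differentiable on the whole line, so \<open>deriv\<close> is
  meaningful at the endpoints \<open>0\<close> and \<open>d\<close> too.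
\<close>

definition eta_U_squared :: "real \<Rightarrow> real \<Rightarrow> real \<Rightarrow> real \<Rightarrow> real measure \<Rightarrow> real" where
  "eta_U_squared \<alpha> \<gamma> \<sigma> d \<pi> = \<sigma>\<^sup>2 * (LINT x:{0..d}|\<pi>. (deriv (h \<alpha> \<gamma> \<sigma> d) x)\<^sup>2)"

section \<open>Convergence in distribution\<close>

text \<open>
  \<^const>\<open>weak_conv_m\<close> covers sequences only; this is its definition with an arbitrary
  filter in place of \<^const>\<open>sequentially\<close>.
\<close>

definition converges_in_law :: "('i \<Rightarrow> real measure) \<Rightarrow> real measure \<Rightarrow> 'i filter \<Rightarrow> bool" where
  "converges_in_law \<mu> \<nu> F \<longleftrightarrow>
     (\<forall>x. isCont (cdf \<nu>) x \<longrightarrow> ((\<lambda>i. cdf (\<mu> i) x) \<longlongrightarrow> cdf \<nu> x) F)"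

lemma converges_in_law_sequentially: "converges_in_law \<mu> \<nu> sequentially \<longleftrightarrow> weak_conv_m \<mu> \<nu>"
  by (simp add: converges_in_law_def weak_conv_m_def weak_conv_def)

text \<open>The normal law with mean \<open>m\<close> and variance \<open>v > 0\<close>; \<^const>\<open>normal_density\<close> takes
  the standard deviation.\<close>

definition normal_law :: "real \<Rightarrow> real \<Rightarrow> real measure" where
  "normal_law m v = density lborel (normal_density m (sqrt v))"

end

theory Submission
  imports Defs
begin

text \<open>
  With \<open>l = \<theta> / sqrt T\<close> and a solution \<open>k\<close> of the Poisson equation
  \<open>\<sigma>\<^sup>2/2 * k'' + (\<alpha> - \<gamma> * z) * k' = (\<eta>\<^sup>2 - \<sigma>\<^sup>2 * h'\<^sup>2) / 2\<close>, \<open>k' 0 = k' d = 0\<close>, the process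
  \<open>exp (\<i> * l * (U t - q * t) + l\<^sup>2 * \<eta>\<^sup>2 * t / 2) * w (Z t)\<close> with
  \<open>w = exp (\<i> * l * h - l\<^sup>2 * k)\<close> is a martingale up to a drift of order \<open>l\<^sup>3\<close>:
  \<open>w' 0 = 0\<close> and \<open>w' d = \<i> * l * w d\<close> cancel the boundary terms. Over \<open>[0,T]\<close> the drift
  contributes \<open>O(T * l\<^sup>3)\<close>, and \<open>w \<rightarrow> 1\<close>, so the characteristic function of
  \<open>(U T - q * T) / sqrt T\<close> tends to that of the normal law. No ergodic theorem is needed:
  Dynkin's formula for \<open>k\<close>, integrated against \<open>\<pi>\<close>, shows that the \<open>\<eta>\<^sup>2\<close> that makes the
  Poisson equation solvable is \<open>\<sigma>\<^sup>2 * \<integral> h'\<^sup>2 d\<pi>\<close>.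

  Dynkin's formula itself is proved without stochastic integration, on a grid. In each cell
  the increment of the functional is split at \<open>Z s + \<sigma> * (B t - B s)\<close>: the Brownian part is
  a Taylor expansion in an increment independent of the past, the remaining part is a first
  order expansion along a path of bounded variation. As soon as the mesh resolves the
  modulus of continuity of the path, \<open>L\<close> and \<open>U\<close> increase only in cells in which \<open>Z\<close> is
  near the boundary, where the boundary conditions make their contribution small. Stopping
  the sum once \<open>L + U\<close> exceeds \<open>K\<close> provides the domination, so that no moments of \<open>L\<close> and
  \<open>U\<close> are needed.
\<close>

section \<open>Independence of Brownian increments from the past\<close>

text \<open>Formally \<open>U t - q * t = h x - h (Z t) + m t\<close> with a martingale
  \<open>m\<close> of bracket \<open>\<sigma>\<^sup>2 * \<integral> h' (Z s)\<^sup>2 ds\<close>,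
  because \<open>h\<close> solves \<open>b * h' + \<sigma>\<^sup>2/2 * h'' = q\<close> with
  \<open>h' 0 = 0\<close> and \<open>h' d = 1\<close>. The bracket is random; the corrector
  \<open>k\<close> trades it for its mean rate, and since
  \<open>(\<i> * l)\<^sup>2 = - l\<^sup>2\<close>, one exponential of
  \<open>\<i> * l * h - l\<^sup>2 * k\<close> removes the terms of order \<open>l\<close> and
  \<open>l\<^sup>2\<close> at once. Three obstacles shape the rest. The split point
  \<open>Z s + \<sigma> * (B t - B s)\<close> leaves \<open>{0..d}\<close>, so the test functions
  are extended to bounded functions on the line. The definition of stationarity integrates
  transition probabilities that are not known to be measurable in the starting point, so every
  integral against \<open>\<pi>\<close> goes through an almost everywhere version. Finally, Dynkin's
  formula keeps Riemann sums of expectations in place of a time integral, which suits both of its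
  uses.\<close>

lemma bm_prob_space: "standard_brownian_motion M B \<Longrightarrow> prob_space M"
  by (simp add: standard_brownian_motion_def)

lemma bm_measurable: "standard_brownian_motion M B \<Longrightarrow> 0 \<le> t \<Longrightarrow> B t \<in> borel_measurable M"
  by (simp add: standard_brownian_motion_def)

lemma space_brownian_filtration [simp]: "space (brownian_filtration M B t) = space M"
  by (auto simp: brownian_filtration_def intro!: space_measure_of dest: null_sets.sets_into_space)

lemma sets_brownian_filtration:
  assumes "standard_brownian_motion M B"
  shows "sets (brownian_filtration M B t) = sigma_sets (space M)
      ({B s -` A \<inter> space M | s A. 0 \<le> s \<and> s \<le> t \<and> A \<in> sets borel} \<union> null_sets M)"
  unfolding brownian_filtration_def
  using sets.sets_into_space by (intro sets_measure_of) (auto simp: null_sets_def)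

lemma brownian_filtration_subset:
  assumes "standard_brownian_motion M B"
  shows "sets (brownian_filtration M B t) \<subseteq> sets M"
  unfolding sets_brownian_filtration[OF assms]
  using bm_measurable[OF assms]
  by (intro sets.sigma_sets_subset) (auto simp: null_sets_def intro: measurable_sets)

lemma measurable_brownian_filtration:
  assumes "standard_brownian_motion M B" "X \<in> borel_measurable (brownian_filtration M B t)"
  shows "X \<in> borel_measurable M"
  using assms(2) brownian_filtration_subset[OF assms(1), of t]
  unfolding measurable_def by auto

text \<open>By definition the increments of \<open>B\<close> are independent only along a finite
  grid. Sorting \<open>J\<close> together with 0 and \<open>s\<close> and appending \<open>t\<close>
  gives a grid on which the cylinder event depends on partial sums of all increments but the last,
  and the last one is \<open>B t - B s\<close>.\<close>

lemma cylinder_indep_increment: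
  fixes M :: "'a measure" and B :: "real \<Rightarrow> 'a \<Rightarrow> real"
  assumes bm: "standard_brownian_motion M B" and st: "0 \<le> s" "s < t"
    and J: "finite J" "J \<subseteq> {0..s}" and A: "\<And>r. r \<in> J \<Longrightarrow> A r \<in> sets borel"
    and C: "C \<in> sets borel"
  shows "measure M ((\<Inter>r\<in>J. B r -` A r) \<inter> space M \<inter> ((\<lambda>\<omega>. B t \<omega> - B s \<omega>) -` C \<inter> space M)) =
    measure M ((\<Inter>r\<in>J. B r -` A r) \<inter> space M) * measure M ((\<lambda>\<omega>. B t \<omega> - B s \<omega>) -` C \<inter> space M)"
proof -
  interpret prob_space M using bm by (rule bm_prob_space)
  \<comment> \<open>0 lets the partial sums start at \<open>B 0\<close>, which vanishes almost
    surely; \<open>s\<close> makes the last grid interval \<open>[s,t]\<close>.\<close>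
  define l where "l = sorted_list_of_set (J \<union> {0,s})"
  define m where "m = length l"
  \<comment> \<open>From index \<open>m\<close> on the grid stays at \<open>t\<close>, so the
    increments over \<open>{..<m}\<close> end with the one over \<open>[s,t]\<close>.\<close>
  define \<tau> where "\<tau> i = (if i < m then l ! i else t)" for i
  define X where "X i \<omega> = B (\<tau> (Suc i)) \<omega> - B (\<tau> i) \<omega>" for i \<omega>
  have setl: "set l = J \<union> {0,s}" and srt: "sorted l" using J unfolding l_def by (simp_all only: set_sorted_list_of_set finite_Un finite_insert finite.emptyI sorted_sorted_list_of_set)
  have lrange: "l ! i \<in> {0..s}" if "i < m" for i
    using that setl J st nth_mem[of i l] by (auto simp: m_def)
  have mpos: "0 < m" using setl by (cases l) (auto simp: m_def)
  have l0: "l ! 0 = 0"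
  proof -
    obtain i where "i < m" "l ! i = 0" using setl by (metis UnCI in_set_conv_nth insertI1 m_def)
    then have "l ! 0 \<le> 0" using sorted_nth_mono[OF srt, of 0 i] by (simp add: m_def)
    then show ?thesis using lrange[OF mpos] by auto
  qed
  have lm: "l ! (m - 1) = s"
  proof -
    obtain i where i: "i < m" "l ! i = s" using setl
      by (metis UnCI in_set_conv_nth insertI1 insert_commute m_def)
    then have "s \<le> l ! (m-1)" using sorted_nth_mono[OF srt, of i "m-1"] by (simp add: m_def)
    then show ?thesis using lrange[of "m-1"] mpos by auto
  qed
  have \<tau>0: "\<tau> 0 = 0" using mpos l0 by (simp add: \<tau>_def)
  have \<tau>nn: "0 \<le> \<tau> i" for i using lrange[of i] st by (auto simp: \<tau>_def)
  have "\<tau> i \<le> \<tau> (Suc i)" for i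
    using sorted_nth_mono[OF srt, of i "Suc i"] lrange[of i] st by (auto simp: \<tau>_def m_def)
  then have iv: "indep_vars (\<lambda>_. borel) X {..<m}"
    using bm \<tau>0 unfolding standard_brownian_motion_def X_def by auto
  have Xm[measurable]: "X i \<in> borel_measurable M" for i
    unfolding X_def using bm_measurable[OF bm] \<tau>nn by (intro borel_measurable_diff) auto
  have D: "X (m-1) = (\<lambda>\<omega>. B t \<omega> - B s \<omega>)"
    using mpos lm by (auto simp: X_def \<tau>_def)
  let ?I = "{..<m-1}" and ?R = "\<lambda>\<omega>. restrict (\<lambda>i. X i \<omega>) {..<m-1}"
  have iv2: "indep_var (PiM ?I (\<lambda>_. borel)) ?R (PiM {m-1} (\<lambda>_. borel)) (\<lambda>\<omega>. restrict (\<lambda>i. X i \<omega>) {m-1})"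
    using mpos by (intro indep_var_restrict[OF iv]) auto
  define Y where "Y = {f \<in> space (PiM ?I (\<lambda>_. borel :: real measure)). \<forall>i\<in>{i. i < m \<and> l ! i \<in> J}. (\<Sum>k<i. f k) \<in> A (l ! i)}"
  have Ys: "Y \<in> sets (PiM ?I (\<lambda>_. borel))"
    unfolding Y_def
  proof (intro sets.sets_Collect_finite_All)
    fix i assume i: "i \<in> {i. i < m \<and> l ! i \<in> J}"
    have "(\<lambda>f. \<Sum>k<i. f k) \<in> borel_measurable (PiM ?I (\<lambda>_. borel :: real measure))"
      using i by (intro borel_measurable_sum measurable_component_singleton) auto
    from measurable_sets[OF this A[of "l ! i"]] i
    show "{f \<in> space (PiM ?I (\<lambda>_. borel)). (\<Sum>k<i. f k) \<in> A (l ! i)} \<in> sets (PiM ?I (\<lambda>_. borel))"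
      by (simp add: vimage_def Int_def conj_commute)
  qed auto
  let ?E = "?R -` Y \<inter> space M" and ?cyl = "(\<Inter>r\<in>J. B r -` A r) \<inter> space M" and ?D = "X (m-1) -` C \<inter> space M"
  have Rm: "?R \<in> measurable M (PiM ?I (\<lambda>_. borel))" by (intro measurable_restrict) auto
  have Em: "?E \<in> sets M" using measurable_sets[OF Rm Ys] .
  have Dm: "?D \<in> sets M" using C by simp
  have cylm: "?cyl \<in> sets M"
  proof -
    have "{\<omega> \<in> space M. \<forall>r\<in>J. B r \<omega> \<in> A r} \<in> sets M"
    proof (intro sets.sets_Collect_finite_All)
      fix r assume "r \<in> J"
      then show "{\<omega> \<in> space M. B r \<omega> \<in> A r} \<in> sets M"
        using measurable_sets[OF bm_measurable[OF bm, of r] A[of r]] J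
        by (auto simp: vimage_def Int_def conj_commute)
    qed (use J in auto)
    also have "{\<omega> \<in> space M. \<forall>r\<in>J. B r \<omega> \<in> A r} = ?cyl" by auto
    finally show ?thesis .
  qed
  have tel: "(\<Sum>k<i. X k \<omega>) = B (l ! i) \<omega> - B 0 \<omega>" if "i < m" for i \<omega>
    using that sum_lessThan_telescope[of "\<lambda>k. B (\<tau> k) \<omega>" i] \<tau>0
    by (simp add: X_def \<tau>_def[of i])
  have "AE \<omega> in M. B 0 \<omega> = 0" using bm by (simp add: standard_brownian_motion_def)
  \<comment> \<open>The two events agree only up to a null set, because \<open>B 0 = 0\<close> is an
    almost sure statement.\<close>
  then have ae: "AE \<omega> in M. \<omega> \<in> ?E \<longleftrightarrow> \<omega> \<in> ?cyl"
  proof eventually_elim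
    case (elim \<omega>)
    have "?R \<omega> \<in> Y \<longleftrightarrow> (\<forall>i. i < m \<and> l ! i \<in> J \<longrightarrow> (\<Sum>k<i. X k \<omega>) \<in> A (l ! i))"
    proof -
      have "(\<Sum>k<i. ?R \<omega> k) = (\<Sum>k<i. X k \<omega>)" if "i < m" for i
        using that by (intro sum.cong) auto
      moreover have "?R \<omega> \<in> space (PiM ?I (\<lambda>_. borel))" by (simp add: space_PiM)
      ultimately show ?thesis unfolding Y_def by (simp add: Ball_def conj_imp_eq_imp_imp)
    qed
    also have "\<dots> \<longleftrightarrow> (\<forall>r\<in>J. B r \<omega> \<in> A r)"
    proof -
      have "\<exists>i<m. l ! i = r" if "r \<in> J" for r
        using that setl by (metis UnCI in_set_conv_nth m_def)
      then show ?thesis using tel elim by fastforce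
    qed
    finally show ?case by auto
  qed
  have "prob (?E \<inter> ?D) = prob ?E * prob ?D"
  proof -
    let ?L = "\<lambda>\<omega>. restrict (\<lambda>i. X i \<omega>) {m-1}"
    define C' where "C' = {f \<in> space (PiM {m-1} (\<lambda>_. borel :: real measure)). f (m-1) \<in> C}"
    have C': "C' \<in> sets (PiM {m-1} (\<lambda>_. borel))"
      unfolding C'_def using C
      by (intro measurable_sets_Collect[of "\<lambda>f. f (m-1)" _ borel] measurable_component_singleton) auto
    have "prob ((\<lambda>x. (?R x, ?L x)) -` (Y \<times> C') \<inter> space M) = prob ?E * prob (?L -` C' \<inter> space M)"
      using indep_varD[OF iv2 Ys C'] by simp
    moreover have "?L -` C' \<inter> space M = ?D"
      unfolding C'_def by (auto simp: space_PiM)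
    moreover have "(\<lambda>x. (?R x, ?L x)) -` (Y \<times> C') \<inter> space M = ?E \<inter> (?L -` C' \<inter> space M)" by auto
    ultimately show ?thesis by simp
  qed
  moreover have "prob ?E = prob ?cyl"
    using ae Em cylm by (intro finite_measure_eq_AE) auto
  moreover have "prob (?E \<inter> ?D) = prob (?cyl \<inter> ?D)"
    using ae Em cylm Dm by (intro finite_measure_eq_AE) auto
  ultimately show ?thesis unfolding D by simp
qed

text \<open>Cylinders and null sets together form an intersection-stable generator of the augmented
  filtration: meeting a null set gives a null set, and two cylinders meet in a cylinder. Null sets
  are independent of everything, so independence passes from the generator to the
  sigma-algebra.\<close>

lemma brownian_increment_indep_set:
  fixes M :: "'a measure" and B :: "real \<Rightarrow> 'a \<Rightarrow> real"
  assumes bm: "standard_brownian_motion M B" and st: "0 \<le> s" "s < t"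
  shows "prob_space.indep_set M (sets (brownian_filtration M B s))
     (sigma_sets (space M) {(\<lambda>\<omega>. B t \<omega> - B s \<omega>) -` C \<inter> space M | C. C \<in> sets borel})"
proof -
  interpret prob_space M using bm by (rule bm_prob_space)
  let ?D = "\<lambda>\<omega>. B t \<omega> - B s \<omega>"
  let ?H = "{?D -` C \<inter> space M | C. C \<in> sets borel}"
  define cyl where "cyl = {(\<Inter>r\<in>J. B r -` A r) \<inter> space M | J A. finite J \<and> J \<subseteq> {0..s} \<and> (\<forall>r\<in>J. A r \<in> sets borel)}"
  have Dm: "?D \<in> borel_measurable M"
    using bm_measurable[OF bm] st by (intro borel_measurable_diff) auto
  have H: "?H \<subseteq> events" using measurable_sets[OF Dm] by auto
  have cyl: "cyl \<subseteq> events"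
  proof
    fix a assume "a \<in> cyl"
    then obtain J A where a: "a = (\<Inter>r\<in>J. B r -` A r) \<inter> space M" and JA: "finite J" "J \<subseteq> {0..s}" "\<forall>r\<in>J. A r \<in> sets borel"
      by (auto simp: cyl_def)
    have "{\<omega> \<in> space M. \<forall>r\<in>J. B r \<omega> \<in> A r} \<in> sets M"
    proof (intro sets.sets_Collect_finite_All)
      fix r assume "r \<in> J"
      then show "{\<omega> \<in> space M. B r \<omega> \<in> A r} \<in> sets M"
        using measurable_sets[OF bm_measurable[OF bm, of r], of "A r"] JA
        by (auto simp: vimage_def Int_def conj_commute)
    qed (use JA in auto)
    also have "{\<omega> \<in> space M. \<forall>r\<in>J. B r \<omega> \<in> A r} = a" unfolding a by auto
    finally show "a \<in> events" .
  qed
  have G: "cyl \<union> null_sets M \<subseteq> events" using cyl by auto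
  have prod: "prob (a \<inter> b) = prob a * prob b" if a: "a \<in> cyl \<union> null_sets M" and b: "b \<in> ?H" for a b
  proof -
    obtain C where C: "C \<in> sets borel" "b = ?D -` C \<inter> space M" using b by auto
    show ?thesis
    proof (cases "a \<in> null_sets M")
      case True
      have "b \<in> events" using b H by auto
      then have "a \<inter> b \<in> null_sets M" using True by (auto intro: null_set_Int1 null_set_Int2)
      then show ?thesis using True by (simp add: measure_eq_0_null_sets)
    next
      case False
      then show ?thesis using a C cylinder_indep_increment[OF bm st _ _ _ C(1)]
        unfolding cyl_def by auto
    qed
  qed
  have "indep_set (cyl \<union> null_sets M) ?H" using G H prod by (intro indep_setI) auto
  moreover have "Int_stable (cyl \<union> null_sets M)"
  proof (rule Int_stableI)
    fix a b assume ab: "a \<in> cyl \<union> null_sets M" "b \<in> cyl \<union> null_sets M"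
    show "a \<inter> b \<in> cyl \<union> null_sets M"
    proof (cases "a \<in> null_sets M \<or> b \<in> null_sets M")
      case True
      have "a \<in> events" "b \<in> events" using ab G by auto
      then have "a \<inter> b \<in> null_sets M" using True by (auto intro: null_set_Int1 null_set_Int2)
      then show ?thesis by simp
    next
      case False
      then obtain J A J' A' where a: "a = (\<Inter>r\<in>J. B r -` A r) \<inter> space M" "finite J" "J \<subseteq> {0..s}" "\<forall>r\<in>J. A r \<in> sets borel"
        and b: "b = (\<Inter>r\<in>J'. B r -` A' r) \<inter> space M" "finite J'" "J' \<subseteq> {0..s}" "\<forall>r\<in>J'. A' r \<in> sets borel"
        using ab unfolding cyl_def by blast
      \<comment> \<open>A time that belongs to only one index set is left unconstrained by the other
        cylinder.\<close>
      let ?A = "\<lambda>r. (if r \<in> J then A r else UNIV) \<inter> (if r \<in> J' then A' r else UNIV)"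
      have "a \<inter> b = (\<Inter>r\<in>J \<union> J'. B r -` ?A r) \<inter> space M"
        unfolding a(1) b(1) by (auto split: if_splits)
      moreover have "finite (J \<union> J') \<and> J \<union> J' \<subseteq> {0..s} \<and> (\<forall>r\<in>J \<union> J'. ?A r \<in> sets borel)"
        using a b by auto
      ultimately have "a \<inter> b \<in> cyl"
        unfolding cyl_def by (intro CollectI exI[of _ "J \<union> J'"] exI[of _ ?A] conjI) simp_all
      then show ?thesis by simp
    qed
  qed
  moreover have "Int_stable ?H"
  proof (rule Int_stableI)
    fix a b assume "a \<in> ?H" "b \<in> ?H"
    then obtain C C' where C: "a = ?D -` C \<inter> space M" "b = ?D -` C' \<inter> space M" "C \<in> sets borel" "C' \<in> sets borel" by auto
    then have "a \<inter> b = ?D -` (C \<inter> C') \<inter> space M" by auto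
    then show "a \<inter> b \<in> ?H" using C by blast
  qed
  ultimately have ind: "indep_set (sigma_sets (space M) (cyl \<union> null_sets M)) (sigma_sets (space M) ?H)"
    by (rule indep_set_sigma_sets)
  have sub: "sets (brownian_filtration M B s) \<subseteq> sigma_sets (space M) (cyl \<union> null_sets M)"
    unfolding sets_brownian_filtration[OF bm]
  proof (rule sigma_sets_mono', rule Un_mono)
    show "{B r -` A \<inter> space M |r A. 0 \<le> r \<and> r \<le> s \<and> A \<in> sets borel} \<subseteq> cyl"
    proof clarsimp
      fix r and A :: "real set" assume "0 \<le> r" "r \<le> s" "A \<in> sets borel"
      then show "B r -` A \<inter> space M \<in> cyl"
        unfolding cyl_def by (intro CollectI exI[of _ "{r}"] exI[of _ "\<lambda>_. A"]) auto
    qed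
  qed simp
  show ?thesis
    using ind sub unfolding indep_set_def
    by (rule_tac indep_sets_mono_sets) (auto split: bool.splits)
qed

lemma brownian_increment_indep_var:
  fixes X :: "'a \<Rightarrow> complex" and f :: "real \<Rightarrow> complex"
  assumes bm: "standard_brownian_motion M B" and st: "0 \<le> s" "s < t"
    and X: "X \<in> borel_measurable (brownian_filtration M B s)" and f: "f \<in> borel_measurable borel"
  shows "prob_space.indep_var M borel X borel (\<lambda>\<omega>. f (B t \<omega> - B s \<omega>))"
proof -
  interpret prob_space M using bm by (rule bm_prob_space)
  let ?D = "\<lambda>\<omega>. B t \<omega> - B s \<omega>"
  have Dm: "?D \<in> borel_measurable M"
    using bm_measurable[OF bm] st by (intro borel_measurable_diff) auto
  have fD: "(\<lambda>\<omega>. f (?D \<omega>)) \<in> borel_measurable M"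
    using measurable_compose[OF Dm f] .
  have "{X -` A \<inter> space M | A. A \<in> sets borel} \<subseteq> sets (brownian_filtration M B s)"
    using measurable_sets[OF X] by auto
  then have 1: "sigma_sets (space M) {X -` A \<inter> space M | A. A \<in> sets borel} \<subseteq> sets (brownian_filtration M B s)"
    using sets.sigma_sets_subset[of _ "brownian_filtration M B s"] by simp
  have sub: "{(\<lambda>\<omega>. f (?D \<omega>)) -` A \<inter> space M | A. A \<in> sets borel} \<subseteq>
      {?D -` C \<inter> space M | C. C \<in> sets borel}"
  proof (rule subsetI)
    fix E assume "E \<in> {(\<lambda>\<omega>. f (?D \<omega>)) -` A \<inter> space M | A. A \<in> sets borel}"
    then obtain A where A: "A \<in> sets borel" "E = (\<lambda>\<omega>. f (?D \<omega>)) -` A \<inter> space M" by auto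
    have "f -` A \<in> sets borel" using measurable_sets[OF f A(1)] by simp
    moreover have "E = ?D -` (f -` A) \<inter> space M" using A(2) by auto
    ultimately show "E \<in> {?D -` C \<inter> space M | C. C \<in> sets borel}" by auto
  qed
  note 2 = sigma_sets_mono'[OF sub, of "space M"]
  show ?thesis
    unfolding indep_var_eq
  proof (intro conjI)
    show "indep_set (sigma_sets (space M) {X -` A \<inter> space M | A. A \<in> sets borel})
        (sigma_sets (space M) {(\<lambda>\<omega>. f (?D \<omega>)) -` A \<inter> space M | A. A \<in> sets borel})"
      using brownian_increment_indep_set[OF bm st] unfolding indep_set_def
      by (rule indep_sets_mono_sets) (use 1 2 in \<open>simp split: bool.split\<close>)
  qed (use fD measurable_brownian_filtration[OF bm X] in auto)
qed

text \<open>These are the moments that a second-order Taylor expansion consumes: the first vanishes,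
  the second cancels the compensator in \<open>gauss\<close>, and the third absolute one, of order
  \<open>t - s\<close> to the power 3/2, controls the remainder.\<close>

lemma brownian_increment_moments:
  assumes bm: "standard_brownian_motion M B" and st: "0 \<le> s" "s < t"
  defines "D \<equiv> \<lambda>\<omega>. B t \<omega> - B s \<omega>"
  shows "integrable M (\<lambda>\<omega>. D \<omega> ^ k)" and "integrable M (\<lambda>\<omega>. \<bar>D \<omega>\<bar> ^ k)"
    and "(\<integral>\<omega>. D \<omega> \<partial>M) = 0" and "(\<integral>\<omega>. D \<omega> ^ 2 \<partial>M) = t - s"
    and "(\<integral>\<omega>. \<bar>D \<omega>\<bar> ^ 3 \<partial>M) = 2 * sqrt (2 / pi) * sqrt (t - s) ^ 3"
proof -
  interpret prob_space M using bm by (rule bm_prob_space)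
  have dist: "distributed M lborel D (normal_density 0 (sqrt (t - s)))"
    using bm st unfolding standard_brownian_motion_def D_def by blast
  have pos: "0 < sqrt (t - s)" using st by simp
  show "integrable M (\<lambda>\<omega>. D \<omega> ^ k)"
    using distributed_integrable[OF dist, of "\<lambda>x. x ^ k"] integrable_normal_moment[OF pos, of 0 k]
    by simp
  show "integrable M (\<lambda>\<omega>. \<bar>D \<omega>\<bar> ^ k)"
    using distributed_integrable[OF dist, of "\<lambda>x. \<bar>x\<bar> ^ k"] integrable_normal_moment_abs[OF pos, of 0 k]
    by simp
  show "(\<integral>\<omega>. D \<omega> \<partial>M) = 0"
    using distributed_integral[OF dist, of "\<lambda>x. x"] integral_normal_moment_odd[OF pos, of 0 0] by simp
  show "(\<integral>\<omega>. D \<omega> ^ 2 \<partial>M) = t - s"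
    using distributed_integral[OF dist, of "\<lambda>x. x ^ 2"] integral_normal_moment_even[OF pos, of 0 1] st
    by simp
  show "(\<integral>\<omega>. \<bar>D \<omega>\<bar> ^ 3 \<partial>M) = 2 * sqrt (2 / pi) * sqrt (t - s) ^ 3"
    using distributed_integral[OF dist, of "\<lambda>x. \<bar>x\<bar> ^ 3"] integral_normal_moment_abs_odd[OF pos, of 0 1]
    by (simp add: numeral_3_eq_3)
qed

lemma integral_mult_brownian_increment:
  fixes X :: "'a \<Rightarrow> complex"
  assumes bm: "standard_brownian_motion M B" and st: "0 \<le> s" "s < t"
    and X: "X \<in> borel_measurable (brownian_filtration M B s)" and bdd: "\<And>\<omega>. norm (X \<omega>) \<le> C"
  shows "integrable M (\<lambda>\<omega>. X \<omega> * complex_of_real ((B t \<omega> - B s \<omega>) ^ k))"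
    and "(\<integral>\<omega>. X \<omega> * complex_of_real ((B t \<omega> - B s \<omega>) ^ k) \<partial>M) =
           (\<integral>\<omega>. X \<omega> \<partial>M) * (\<integral>\<omega>. (B t \<omega> - B s \<omega>) ^ k \<partial>M)"
proof -
  interpret prob_space M using bm by (rule bm_prob_space)
  have iv: "indep_var borel X borel (\<lambda>\<omega>. complex_of_real ((B t \<omega> - B s \<omega>) ^ k))"
    by (rule brownian_increment_indep_var[OF bm st X, of "\<lambda>y. complex_of_real (y ^ k)"]) measurable
  have iX: "integrable M X"
    using measurable_brownian_filtration[OF bm X] bdd by (intro integrable_const_bound[of _ C]) auto
  have iD: "integrable M (\<lambda>\<omega>. complex_of_real ((B t \<omega> - B s \<omega>) ^ k))"
    by (intro integrable_of_real brownian_increment_moments(1)[OF bm st])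
  show "integrable M (\<lambda>\<omega>. X \<omega> * complex_of_real ((B t \<omega> - B s \<omega>) ^ k))"
    using indep_var_integrable[OF iv iX iD] .
  show "(\<integral>\<omega>. X \<omega> * complex_of_real ((B t \<omega> - B s \<omega>) ^ k) \<partial>M) =
           (\<integral>\<omega>. X \<omega> \<partial>M) * (\<integral>\<omega>. (B t \<omega> - B s \<omega>) ^ k \<partial>M)"
    using indep_var_lebesgue_integral[OF iv iX iD] by (simp only: integral_complex_of_real)
qed

section \<open>Test functions\<close>

lemma vector_mean_value_bound:
  fixes f :: "real \<Rightarrow> complex"
  assumes "\<And>r. (f has_vector_derivative f' r) (at r)"
    and "\<And>r. r \<in> closed_segment x y \<Longrightarrow> norm (f' r) \<le> K"
  shows "norm (f y - f x) \<le> K * \<bar>y - x\<bar>"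
proof -
  have "norm (f y - f x) \<le> K * norm (y - x)"
  proof (rule differentiable_bound[of "closed_segment x y" f "\<lambda>r h. h *\<^sub>R f' r"])
    fix r assume r: "r \<in> closed_segment x y"
    show "(f has_derivative (\<lambda>h. h *\<^sub>R f' r)) (at r within closed_segment x y)"
      using assms(1)[of r] has_vector_derivative_at_within[of f "f' r" r "closed_segment x y"]
      unfolding has_vector_derivative_def by blast
    show "onorm (\<lambda>h. h *\<^sub>R f' r) \<le> K"
      using assms(2)[OF r] by (intro onorm_le) (auto intro: mult_right_mono simp: mult.commute[of "\<bar>_\<bar>"])
  qed auto
  then show ?thesis by simp
qed

text \<open>Both bounds come from differentiating along the segment from 0 to \<open>z\<close>. Only
  \<open>Re z\<close> enters the constant: in a cell the imaginary part contains the increment of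
  \<open>U\<close>, which has no a priori bound.\<close>

lemma exp_minus_one_bounds:
  fixes z :: complex
  assumes "Re z \<le> m" "0 \<le> m"
  shows "norm (exp z - 1) \<le> exp m * norm z" and "norm (exp z - 1 - z) \<le> exp m * (norm z)\<^sup>2"
proof -
  have d: "((\<lambda>r. exp (of_real r * z)) has_vector_derivative z * exp (of_real r * z)) (at r)" for r :: real
    by (auto intro!: derivative_eq_intros has_vector_derivative_real_field)
  have e: "norm (exp (of_real r * z)) \<le> exp m" if "r \<in> {0..1}" for r
  proof -
    have "r * Re z \<le> r * m" using that assms by (intro mult_left_mono) auto
    also have "\<dots> \<le> 1 * m" using that assms by (intro mult_right_mono) auto
    finally have "r * Re z \<le> m" by simp
    then show ?thesis by (simp add: norm_exp_eq_Re)
  qed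
  have 1: "norm (exp (of_real y * z) - 1) \<le> exp m * norm z" if "y \<in> {0..1}" for y
  proof -
    have "norm (exp (of_real y * z) - exp (of_real 0 * z)) \<le> (norm z * exp m) * \<bar>y - 0\<bar>"
      using that by (intro vector_mean_value_bound[OF d])
        (auto simp: norm_mult closed_segment_eq_real_ivl simp del: norm_exp_eq_Re intro!: mult_left_mono e)
    also have "\<dots> \<le> (norm z * exp m) * 1" using that by (intro mult_left_mono) auto
    finally show ?thesis by (simp add: mult.commute)
  qed
  show "norm (exp z - 1) \<le> exp m * norm z" using 1[of 1] by simp
  have d2: "((\<lambda>r. exp (of_real r * z) - of_real r * z) has_vector_derivative z * exp (of_real r * z) - z) (at r)" for r :: real
    by (auto intro!: derivative_eq_intros has_vector_derivative_real_field)
  have "norm ((exp (of_real 1 * z) - of_real 1 * z) - (exp (of_real 0 * z) - of_real 0 * z)) \<le> (norm z * (exp m * norm z)) * \<bar>1 - 0\<bar>"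
  proof (rule vector_mean_value_bound[OF d2])
    fix r :: real assume r: "r \<in> closed_segment 0 1"
    have "norm (z * exp (of_real r * z) - z) = norm z * norm (exp (of_real r * z) - 1)"
      by (metis mult.right_neutral norm_mult right_diff_distrib)
    also have "\<dots> \<le> norm z * (exp m * norm z)"
      using r by (intro mult_left_mono 1) (auto simp: closed_segment_eq_real_ivl)
    finally show "norm (z * exp (of_real r * z) - z) \<le> norm z * (exp m * norm z)" .
  qed
  then show "norm (exp z - 1 - z) \<le> exp m * (norm z)\<^sup>2"
    by (simp add: power2_eq_square mult_ac diff_diff_eq add.commute)
qed

lemma segment_abs_le: "r \<in> closed_segment y z \<Longrightarrow> \<bar>r - y\<bar> \<le> \<bar>z - y\<bar>" for r y z :: real
  by (auto simp: closed_segment_eq_real_ivl split: if_splits)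

text \<open>The bounds are global because \<open>w\<close> is evaluated at
  \<open>Z s + \<sigma> * (B t - B s)\<close>, which leaves \<open>{0..d}\<close>. A Lipschitz
  second derivative stands in for a bounded third one in the cubic Taylor remainder, since the
  extensions used later are only \<open>C\<^sup>2\<close>.\<close>

locale test_function =
  fixes w w1 w2 :: "real \<Rightarrow> complex" and C :: real
  assumes w_deriv: "\<And>y. (w has_vector_derivative w1 y) (at y)"
    and w1_deriv: "\<And>y. (w1 has_vector_derivative w2 y) (at y)"
    and w_bound: "\<And>y. norm (w y) \<le> C" and w1_bound: "\<And>y. norm (w1 y) \<le> C"
    and w2_bound: "\<And>y. norm (w2 y) \<le> C"
    and w2_lipschitz: "\<And>y z. norm (w2 z - w2 y) \<le> C * \<bar>z - y\<bar>"
begin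

lemma C_nonneg: "0 \<le> C"
  using w_bound[of 0] norm_ge_zero order_trans by blast

lemma w_lipschitz: "norm (w z - w y) \<le> C * \<bar>z - y\<bar>"
  by (intro vector_mean_value_bound[OF w_deriv] w1_bound)

lemma w1_lipschitz: "norm (w1 z - w1 y) \<le> C * \<bar>z - y\<bar>"
  by (intro vector_mean_value_bound[OF w1_deriv] w2_bound)

text \<open>Kept general in \<open>f\<close> so that it serves both \<open>w\<close> and
  \<open>w1\<close>; the factor 1/2 is lost because the mean value inequality is used instead of
  integration.\<close>

lemma taylor1:
  assumes deriv: "\<And>y. (f has_vector_derivative f1 y) (at y)"
    and lip: "\<And>y z. norm (f1 z - f1 y :: complex) \<le> C * \<bar>z - y\<bar>"
  shows "norm (f z - f y - of_real (z - y) * f1 y) \<le> C * (z - y)\<^sup>2"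
proof -
  have d: "((\<lambda>r. f r - of_real (r - y) * f1 y) has_vector_derivative f1 r - f1 y) (at r)" for r
    by (auto intro!: derivative_eq_intros deriv has_vector_derivative_real_field)
  have "norm ((f z - of_real (z - y) * f1 y) - (f y - of_real (y - y) * f1 y)) \<le> (C * \<bar>z - y\<bar>) * \<bar>z - y\<bar>"
    using segment_abs_le
    by (intro vector_mean_value_bound[OF d] order_trans[OF lip] mult_left_mono C_nonneg) auto
  then show ?thesis by (simp add: power2_eq_square algebra_simps abs_mult_self_eq)
qed

lemmas w_taylor1 = taylor1[OF w_deriv w1_lipschitz]
lemmas w1_taylor1 = taylor1[OF w1_deriv w2_lipschitz]

lemma w_taylor2:
  "norm (w z - w y - of_real (z - y) * w1 y - of_real ((z - y)\<^sup>2 / 2) * w2 y) \<le> C * \<bar>z - y\<bar> ^ 3"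
proof -
  let ?f = "\<lambda>r. w r - of_real (r - y) * w1 y - of_real ((r - y)\<^sup>2 / 2) * w2 y"
  have d: "(?f has_vector_derivative w1 r - w1 y - of_real (r - y) * w2 y) (at r)" for r
    by (auto intro!: derivative_eq_intros w_deriv has_vector_derivative_real_field)
  have "norm (?f z - ?f y) \<le> (C * (z - y)\<^sup>2) * \<bar>z - y\<bar>"
    by (intro vector_mean_value_bound[OF d] order_trans[OF w1_taylor1] mult_left_mono C_nonneg)
       (use segment_abs_le in \<open>simp add: abs_le_square_iff\<close>)
  moreover have "(C * (z - y)\<^sup>2) * \<bar>z - y\<bar> = C * \<bar>z - y\<bar> ^ 3"
    by (simp add: power3_eq_cube power2_eq_square abs_mult_self_eq mult.assoc[symmetric])
  moreover have "?f z - ?f y = w z - w y - of_real (z - y) * w1 y - of_real ((z - y)\<^sup>2 / 2) * w2 y"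
    by simp
  ultimately show ?thesis by (simp only:)
qed

lemma continuous_w: "continuous_on A w" and continuous_w1: "continuous_on A w1"
  using w_deriv w1_deriv
  by (auto intro!: continuous_at_imp_continuous_on has_vector_derivative_continuous)

lemma continuous_w2: "continuous_on A w2"
proof -
  have "C-lipschitz_on A w2"
    using w2_lipschitz C_nonneg by (intro lipschitz_onI) (auto simp: dist_norm)
  then show ?thesis by (rule lipschitz_on_continuous_on)
qed

lemma measurable_w [measurable]: "w \<in> borel_measurable borel" "w1 \<in> borel_measurable borel" "w2 \<in> borel_measurable borel"
  using continuous_w continuous_w1 continuous_w2 by (auto intro: borel_measurable_continuous_onI)

end

section \<open>Reflected paths\<close>

text \<open>The increment \<open>f t - f s\<close> is the Stieltjes mass of \<open>{s<..t}\<close>,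
  and on this interval the integrand of the null integral equals 1.\<close>

lemma stieltjes_null_imp_eq:
  assumes f: "regulator_path f"
    and null: "(\<integral>\<^sup>+ t\<in>{0..T}. indicator {t. P t} t \<partial>stieltjes f) = 0"
    and st: "0 \<le> s" "s \<le> t" "t \<le> T" and P: "\<And>r. s < r \<Longrightarrow> r \<le> t \<Longrightarrow> P r"
  shows "f t = f s"
proof -
  let ?F = "\<lambda>t. f (max 0 t)"
  have mono: "f x \<le> f y" if "0 \<le> x" "x \<le> y" for x y
    using f that by (auto simp: regulator_path_def mono_on_def)
  have "continuous_on UNIV ?F"
    using f unfolding regulator_path_def
    by (intro continuous_on_compose2[of "{0..}" f UNIV "\<lambda>t. max 0 t"]) (auto intro!: continuous_intros)
  then have cont: "continuous (at_right a) ?F" for a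
    by (auto simp: continuous_on_eq_continuous_at intro: continuous_at_imp_continuous_at_within)
  have "emeasure (stieltjes f) {s<..t} = ennreal (?F t - ?F s)"
    unfolding stieltjes_def using st cont by (intro emeasure_interval_measure_Ioc) (auto intro!: mono)
  moreover have "emeasure (stieltjes f) {s<..t} = (\<integral>\<^sup>+ r. indicator {s<..t} r \<partial>stieltjes f)"
    by (simp add: stieltjes_def)
  moreover have "\<dots> \<le> (\<integral>\<^sup>+ t\<in>{0..T}. indicator {t. P t} t \<partial>stieltjes f)"
    using st P by (intro nn_integral_mono) (auto simp: indicator_def)
  ultimately have "ennreal (f t - f s) = 0" using null st by simp
  then show ?thesis using mono[of s t] st by (simp add: ennreal_eq_0_iff)
qed

text \<open>A single trajectory, with the noise \<open>B\<close> as a given continuous function.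
  Almost every sample path satisfies these assumptions, so all estimates inside grid cells are
  deterministic.\<close>

locale reflected_path =
  fixes \<alpha> \<gamma> \<sigma> d x :: real and B Z L U :: "real \<Rightarrow> real"
  assumes pos: "\<alpha> > 0" "\<gamma> > 0" "\<sigma> > 0" "d > 0"
    and continuous_B: "continuous_on {0..} B" and continuous_Z: "continuous_on {0..} Z"
    and regulator_L: "regulator_path L" and regulator_U: "regulator_path U"
    and Z_range: "\<And>t. 0 \<le> t \<Longrightarrow> Z t \<in> {0..d}"
    and equation: "\<And>t. 0 \<le> t \<Longrightarrow> Z t = x + (LBINT s:{0..t}. \<alpha> - \<gamma> * Z s) + \<sigma> * B t + L t - U t"
    and L_support: "\<And>T. 0 < T \<Longrightarrow> (\<integral>\<^sup>+ t\<in>{0..T}. indicator {t. Z t > 0} t \<partial>stieltjes L) = 0"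
    and U_support: "\<And>T. 0 < T \<Longrightarrow> (\<integral>\<^sup>+ t\<in>{0..T}. indicator {t. Z t < d} t \<partial>stieltjes U) = 0"
begin

lemma L_mono: "0 \<le> s \<Longrightarrow> s \<le> t \<Longrightarrow> L s \<le> L t"
  and U_mono: "0 \<le> s \<Longrightarrow> s \<le> t \<Longrightarrow> U s \<le> U t"
  using regulator_L regulator_U by (auto simp: regulator_path_def mono_on_def)

lemma continuous_L: "continuous_on {0..} L" and continuous_U: "continuous_on {0..} U"
  and L_0: "L 0 = 0" and U_0: "U 0 = 0"
  using regulator_L regulator_U by (auto simp: regulator_path_def)

text \<open>Applied in contrapositive form: if \<open>L\<close> grows in a cell, then
  \<open>Z\<close> visits 0 in that cell.\<close>

lemma L_flat:
  assumes "0 \<le> s" "s \<le> t" "\<And>r. s \<le> r \<Longrightarrow> r \<le> t \<Longrightarrow> Z r \<noteq> 0"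
  shows "L t = L s"
proof (rule stieltjes_null_imp_eq[OF regulator_L L_support[of "t + 1"]])
  show "0 < Z r" if "s < r" "r \<le> t" for r
    using assms(3)[of r] Z_range[of r] assms(1) that by auto
qed (use assms in auto)

lemma U_flat:
  assumes "0 \<le> s" "s \<le> t" "\<And>r. s \<le> r \<Longrightarrow> r \<le> t \<Longrightarrow> Z r \<noteq> d"
  shows "U t = U s"
proof (rule stieltjes_null_imp_eq[OF regulator_U U_support[of "t + 1"]])
  show "Z r < d" if "s < r" "r \<le> t" for r
    using assms(3)[of r] Z_range[of r] assms(1) that by auto
qed (use assms in auto)

text \<open>\<open>I\<close> is the drift integral over \<open>{s..t}\<close>. Its crude bound
  serves the domination, the bound by the oscillation \<open>\<delta>\<close> serves the expansion
  in fine cells.\<close>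

lemma increment:
  assumes st: "0 \<le> s" "s \<le> t"
  obtains I where "Z t = Z s + I + \<sigma> * (B t - B s) + (L t - L s) - (U t - U s)"
    and "\<bar>I\<bar> \<le> (\<alpha> + \<gamma> * d) * (t - s)"
    and "\<And>\<delta>. (\<And>r. s \<le> r \<Longrightarrow> r \<le> t \<Longrightarrow> \<bar>Z r - Z s\<bar> \<le> \<delta>) \<Longrightarrow>
           \<bar>I - (t - s) * (\<alpha> - \<gamma> * Z s)\<bar> \<le> \<gamma> * \<delta> * (t - s)"
proof
  let ?b = "\<lambda>r. \<alpha> - \<gamma> * Z r"
  define I where "I = integral {s..t} ?b"
  have cont: "continuous_on {u..v} ?b" if "0 \<le> u" for u v
    using that by (intro continuous_intros continuous_on_subset[OF continuous_Z]) auto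
  have LB: "(LBINT r:{0..u}. ?b r) = integral {0..u} ?b" if "0 \<le> u" for u
    using that by (intro set_borel_integral_eq_integral borel_integrable_atLeastAtMost' cont) auto
  have comb: "integral {0..t} ?b = integral {0..s} ?b + I"
    unfolding I_def using st
    by (intro Henstock_Kurzweil_Integration.integral_combine[symmetric] integrable_continuous_real cont) auto
  have "integral {0..t} ?b = (LBINT r:{0..t}. ?b r)" "integral {0..s} ?b = (LBINT r:{0..s}. ?b r)"
    using LB st by auto
  then show "Z t = Z s + I + \<sigma> * (B t - B s) + (L t - L s) - (U t - U s)"
    using equation[of s] equation[of t] st comb by (simp add: algebra_simps)
  have int: "?b integrable_on {s..t}" using st by (intro integrable_continuous_real cont)
  have "norm I \<le> (\<alpha> + \<gamma> * d) * (t - s)"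
    unfolding I_def
  proof (rule integral_bound)
    fix r assume "r \<in> {s..t}"
    then have "Z r \<in> {0..d}" using Z_range st by auto
    then have "0 \<le> \<gamma> * Z r" "\<gamma> * Z r \<le> \<gamma> * d" using pos by auto
    then show "norm (?b r) \<le> \<alpha> + \<gamma> * d"
      unfolding real_norm_def abs_le_iff using pos by linarith
  qed (use st cont in auto)
  then show "\<bar>I\<bar> \<le> (\<alpha> + \<gamma> * d) * (t - s)" by simp
  fix \<delta> assume \<delta>: "\<And>r. s \<le> r \<Longrightarrow> r \<le> t \<Longrightarrow> \<bar>Z r - Z s\<bar> \<le> \<delta>"
  have "I - (t - s) * (\<alpha> - \<gamma> * Z s) = integral {s..t} (\<lambda>r. ?b r - ?b s)"
    unfolding I_def using st int by (subst Henstock_Kurzweil_Integration.integral_diff) auto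
  also have "norm \<dots> \<le> \<gamma> * \<delta> * (t - s)"
  proof (rule integral_bound)
    fix r assume "r \<in> {s..t}"
    then have "\<gamma> * \<bar>Z r - Z s\<bar> \<le> \<gamma> * \<delta>" using \<delta> pos by (intro mult_left_mono) auto
    moreover have "?b r - ?b s = - (\<gamma> * (Z r - Z s))" by (simp add: algebra_simps)
    ultimately show "norm (?b r - ?b s) \<le> \<gamma> * \<delta>" using pos by (simp add: abs_mult)
  qed (use st in \<open>auto intro!: continuous_intros continuous_on_subset[OF continuous_Z]\<close>)
  finally show "\<bar>I - (t - s) * (\<alpha> - \<gamma> * Z s)\<bar> \<le> \<gamma> * \<delta> * (t - s)" by simp
qed

end

section \<open>Expansion of the weighted functional over one grid cell\<close>

lemma uniform_on_mesh:
  fixes f :: "real \<Rightarrow> real"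
  assumes f: "continuous_on {0..} f" and T: "0 < T" and \<delta>: "0 < \<delta>"
  shows "\<forall>\<^sub>F n in sequentially. \<forall>s r. 0 \<le> s \<and> s \<le> r \<and> r \<le> s + T / real n \<and> r \<le> T \<longrightarrow> \<bar>f r - f s\<bar> \<le> \<delta>"
proof -
  have "uniformly_continuous_on {0..T} f"
    using f by (intro compact_uniformly_continuous continuous_on_subset[OF f]) auto
  then obtain e where e: "0 < e" "\<And>s r. s \<in> {0..T} \<Longrightarrow> r \<in> {0..T} \<Longrightarrow> dist r s < e \<Longrightarrow> dist (f r) (f s) < \<delta>"
    using \<delta> unfolding uniformly_continuous_on_def by metis
  have "((\<lambda>n. T / real n) \<longlongrightarrow> 0) sequentially" by (rule lim_const_over_n)
  then have "\<forall>\<^sub>F n in sequentially. T / real n < e" using e(1) by (rule order_tendstoD)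
  then show ?thesis
  proof eventually_elim
    case (elim n)
    show ?case using e(2) elim by (fastforce simp: dist_real_def less_imp_le)
  qed
qed

text \<open>The functional is \<open>exp (a * U t + \<mu> * t) * w (Z t)\<close>. A purely imaginary
  \<open>a\<close> keeps it bounded however large \<open>U\<close> is. Up to the weight, growth of
  \<open>U\<close> changes it by \<open>(a * w d - w1 d) dU\<close> and growth of \<open>L\<close>
  by \<open>w1 0 dL\<close>, and both vanish.\<close>

locale reflected_path_test = reflected_path + test_function +
  fixes a \<mu> :: complex
  assumes Re_a: "Re a = 0" and w1_0: "w1 0 = 0" and w1_d: "w1 d = a * w d"
begin

text \<open>The first-order part of the generator; the term with \<open>w2\<close> is absent because
  the Brownian displacement is split off and treated in expectation.\<close>

definition gen1 :: "real \<Rightarrow> complex" where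
  "gen1 z = \<mu> * w z + of_real (\<alpha> - \<gamma> * z) * w1 z"

definition growth :: "real \<Rightarrow> real \<Rightarrow> real" where
  "growth s t = (L t - L s) + (U t - U s)"

text \<open>The change over a cell caused by everything but the Brownian increment, relative to the
  weight at \<open>s\<close>: the comparison point is \<open>Z s\<close> displaced by the noise
  alone.\<close>

definition rem :: "real \<Rightarrow> real \<Rightarrow> complex" where
  "rem s t = exp (a * of_real (U t - U s) + \<mu> * of_real (t - s)) * w (Z t) - w (Z s + \<sigma> * (B t - B s))"

text \<open>One constant that dominates, per unit of growth plus elapsed time, both the exponent
  increment \<open>\<eta>\<close> and the displacement \<open>v\<close> of
  \<open>cell_bounds\<close>.\<close>

definition N :: real where "N = norm a + norm \<mu> + \<alpha> + \<gamma> * d + 1"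

text \<open>The first summand pays for the quadratic terms \<open>T1\<close> of
  \<open>rem_small\<close>, with the factor 3 from \<open>E \<le> 3 * \<delta>\<close>; the bracket
  lists the five first-order terms of \<open>T2\<close>.\<close>

definition K_small :: real where
  "K_small = 3 * C * (exp (norm \<mu>) + 2) * N\<^sup>2 +
    C * ((norm a + 1) * (1 + \<sigma>) + (1 + \<sigma>) + norm \<mu> * \<sigma> + \<gamma> + (\<alpha> + \<gamma> * d) * \<sigma>)"

text \<open>The summands are the linear bound on \<open>rem\<close> for small cells, the trivial
  bound for large ones, and the two terms of \<open>gen1\<close>.\<close>

definition K_large :: real where
  "K_large = C * (exp (norm \<mu>) + 1) * N + (exp (norm \<mu>) + 1) * C + norm \<mu> * C + (\<alpha> + \<gamma> * d) * C"

lemma growth_nonneg: "0 \<le> s \<Longrightarrow> s \<le> t \<Longrightarrow> 0 \<le> growth s t"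
  using L_mono[of s t] U_mono[of s t] by (simp add: growth_def)

lemma N_pos: "0 < N"
  using pos by (simp add: N_def add_nonneg_pos)

lemma drift_bound: "0 \<le> s \<Longrightarrow> \<bar>\<alpha> - \<gamma> * Z s\<bar> \<le> \<alpha> + \<gamma> * d"
proof -
  assume "0 \<le> s"
  then have "Z s \<in> {0..d}" by (rule Z_range)
  then have "0 \<le> \<gamma> * Z s" "\<gamma> * Z s \<le> \<gamma> * d" using pos by auto
  then show ?thesis unfolding abs_le_iff using pos by linarith
qed

text \<open>All displacements other than the Brownian one are of first order in \<open>E\<close>.
  The exponent has bounded real part since \<open>a\<close> is imaginary and a cell has length at
  most 1.\<close>

lemma cell_bounds:
  assumes st: "0 \<le> s" "s \<le> t" "t \<le> s + 1"
  defines "E \<equiv> growth s t + (t - s)"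
    and "\<eta> \<equiv> a * of_real (U t - U s) + \<mu> * of_real (t - s)"
    and "v \<equiv> Z t - (Z s + \<sigma> * (B t - B s))"
  shows "0 \<le> E" "norm \<eta> \<le> N * E" "\<bar>v\<bar> \<le> N * E" "Re \<eta> \<le> norm \<mu>"
proof -
  have mono: "L s \<le> L t" "U s \<le> U t" using L_mono U_mono st by auto
  show E0: "0 \<le> E" using growth_nonneg st unfolding E_def by auto
  have nE: "norm a * E + norm \<mu> * E \<le> N * E"
    unfolding N_def distrib_right[symmetric] using pos E0 by (intro mult_right_mono) auto
  have "norm \<eta> \<le> norm a * \<bar>U t - U s\<bar> + norm \<mu> * \<bar>t - s\<bar>"
    unfolding \<eta>_def by (rule order_trans[OF norm_triangle_ineq]) (simp add: norm_mult flip: of_real_diff)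
  also have "\<dots> \<le> norm a * E + norm \<mu> * E"
    using mono st by (intro add_mono mult_left_mono) (auto simp: E_def growth_def)
  finally show "norm \<eta> \<le> N * E" using nE by simp
  have "Re \<eta> = Re \<mu> * (t - s)" unfolding \<eta>_def using Re_a by simp
  also have "\<dots> \<le> norm \<mu> * 1"
    using st abs_Re_le_cmod[of \<mu>] by (intro mult_mono) auto
  finally show "Re \<eta> \<le> norm \<mu>" by simp
  obtain I where I: "Z t = Z s + I + \<sigma> * (B t - B s) + (L t - L s) - (U t - U s)"
      "\<bar>I\<bar> \<le> (\<alpha> + \<gamma> * d) * (t - s)"
    using increment[OF st(1,2)] by metis
  have "\<bar>v\<bar> \<le> \<bar>I\<bar> + (L t - L s) + (U t - U s)" using I(1) mono unfolding v_def by auto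
  also have "\<dots> \<le> (\<alpha> + \<gamma> * d) * E + 1 * E"
  proof -
    have "(\<alpha> + \<gamma> * d) * (t - s) \<le> (\<alpha> + \<gamma> * d) * E"
      using mono pos unfolding E_def growth_def by (intro mult_left_mono) auto
    then show ?thesis using I(2) st unfolding E_def growth_def by auto
  qed
  also have "\<dots> \<le> N * E"
    unfolding distrib_right[symmetric] using E0 by (intro mult_right_mono) (auto simp: N_def)
  finally show "\<bar>v\<bar> \<le> N * E" .
qed

text \<open>Free of any control of the oscillation, hence good for every mesh up to 1: this provides
  the dominating constant. The cap \<open>min 1\<close> is available because \<open>rem\<close> is
  bounded outright; it limits the cost of a cell in which \<open>L + U\<close> grows a lot.\<close>

lemma rem_large:
  assumes st: "0 \<le> s" "s \<le> t" "t \<le> s + 1"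
  shows "norm (rem s t - of_real (t - s) * gen1 (Z s)) \<le> K_large * (min 1 (growth s t) + (t - s))"
proof -
  define E where "E = growth s t + (t - s)"
  define \<eta> where "\<eta> = a * of_real (U t - U s) + \<mu> * of_real (t - s)"
  define y where "y = Z s + \<sigma> * (B t - B s)"
  define M where "M = exp (norm \<mu>)"
  define E' where "E' = min 1 (growth s t) + (t - s)"
  note cb = cell_bounds[OF st, folded E_def \<eta>_def y_def]
  note C0 = C_nonneg
  have M: "1 \<le> M" unfolding M_def by simp
  have E': "0 \<le> E'" "min 1 E \<le> E'" using growth_nonneg st unfolding E'_def E_def by auto
  have e1: "norm (exp \<eta> - 1) \<le> M * norm \<eta>" unfolding M_def
    using exp_minus_one_bounds(1)[OF cb(4)] by simp
  have e0: "norm (exp \<eta>) \<le> M" unfolding M_def using cb(4) by simp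
  have r: "rem s t = exp \<eta> * w (Z t) - w y" by (simp add: rem_def \<eta>_def y_def)
  have "rem s t = (exp \<eta> - 1) * w (Z t) + (w (Z t) - w y)" unfolding r by (simp add: algebra_simps)
  then have "norm (rem s t) \<le> norm (exp \<eta> - 1) * norm (w (Z t)) + norm (w (Z t) - w y)"
    by (metis norm_mult norm_triangle_ineq)
  also have "\<dots> \<le> (M * (N * E)) * C + C * (N * E)"
    using e1 cb(2,3) w_bound w_lipschitz[of "Z t" y] C0 M
    by (intro add_mono mult_mono order_trans[OF e1] order_trans[OF w_lipschitz] mult_left_mono) auto
  finally have 1: "norm (rem s t) \<le> (C * (M + 1) * N) * E" by (simp add: algebra_simps)
  have "norm (rem s t) \<le> norm (exp \<eta>) * norm (w (Z t)) + norm (w y)"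
    unfolding r by (metis norm_mult norm_triangle_ineq4)
  also have "\<dots> \<le> M * C + C" using e0 w_bound C0 M by (intro add_mono mult_mono) auto
  finally have 2: "norm (rem s t) \<le> (M + 1) * C" by (simp add: algebra_simps)
  define K where "K = C * (M + 1) * N + (M + 1) * C"
  have K: "C * (M + 1) * N \<le> K" "(M + 1) * C \<le> K" "0 \<le> K"
    using C0 M N_pos by (auto simp: K_def)
  have "norm (rem s t) \<le> K * min 1 E"
  proof (cases "E \<le> 1")
    case True
    have "(C * (M + 1) * N) * E \<le> K * E" using K cb(1) by (intro mult_right_mono) auto
    with 1 True show ?thesis by simp
  next
    case False
    then show ?thesis using 2 K by simp
  qed
  also have "\<dots> \<le> K * E'" using E' K by (intro mult_left_mono) auto
  finally have r': "norm (rem s t) \<le> K * E'" .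
  have "norm (of_real (t - s) * gen1 (Z s)) \<le> (t - s) * (norm \<mu> * C + (\<alpha> + \<gamma> * d) * C)"
  proof -
    have "norm (gen1 (Z s)) \<le> norm \<mu> * norm (w (Z s)) + \<bar>\<alpha> - \<gamma> * Z s\<bar> * norm (w1 (Z s))"
      unfolding gen1_def by (rule order_trans[OF norm_triangle_ineq]) (simp add: norm_mult del: of_real_diff)
    also have "\<dots> \<le> norm \<mu> * C + (\<alpha> + \<gamma> * d) * C"
      using drift_bound[OF st(1)] w_bound w1_bound C0 by (intro add_mono mult_mono) auto
    finally show ?thesis using st by (simp add: norm_mult mult_left_mono del: of_real_diff)
  qed
  also have "\<dots> \<le> E' * (norm \<mu> * C + (\<alpha> + \<gamma> * d) * C)"
    using growth_nonneg[OF st(1,2)] C0 pos st unfolding E'_def by (intro mult_right_mono) auto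
  finally have "norm (rem s t - of_real (t - s) * gen1 (Z s)) \<le> K * E' + E' * (norm \<mu> * C + (\<alpha> + \<gamma> * d) * C)"
    using r' by (metis (no_types, lifting) add_mono norm_triangle_ineq4 order_trans)
  also have "\<dots> = K_large * E'" unfolding K_large_def K_def M_def by (simp add: algebra_simps)
  finally show ?thesis unfolding E'_def .
qed

text \<open>To first order \<open>rem\<close> is \<open>\<eta> * w y + v * w1 y\<close>. Its part in
  \<open>dU\<close> has the coefficient \<open>a * w y - w1 y\<close>, its part in \<open>dL\<close>
  the coefficient \<open>w1 y\<close>; both are of order \<open>\<delta>\<close> because such growth
  forces \<open>Z\<close> to the boundary within the cell. What is left is the drift, which
  \<open>gen1\<close> cancels up to order \<open>\<delta>\<close>.\<close>

lemma rem_small: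
  assumes st: "0 \<le> s" "s \<le> t" "t \<le> s + 1" "t - s \<le> \<delta>"
    and osc: "\<And>r. s \<le> r \<Longrightarrow> r \<le> t \<Longrightarrow> \<bar>Z r - Z s\<bar> \<le> \<delta>"
      "\<bar>B t - B s\<bar> \<le> \<delta>" "\<bar>L t - L s\<bar> \<le> \<delta>" "\<bar>U t - U s\<bar> \<le> \<delta>"
  shows "norm (rem s t - of_real (t - s) * gen1 (Z s)) \<le> K_small * \<delta> * (growth s t + (t - s))"
proof -
  define E where "E = growth s t + (t - s)"
  define \<eta> where "\<eta> = a * of_real (U t - U s) + \<mu> * of_real (t - s)"
  define y where "y = Z s + \<sigma> * (B t - B s)"
  define v where "v = Z t - y"
  define M where "M = exp (norm \<mu>)"
  define \<beta> where "\<beta> = \<alpha> + \<gamma> * d"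
  note cb = cell_bounds[OF st(1-3), folded E_def \<eta>_def y_def, folded v_def]
  note C0 = C_nonneg
  have mono: "L s \<le> L t" "U s \<le> U t" using L_mono U_mono st by auto
  have d0: "0 \<le> \<delta>" using st by simp
  have M: "1 \<le> M" unfolding M_def by simp
  have \<beta>: "0 \<le> \<beta>" using pos unfolding \<beta>_def by simp
  \<comment> \<open>Turns one factor of each quadratic term into a multiple of
    \<open>\<delta>\<close>.\<close>
  have E3: "E \<le> 3 * \<delta>" using osc st unfolding E_def growth_def by auto
  have D_E: "t - s \<le> E" "U t - U s \<le> E" "L t - L s \<le> E"
    using mono st unfolding E_def growth_def by auto
  have r: "rem s t = exp \<eta> * w (Z t) - w y" by (simp add: rem_def \<eta>_def y_def)
  obtain I where I: "Z t = Z s + I + \<sigma> * (B t - B s) + (L t - L s) - (U t - U s)"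
      "\<And>\<delta>. (\<And>r. s \<le> r \<Longrightarrow> r \<le> t \<Longrightarrow> \<bar>Z r - Z s\<bar> \<le> \<delta>) \<Longrightarrow>
           \<bar>I - (t - s) * (\<alpha> - \<gamma> * Z s)\<bar> \<le> \<gamma> * \<delta> * (t - s)"
    using increment[OF st(1,2)] by metis
  have v: "v = I + (L t - L s) - (U t - U s)" using I(1) unfolding v_def y_def by simp
  have e2: "norm (exp \<eta> - 1 - \<eta>) \<le> M * (norm \<eta>)\<^sup>2"
    unfolding M_def using exp_minus_one_bounds(2)[OF cb(4)] by simp
  have sq: "(norm \<eta>)\<^sup>2 \<le> (N * E)\<^sup>2" "v\<^sup>2 \<le> (N * E)\<^sup>2"
    using cb N_pos by (auto intro!: power_mono simp: abs_le_square_iff[symmetric])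
  \<comment> \<open>\<open>T1\<close> is what remains after expanding \<open>exp \<eta>\<close> and
    \<open>w\<close> to first order at \<open>y\<close>.\<close>
  define T1 where "T1 = (exp \<eta> - 1 - \<eta>) * w (Z t) + (w (Z t) - w y - of_real (Z t - y) * w1 y) + \<eta> * (w (Z t) - w y)"
  have "norm T1 \<le> norm (exp \<eta> - 1 - \<eta>) * norm (w (Z t)) + norm (w (Z t) - w y - of_real (Z t - y) * w1 y) + norm \<eta> * norm (w (Z t) - w y)"
    unfolding T1_def by (metis (no_types, lifting) norm_mult norm_triangle_mono order_refl)
  also have "\<dots> \<le> (M * (N * E)\<^sup>2) * C + C * (N * E)\<^sup>2 + (N * E) * (C * (N * E))"
  proof (intro add_mono mult_mono)
    show "norm (exp \<eta> - 1 - \<eta>) \<le> M * (N * E)\<^sup>2"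
      using order_trans[OF e2 mult_left_mono[OF sq(1)]] M by simp
    show "norm (w (Z t) - w y - of_real (Z t - y) * w1 y) \<le> C * (N * E)\<^sup>2"
      using order_trans[OF w_taylor1 mult_left_mono[OF sq(2) C0, unfolded v_def]] .
    show "norm (w (Z t) - w y) \<le> C * (N * E)"
      using order_trans[OF w_lipschitz mult_left_mono[OF cb(3) C0, unfolded v_def]] .
  qed (use cb w_bound C0 N_pos M in auto)
  also have "\<dots> = C * (M + 2) * N\<^sup>2 * (E * E)" by (simp add: power2_eq_square algebra_simps)
  also have "\<dots> \<le> C * (M + 2) * N\<^sup>2 * ((3 * \<delta>) * E)"
    using C0 M E3 cb(1) by (intro mult_left_mono mult_right_mono) auto
  finally have T1: "norm T1 \<le> 3 * C * (M + 2) * N\<^sup>2 * \<delta> * E" by (simp only: mult_ac)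
  \<comment> \<open>If \<open>L\<close> grows, then \<open>Z\<close> vanishes somewhere in the cell,
    so \<open>y\<close> lies within \<open>(1 + \<sigma>) * \<delta>\<close> of 0, a zero of
    \<open>w1\<close>.\<close>
  have near: "norm (w1 y) * (L t - L s) \<le> C * ((1 + \<sigma>) * \<delta>) * E"
  proof (cases "L t = L s")
    case False
    then obtain r where rr: "s \<le> r" "r \<le> t" "Z r = 0" using L_flat[OF st(1,2)] by auto
    have "\<bar>\<sigma> * (B t - B s)\<bar> \<le> \<sigma> * \<delta>" using osc(2) pos by (simp add: abs_mult)
    then have "\<bar>y\<bar> \<le> (1 + \<sigma>) * \<delta>" using osc(1)[OF rr(1,2)] rr(3) unfolding y_def by (simp add: algebra_simps)
    then have "norm (w1 y) \<le> C * ((1 + \<sigma>) * \<delta>)"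
      using w1_lipschitz[of y 0] w1_0 C0 by (auto intro: order_trans mult_left_mono)
    then show ?thesis using D_E mono C0 d0 pos by (intro mult_mono) auto
  qed (use C0 d0 pos cb(1) in simp)
  \<comment> \<open>The same argument at \<open>d\<close>, where \<open>a * w - w1\<close>
    vanishes.\<close>
  have far: "norm (a * w y - w1 y) * (U t - U s) \<le> C * ((norm a + 1) * (1 + \<sigma>) * \<delta>) * E"
  proof (cases "U t = U s")
    case False
    then obtain r where rr: "s \<le> r" "r \<le> t" "Z r = d" using U_flat[OF st(1,2)] by auto
    have "\<bar>\<sigma> * (B t - B s)\<bar> \<le> \<sigma> * \<delta>" using osc(2) pos by (simp add: abs_mult)
    then have yd: "\<bar>y - d\<bar> \<le> (1 + \<sigma>) * \<delta>" using osc(1)[OF rr(1,2)] rr(3) unfolding y_def by (simp add: algebra_simps)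
    have "a * w y - w1 y = a * (w y - w d) - (w1 y - w1 d)" using w1_d by (simp add: algebra_simps)
    then have "norm (a * w y - w1 y) \<le> norm a * norm (w y - w d) + norm (w1 y - w1 d)"
      by (metis norm_mult norm_triangle_ineq4)
    also have "\<dots> \<le> norm a * (C * \<bar>y - d\<bar>) + C * \<bar>y - d\<bar>"
      by (intro add_mono mult_left_mono w_lipschitz w1_lipschitz) auto
    also have "\<dots> = C * (norm a + 1) * \<bar>y - d\<bar>" by (simp add: algebra_simps)
    also have "\<dots> \<le> C * (norm a + 1) * ((1 + \<sigma>) * \<delta>)" using yd C0 by (intro mult_left_mono) auto
    finally have "norm (a * w y - w1 y) \<le> C * ((norm a + 1) * (1 + \<sigma>) * \<delta>)" by (simp add: mult_ac)
    then show ?thesis using D_E mono C0 d0 pos by (intro mult_mono) auto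
  qed (use C0 d0 pos cb(1) in simp)
  have yZ: "\<bar>y - Z s\<bar> \<le> \<sigma> * \<delta>" using osc(2) pos unfolding y_def by (simp add: abs_mult)
  \<comment> \<open>The linear terms minus the drift, grouped by source: growth of \<open>U\<close>,
    growth of \<open>L\<close>, displacement of \<open>w\<close> from \<open>Z s\<close> to
    \<open>y\<close>, error of the drift integral, displacement of \<open>w1\<close>.\<close>
  define T2 where "T2 = of_real (U t - U s) * (a * w y - w1 y) + of_real (L t - L s) * w1 y
     + \<mu> * of_real (t - s) * (w y - w (Z s)) + of_real (I - (t - s) * (\<alpha> - \<gamma> * Z s)) * w1 y
     + of_real ((t - s) * (\<alpha> - \<gamma> * Z s)) * (w1 y - w1 (Z s))"
  have decomp: "rem s t - of_real (t - s) * gen1 (Z s) = T1 + T2"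
    unfolding r T1_def T2_def gen1_def v_def[symmetric] v \<eta>_def
    by (simp add: algebra_simps)
  have "norm T2 \<le> norm (of_real (U t - U s) * (a * w y - w1 y)) + norm (of_real (L t - L s) * w1 y)
     + norm (\<mu> * of_real (t - s) * (w y - w (Z s))) + norm (of_real (I - (t - s) * (\<alpha> - \<gamma> * Z s)) * w1 y)
     + norm (of_real ((t - s) * (\<alpha> - \<gamma> * Z s)) * (w1 y - w1 (Z s)))"
    unfolding T2_def by (intro norm_triangle_mono order_refl)
  also have "\<dots> \<le> C * ((norm a + 1) * (1 + \<sigma>) * \<delta>) * E + C * ((1 + \<sigma>) * \<delta>) * E
     + C * (norm \<mu> * \<sigma> * \<delta>) * E + C * (\<gamma> * \<delta>) * E + C * (\<beta> * \<sigma> * \<delta>) * E"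
  proof (intro add_mono)
    show "norm (of_real (U t - U s) * (a * w y - w1 y)) \<le> C * ((norm a + 1) * (1 + \<sigma>) * \<delta>) * E"
      using far mono by (simp add: norm_mult mult.commute del: of_real_diff)
    show "norm (of_real (L t - L s) * w1 y) \<le> C * ((1 + \<sigma>) * \<delta>) * E"
      using near mono by (simp add: norm_mult mult.commute del: of_real_diff)
    have "norm (\<mu> * of_real (t - s) * (w y - w (Z s))) = norm \<mu> * ((t - s) * norm (w y - w (Z s)))"
      using st by (simp add: norm_mult del: of_real_diff)
    also have "\<dots> \<le> norm \<mu> * (E * (C * (\<sigma> * \<delta>)))"
      using st D_E cb(1) C0 yZ by (intro mult_left_mono mult_mono order_trans[OF w_lipschitz]) auto
    finally show "norm (\<mu> * of_real (t - s) * (w y - w (Z s))) \<le> C * (norm \<mu> * \<sigma> * \<delta>) * E"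
      by (simp add: mult_ac)
    have "norm (of_real (I - (t - s) * (\<alpha> - \<gamma> * Z s)) * w1 y) = \<bar>I - (t - s) * (\<alpha> - \<gamma> * Z s)\<bar> * norm (w1 y)"
      by (simp only: norm_mult norm_of_real)
    also have "\<dots> \<le> (\<gamma> * \<delta> * E) * C"
    proof (intro mult_mono w1_bound)
      show "\<bar>I - (t - s) * (\<alpha> - \<gamma> * Z s)\<bar> \<le> \<gamma> * \<delta> * E"
        using order_trans[OF I(2)[OF osc(1)] mult_left_mono[OF D_E(1), of "\<gamma> * \<delta>"]] pos d0 by simp
    qed (use pos d0 cb(1) in auto)
    finally show "norm (of_real (I - (t - s) * (\<alpha> - \<gamma> * Z s)) * w1 y) \<le> C * (\<gamma> * \<delta>) * E"
      by (simp only: mult_ac)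
    have "norm (of_real ((t - s) * (\<alpha> - \<gamma> * Z s)) * (w1 y - w1 (Z s))) = (t - s) * \<bar>\<alpha> - \<gamma> * Z s\<bar> * norm (w1 y - w1 (Z s))"
      using st by (simp only: norm_mult norm_of_real abs_mult abs_of_nonneg diff_ge_0_iff_ge)
    also have "\<dots> \<le> (E * \<beta>) * (C * (\<sigma> * \<delta>))"
      using st D_E cb(1) C0 yZ \<beta> drift_bound[OF st(1)]
      by (intro mult_mono order_trans[OF w1_lipschitz] mult_left_mono) (auto simp: \<beta>_def)
    finally show "norm (of_real ((t - s) * (\<alpha> - \<gamma> * Z s)) * (w1 y - w1 (Z s))) \<le> C * (\<beta> * \<sigma> * \<delta>) * E"
      by (simp only: mult_ac)
  qed
  finally have T2: "norm T2 \<le> C * ((norm a + 1) * (1 + \<sigma>) * \<delta>) * E + C * ((1 + \<sigma>) * \<delta>) * E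
     + C * (norm \<mu> * \<sigma> * \<delta>) * E + C * (\<gamma> * \<delta>) * E + C * (\<beta> * \<sigma> * \<delta>) * E" .
  have "norm (rem s t - of_real (t - s) * gen1 (Z s)) \<le> norm T1 + norm T2"
    unfolding decomp by (rule norm_triangle_ineq)
  also have "\<dots> \<le> K_small * \<delta> * E"
    using T1 T2 unfolding K_small_def M_def \<beta>_def by (simp add: algebra_simps)
  finally show ?thesis unfolding E_def .
qed

end

section \<open>Stopped grid sums\<close>

definition grid :: "real \<Rightarrow> nat \<Rightarrow> nat \<Rightarrow> real" where
  "grid T n j = real j * (T / real n)"

text \<open>The decision to stop looks only at the left end of a cell. It is therefore known before
  the Brownian increment over the cell, and the cell in which \<open>S\<close> passes
  \<open>K\<close> is still counted.\<close>

definition stopped_sum :: "real \<Rightarrow> (real \<Rightarrow> real) \<Rightarrow> real \<Rightarrow> nat \<Rightarrow> (real \<Rightarrow> real \<Rightarrow> complex) \<Rightarrow> complex" where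
  "stopped_sum K S T n f =
     (\<Sum>j<n. if S (grid T n j) \<le> K then f (grid T n j) (grid T n (Suc j)) else 0)"

lemma grid_simps:
  assumes "0 < T" "0 < n"
  shows "grid T n 0 = 0" "grid T n n = T" "grid T n (Suc j) = grid T n j + T / real n"
    "0 \<le> grid T n j" "grid T n j < grid T n (Suc j)"
  using assms by (auto simp: grid_def field_simps)

lemma grid_mono: "0 < T \<Longrightarrow> i \<le> j \<Longrightarrow> grid T n i \<le> grid T n j"
  unfolding grid_def by (intro mult_right_mono divide_nonneg_nonneg) auto

lemma grid_le: "0 < T \<Longrightarrow> 0 < n \<Longrightarrow> j \<le> n \<Longrightarrow> grid T n j \<le> T"
  using grid_mono[of T j n n] grid_simps(2)[of T n] by simp

lemma stopped_sum_add:
  "stopped_sum K S T n (\<lambda>s t. f s t + g s t) = stopped_sum K S T n f + stopped_sum K S T n g"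
  by (auto simp: stopped_sum_def sum.distrib[symmetric] intro!: sum.cong)

text \<open>\<open>c\<close> holds on an initial segment of the indices, so the sum telescopes up to
  the first failure.\<close>

lemma stopped_telescope:
  fixes F :: "nat \<Rightarrow> complex"
  assumes "\<And>i j. i \<le> j \<Longrightarrow> c j \<Longrightarrow> c i"
  shows "\<exists>m\<le>n. (\<Sum>j<n. if c j then F (Suc j) - F j else 0) = F m - F 0"
proof (induction n)
  case (Suc n)
  show ?case
  proof (cases "c n")
    case True
    then have "c j" if "j < Suc n" for j using assms[of j n] that by simp
    then have "(\<Sum>j<Suc n. if c j then F (Suc j) - F j else 0) = F (Suc n) - F 0"
      using sum_lessThan_telescope[of F "Suc n"] by simp
    then show ?thesis by blast
  next
    case False
    then show ?thesis using Suc by (auto intro: le_SucI)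
  qed
qed simp

text \<open>Only the last counted cell can overshoot \<open>K\<close>, and its contribution is
  capped by 1. The minimum with \<open>S n\<close> is what makes the induction go through.\<close>

lemma stopped_growth:
  fixes S :: "nat \<Rightarrow> real"
  assumes "incseq S" "S 0 = 0" "0 \<le> K"
  shows "(\<Sum>j<n. if S j \<le> K then min 1 (S (Suc j) - S j) else 0) \<le> min (S n) (K + 1)"
proof (induction n)
  case (Suc n)
  have "S n \<le> S (Suc n)" using assms(1) by (auto simp: incseq_def)
  then show ?case using Suc by auto
qed (use assms in simp)

text \<open>The change of the functional over a cell, minus the part due to the Brownian
  displacement and minus the first-order drift. It takes bare paths as arguments so that the
  pathwise estimates and the expectations refer to the same term.\<close>

definition one_step ::
  "complex \<Rightarrow> complex \<Rightarrow> real \<Rightarrow> real \<Rightarrow> real \<Rightarrow> (real \<Rightarrow> complex) \<Rightarrow> (real \<Rightarrow> complex) \<Rightarrow>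
   (real \<Rightarrow> real) \<Rightarrow> (real \<Rightarrow> real) \<Rightarrow> (real \<Rightarrow> real) \<Rightarrow> real \<Rightarrow> real \<Rightarrow> complex" where
  "one_step a \<mu> \<alpha> \<gamma> \<sigma> w w1 B Z U s t =
     exp (a * of_real (U t) + \<mu> * of_real t) * w (Z t) -
     exp (a * of_real (U s) + \<mu> * of_real s) *
       (w (Z s + \<sigma> * (B t - B s)) + of_real (t - s) * (\<mu> * w (Z s) + of_real (\<alpha> - \<gamma> * Z s) * w1 (Z s)))"

section \<open>Pathwise behaviour of the stopped sums\<close>

context reflected_path_test
begin

abbreviation path_S :: "real \<Rightarrow> real" where "path_S t \<equiv> L t + U t"
abbreviation path_step :: "real \<Rightarrow> real \<Rightarrow> complex" where "path_step \<equiv> one_step a \<mu> \<alpha> \<gamma> \<sigma> w w1 B Z U"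
abbreviation path_weight :: "real \<Rightarrow> complex" where "path_weight t \<equiv> exp (a * of_real (U t) + \<mu> * of_real t)"

lemma norm_weight: "0 \<le> t \<Longrightarrow> t \<le> T \<Longrightarrow> norm (path_weight t) \<le> exp (norm \<mu> * T)"
proof -
  assume t: "0 \<le> t" "t \<le> T"
  have "Re \<mu> * t \<le> norm \<mu> * t" using t abs_Re_le_cmod[of \<mu>] by (intro mult_right_mono) auto
  also have "\<dots> \<le> norm \<mu> * T" using t by (intro mult_left_mono) auto
  finally show ?thesis using Re_a by simp
qed

lemma step_eq: "path_step s t = path_weight s * (rem s t - of_real (t - s) * gen1 (Z s))"
proof -
  have "path_weight t = path_weight s * exp (a * of_real (U t - U s) + \<mu> * of_real (t - s))"
    by (simp add: exp_add[symmetric] algebra_simps)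
  then show ?thesis by (simp add: one_step_def rem_def gen1_def algebra_simps)
qed

lemma incseq_S_grid: "0 < T \<Longrightarrow> incseq (\<lambda>j. path_S (grid T n j))"
  by (intro incseq_SucI add_mono L_mono U_mono grid_mono) (auto simp: grid_def)

lemma growth_eq: "growth s t = path_S t - path_S s"
  by (simp add: growth_def)

text \<open>The stopped growth is at most \<open>K + 1\<close> and the elapsed time is
  \<open>T\<close>, so the bound depends neither on \<open>n\<close> nor on the path.\<close>

lemma stopped_step_bound:
  assumes T: "0 < T" "0 < n" "T / real n \<le> 1" and K: "0 \<le> K"
  shows "norm (stopped_sum K path_S T n path_step) \<le> exp (norm \<mu> * T) * K_large * (K + 1 + T)"
proof -
  let ?t = "grid T n"
  note gs = grid_simps[OF T(1,2)]
  have KL: "0 \<le> K_large" unfolding K_large_def using C_nonneg pos N_pos by simp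
  have "norm (if path_S (?t j) \<le> K then path_step (?t j) (?t (Suc j)) else 0) \<le> exp (norm \<mu> * T) * K_large *
     ((if path_S (?t j) \<le> K then min 1 (path_S (?t (Suc j)) - path_S (?t j)) else 0) + T / real n)" if "j < n" for j
  proof -
    have "norm (path_step (?t j) (?t (Suc j))) \<le> exp (norm \<mu> * T) * (K_large * (min 1 (growth (?t j) (?t (Suc j))) + (?t (Suc j) - ?t j)))"
      unfolding step_eq norm_mult using gs T that grid_le[OF T(1,2), of j]
      by (intro mult_mono norm_weight rem_large) (auto simp: less_imp_le)
    moreover have "?t (Suc j) - ?t j = T / real n" using gs by simp
    moreover have "0 \<le> exp (norm \<mu> * T) * K_large * (T / real n)" using KL T by simp
    ultimately show ?thesis by (auto simp: growth_eq mult.assoc)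
  qed
  then have "norm (stopped_sum K path_S T n path_step) \<le> (\<Sum>j<n. exp (norm \<mu> * T) * K_large *
     ((if path_S (?t j) \<le> K then min 1 (path_S (?t (Suc j)) - path_S (?t j)) else 0) + T / real n))"
    unfolding stopped_sum_def by (intro order_trans[OF norm_sum sum_mono]) auto
  also have "\<dots> = exp (norm \<mu> * T) * K_large * ((\<Sum>j<n. if path_S (?t j) \<le> K then min 1 (path_S (?t (Suc j)) - path_S (?t j)) else 0) + T)"
    using T by (simp add: sum_distrib_left[symmetric] sum.distrib)
  also have "\<dots> \<le> exp (norm \<mu> * T) * K_large * (K + 1 + T)"
    using stopped_growth[OF incseq_S_grid[OF T(1)] _ K, of n n] KL gs(1) L_0 U_0
    by (intro mult_left_mono) auto
  finally show ?thesis .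
qed

text \<open>On a fixed path \<open>L + U\<close> is finite at \<open>T\<close>. Once the mesh
  resolves the oscillation \<open>\<delta>\<close>, each cell costs at most a multiple of
  \<open>\<delta>\<close> times its own growth plus length, and these telescope.\<close>

lemma stopped_step_tendsto_0:
  assumes T: "0 < T"
  shows "(\<lambda>n. stopped_sum K path_S T n path_step) \<longlonglongrightarrow> 0"
proof (rule tendstoI)
  fix e :: real assume e: "0 < e"
  have KS: "0 \<le> K_small" unfolding K_small_def using C_nonneg pos N_pos by simp
  have ST: "0 \<le> path_S T" using L_mono[of 0 T] U_mono[of 0 T] L_0 U_0 T by simp
  define c where "c = exp (norm \<mu> * T) * K_small * (path_S T + T)"
  have c: "0 \<le> c" unfolding c_def using KS ST T by simp
  \<comment> \<open>The denominator with \<open>c + 1\<close> avoids a division by zero and gives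
    \<open>c * \<delta> \<le> e / 2\<close>.\<close>
  define \<delta> where "\<delta> = e / (2 * (c + 1))"
  have \<delta>: "0 < \<delta>" "c * \<delta> < e"
  proof -
    show "0 < \<delta>" unfolding \<delta>_def using e c by simp
    have "c * \<delta> \<le> (c + 1) * \<delta>" using \<open>0 < \<delta>\<close> by simp
    also have "\<dots> = e / 2" unfolding \<delta>_def using c by (simp add: field_simps)
    finally show "c * \<delta> < e" using e by simp
  qed
  have "(\<lambda>n. T / real n) \<longlonglongrightarrow> 0" by (rule lim_const_over_n)
  then have "\<forall>\<^sub>F n in sequentially. T / real n < min 1 \<delta>" using \<delta> by (intro order_tendstoD) auto
  moreover note uniform_on_mesh[OF continuous_Z T \<delta>(1)] uniform_on_mesh[OF continuous_B T \<delta>(1)]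
    uniform_on_mesh[OF continuous_L T \<delta>(1)] uniform_on_mesh[OF continuous_U T \<delta>(1)]
    eventually_gt_at_top[of "0::nat"]
  ultimately show "\<forall>\<^sub>F n in sequentially. dist (stopped_sum K path_S T n path_step) 0 < e"
  proof eventually_elim
    case (elim n)
    let ?t = "grid T n"
    note gs = grid_simps[OF T elim(6)]
    have "norm (if path_S (?t j) \<le> K then path_step (?t j) (?t (Suc j)) else 0) \<le> exp (norm \<mu> * T) * (K_small * \<delta> *
       ((path_S (?t (Suc j)) - path_S (?t j)) + (?t (Suc j) - ?t j)))" if "j < n" for j
    proof -
      have jT: "?t (Suc j) \<le> T" using grid_le[OF T elim(6), of "Suc j"] that by simp
      have le: "0 \<le> ?t j" "?t j \<le> ?t (Suc j)" "?t (Suc j) = ?t j + T / real n" using gs by (auto simp: less_imp_le)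
      have "norm (path_step (?t j) (?t (Suc j))) \<le> exp (norm \<mu> * T) * (K_small * \<delta> * (growth (?t j) (?t (Suc j)) + (?t (Suc j) - ?t j)))"
        unfolding step_eq norm_mult
      proof (intro mult_mono norm_weight rem_small)
        show "\<bar>Z r - Z (?t j)\<bar> \<le> \<delta>" if "?t j \<le> r" "r \<le> ?t (Suc j)" for r
          using elim(2) that le jT by auto
      qed (use elim le jT in auto)
      moreover have "0 \<le> exp (norm \<mu> * T) * (K_small * \<delta> * (growth (?t j) (?t (Suc j)) + (?t (Suc j) - ?t j)))"
        using KS \<delta>(1) growth_nonneg le by simp
      ultimately show ?thesis unfolding growth_eq by auto
    qed
    then have "norm (stopped_sum K path_S T n path_step) \<le> (\<Sum>j<n. exp (norm \<mu> * T) * (K_small * \<delta> *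
       ((path_S (?t (Suc j)) - path_S (?t j)) + (?t (Suc j) - ?t j))))"
      unfolding stopped_sum_def by (intro order_trans[OF norm_sum sum_mono]) auto
    also have "\<dots> = exp (norm \<mu> * T) * (K_small * \<delta> * ((\<Sum>j<n. path_S (?t (Suc j)) - path_S (?t j)) + (\<Sum>j<n. ?t (Suc j) - ?t j)))"
      by (simp only: sum_distrib_left sum.distrib[symmetric])
    also have "\<dots> = exp (norm \<mu> * T) * (K_small * \<delta> * (path_S T + T))"
      using sum_lessThan_telescope[of "\<lambda>j. path_S (?t j)" n] sum_lessThan_telescope[of ?t n] gs(1,2) L_0 U_0 by simp
    also have "\<dots> = c * \<delta>" unfolding c_def by simp
    finally show ?case using \<delta>(2) by simp
  qed
qed

text \<open>If \<open>path_S T \<le> K\<close>, no cell is dropped. Otherwise the sum stops at some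
  grid point, and the error is the difference of two values of a bounded functional.\<close>

lemma stopped_telescope_bound:
  assumes T: "0 < T" "0 < n"
  shows "norm (stopped_sum K path_S T n (\<lambda>s t. path_weight t * w (Z t) - path_weight s * w (Z s)) - (path_weight T * w (Z T) - path_weight 0 * w (Z 0)))
    \<le> (if path_S T \<le> K then 0 else 4 * C * exp (norm \<mu> * T))"
proof -
  let ?F = "\<lambda>j. path_weight (grid T n j) * w (Z (grid T n j))"
  note gs = grid_simps[OF T]
  have "\<exists>m\<le>n. stopped_sum K path_S T n (\<lambda>s t. path_weight t * w (Z t) - path_weight s * w (Z s)) = ?F m - ?F 0"
    unfolding stopped_sum_def
    using incseq_S_grid[OF T(1), of n]
    by (intro stopped_telescope[where F = ?F]) (meson incseqD order_trans)
  then obtain m where m: "m \<le> n" "stopped_sum K path_S T n (\<lambda>s t. path_weight t * w (Z t) - path_weight s * w (Z s)) = ?F m - ?F 0"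
    by blast
  have bd: "norm (?F j) \<le> exp (norm \<mu> * T) * C" if "j \<le> n" for j
    unfolding norm_mult using gs grid_le[OF T that] by (intro mult_mono norm_weight w_bound) auto
  show ?thesis
  proof (cases "path_S T \<le> K")
    case True
    have "path_S (grid T n j) \<le> K" if "j < n" for j
      using incseqD[OF incseq_S_grid[OF T(1), of n], of j n] that True gs(2) by simp
    then have "stopped_sum K path_S T n (\<lambda>s t. path_weight t * w (Z t) - path_weight s * w (Z s)) = (\<Sum>j<n. ?F (Suc j) - ?F j)"
      unfolding stopped_sum_def by (intro sum.cong) auto
    then show ?thesis using True sum_lessThan_telescope[of ?F n] gs by simp
  next
    case False
    have "norm ((?F m - ?F 0) - (?F n - ?F 0)) \<le> norm (?F m) + norm (?F n)"
      using norm_triangle_ineq4[of "?F m" "?F n"] by simp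
    also have "\<dots> \<le> 4 * C * exp (norm \<mu> * T)"
      using bd[OF m(1)] bd[of n] mult_nonneg_nonneg[OF C_nonneg, of "exp (norm \<mu> * T)"] by (simp add: mult_ac)
    finally show ?thesis using False m(2) gs by simp
  qed
qed

end

section \<open>Dynkin's formula\<close>

text \<open>Two instances matter: \<open>a = \<mu> = 0\<close> exploits the stationarity of
  \<open>Z\<close>, and \<open>a = \<i> * l\<close> yields the characteristic function of
  \<open>U\<close>.\<close>

locale reflected_OU_test = test_function +
  fixes M :: "'a measure" and B Z L U :: "real \<Rightarrow> 'a \<Rightarrow> real" and \<alpha> \<gamma> \<sigma> d x :: real and a \<mu> :: complex
  assumes pos: "\<alpha> > 0" "\<gamma> > 0" "\<sigma> > 0" "d > 0"
    and bm: "standard_brownian_motion M B"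
    and OU: "doubly_reflected_OU M B \<alpha> \<gamma> \<sigma> d x Z L U"
    and Re_a: "Re a = 0" and w1_0: "w1 0 = 0" and w1_d: "w1 d = a * w d"
begin

sublocale prob_space M using bm by (rule bm_prob_space)

definition weight :: "real \<Rightarrow> 'a \<Rightarrow> complex" where
  "weight t \<omega> = exp (a * of_real (U t \<omega>) + \<mu> * of_real t)"

definition gen :: "real \<Rightarrow> complex" where
  "gen z = \<mu> * w z + of_real (\<alpha> - \<gamma> * z) * w1 z + of_real (\<sigma>\<^sup>2 / 2) * w2 z"

text \<open>The Brownian part of the increment, compensated by its mean to leading order, so that
  its expectation over a cell is of smaller order than the length of the cell.\<close>

definition gauss :: "real \<Rightarrow> real \<Rightarrow> 'a \<Rightarrow> complex" where
  "gauss s t \<omega> = weight s \<omega> * (w (Z s \<omega> + \<sigma> * (B t \<omega> - B s \<omega>)) - w (Z s \<omega>)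
     - of_real ((t - s) * (\<sigma>\<^sup>2 / 2)) * w2 (Z s \<omega>))"

abbreviation S :: "real \<Rightarrow> 'a \<Rightarrow> real" where "S t \<omega> \<equiv> L t \<omega> + U t \<omega>"
abbreviation step :: "real \<Rightarrow> real \<Rightarrow> 'a \<Rightarrow> complex" where
  "step s t \<omega> \<equiv> one_step a \<mu> \<alpha> \<gamma> \<sigma> w w1 (\<lambda>t. B t \<omega>) (\<lambda>t. Z t \<omega>) (\<lambda>t. U t \<omega>) s t"

lemma AE_path: "AE \<omega> in M. reflected_path_test \<alpha> \<gamma> \<sigma> d x (\<lambda>t. B t \<omega>) (\<lambda>t. Z t \<omega>) (\<lambda>t. L t \<omega>) (\<lambda>t. U t \<omega>) w w1 w2 C a"
proof -
  have "AE \<omega> in M. continuous_on {0..} (\<lambda>t. B t \<omega>)"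
    using bm by (simp add: standard_brownian_motion_def)
  moreover have "AE \<omega> in M.
        continuous_on {0..} (\<lambda>t. Z t \<omega>) \<and>
        regulator_path (\<lambda>t. L t \<omega>) \<and>
        regulator_path (\<lambda>t. U t \<omega>) \<and>
        (\<forall>t\<ge>0. Z t \<omega> \<in> {0..d}) \<and>
        (\<forall>t\<ge>0. Z t \<omega> = x + (LBINT s:{0..t}. \<alpha> - \<gamma> * Z s \<omega>) + \<sigma> * B t \<omega> + L t \<omega> - U t \<omega>) \<and>
        (\<forall>T>0. (\<integral>\<^sup>+ t\<in>{0..T}. indicator {t. Z t \<omega> > 0} t \<partial>stieltjes (\<lambda>t. L t \<omega>)) = 0) \<and>
        (\<forall>T>0. (\<integral>\<^sup>+ t\<in>{0..T}. indicator {t. Z t \<omega> < d} t \<partial>stieltjes (\<lambda>t. U t \<omega>)) = 0)"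
    using OU by (simp add: doubly_reflected_OU_def)
  ultimately show ?thesis
  proof eventually_elim
    case (elim \<omega>)
    then show ?case
      by unfold_locales (use pos Re_a w1_0 w1_d in blast)+
  qed
qed

lemma AE_initial: "AE \<omega> in M. Z 0 \<omega> = x \<and> U 0 \<omega> = 0"
proof -
  have "AE \<omega> in M. B 0 \<omega> = 0" using bm by (simp add: standard_brownian_motion_def)
  with AE_path show ?thesis
  proof eventually_elim
    case (elim \<omega>)
    interpret reflected_path_test \<alpha> \<gamma> \<sigma> d x "\<lambda>t. B t \<omega>" "\<lambda>t. Z t \<omega>" "\<lambda>t. L t \<omega>" "\<lambda>t. U t \<omega>" w w1 w2 C a by fact
    have "(LBINT s:{0..0::real}. \<alpha> - \<gamma> * Z s \<omega>) = 0"
      unfolding set_lebesgue_integral_def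
      by (rule integral_eq_zero_AE) (use AE_lborel_singleton[of "0::real"] in eventually_elim, auto)
    then show ?case using equation[of 0] elim(2) L_0 U_0 by simp
  qed
qed

lemma adapted [measurable]:
  assumes "0 \<le> t"
  shows "Z t \<in> borel_measurable (brownian_filtration M B t)" "L t \<in> borel_measurable (brownian_filtration M B t)"
    "U t \<in> borel_measurable (brownian_filtration M B t)"
  using OU assms by (auto simp: doubly_reflected_OU_def adapted_process_def)

lemma measurable_processes [measurable]:
  assumes "0 \<le> t"
  shows "Z t \<in> borel_measurable M" "L t \<in> borel_measurable M" "U t \<in> borel_measurable M" "B t \<in> borel_measurable M"
  using adapted[OF assms] measurable_brownian_filtration[OF bm] bm_measurable[OF bm assms] by auto

lemma measurable_weight [measurable]:
  assumes [measurable]: "0 \<le> t"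
  shows "weight t \<in> borel_measurable M" "weight t \<in> borel_measurable (brownian_filtration M B t)"
  unfolding weight_def using adapted[OF assms] measurable_processes[OF assms] by measurable

lemma measurable_gen [measurable]: "gen \<in> borel_measurable borel"
  unfolding gen_def by measurable

lemma norm_weight: "0 \<le> t \<Longrightarrow> t \<le> T \<Longrightarrow> norm (weight t \<omega>) \<le> exp (norm \<mu> * T)"
proof -
  assume t: "0 \<le> t" "t \<le> T"
  have "Re \<mu> * t \<le> norm \<mu> * t" using t abs_Re_le_cmod[of \<mu>] by (intro mult_right_mono) auto
  also have "\<dots> \<le> norm \<mu> * T" using t by (intro mult_left_mono) auto
  finally show ?thesis using Re_a by (simp add: weight_def)
qed

text \<open>\<open>2 * sqrt (2 / pi)\<close> is the third absolute moment of the standard normal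
  law.\<close>

definition gauss_const :: "real \<Rightarrow> real" where
  "gauss_const T = exp (norm \<mu> * T) * C * \<sigma> ^ 3 * (2 * sqrt (2 / pi))"

text \<open>Given the past up to \<open>s\<close>, the linear Taylor term has mean zero and the
  quadratic one is balanced by the compensator. The cubic remainder leaves an error of order
  \<open>t - s\<close> to the power 3/2, which still vanishes after summation over the grid. The
  stopping indicator is determined at time \<open>s\<close> and merges with the weight.\<close>

lemma gauss_expectation:
  assumes st: "0 \<le> s" "s < t" "t \<le> T"
  shows "integrable M (\<lambda>\<omega>. if S s \<omega> \<le> K then gauss s t \<omega> else 0)"
    and "norm (\<integral>\<omega>. (if S s \<omega> \<le> K then gauss s t \<omega> else 0) \<partial>M) \<le> gauss_const T * sqrt (t - s) ^ 3"
proof -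
  define D where "D \<omega> = B t \<omega> - B s \<omega>" for \<omega>
  define X where "X \<omega> = (if S s \<omega> \<le> K then weight s \<omega> else 0)" for \<omega>
  define \<rho> where "\<rho> \<omega> = X \<omega> * (w (Z s \<omega> + \<sigma> * D \<omega>) - w (Z s \<omega>) - of_real (\<sigma> * D \<omega>) * w1 (Z s \<omega>)
     - of_real ((\<sigma> * D \<omega>)\<^sup>2 / 2) * w2 (Z s \<omega>))" for \<omega>
  note mom = brownian_increment_moments[OF bm st(1,2), folded D_def]
  let ?e = "exp (norm \<mu> * T)"
  have t0: "0 \<le> t" using st by simp
  note [measurable] = adapted[OF st(1)] measurable_processes[OF st(1)] measurable_processes[OF t0] measurable_weight[OF st(1)]
  have XF[measurable]: "X \<in> borel_measurable (brownian_filtration M B s)" "X \<in> borel_measurable M"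
    unfolding X_def by measurable
  have Xb: "norm (X \<omega>) \<le> ?e" for \<omega>
    using norm_weight[of s T \<omega>] st by (auto simp: X_def)
  have Xb1: "norm (X \<omega> * w1 (Z s \<omega>)) \<le> ?e * C" "norm (X \<omega> * w2 (Z s \<omega>)) \<le> ?e * C" for \<omega>
    unfolding norm_mult by (intro mult_mono Xb w1_bound w2_bound; simp)+
  have XF1: "(\<lambda>\<omega>. X \<omega> * w1 (Z s \<omega>)) \<in> borel_measurable (brownian_filtration M B s)"
     "(\<lambda>\<omega>. X \<omega> * w2 (Z s \<omega>)) \<in> borel_measurable (brownian_filtration M B s)"
    by measurable
  note i1 = integral_mult_brownian_increment[OF bm st(1,2) XF1(1) Xb1(1), of 1, folded D_def]
  note i2 = integral_mult_brownian_increment[OF bm st(1,2) XF1(2) Xb1(2), of 2, folded D_def]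
  have Dm[measurable]: "D \<in> borel_measurable M" unfolding D_def by measurable
  have \<rho>b: "norm (\<rho> \<omega>) \<le> ?e * C * \<sigma> ^ 3 * \<bar>D \<omega>\<bar> ^ 3" for \<omega>
  proof -
    have "norm (\<rho> \<omega>) \<le> ?e * (C * \<bar>\<sigma> * D \<omega>\<bar> ^ 3)"
      unfolding \<rho>_def norm_mult using w_taylor2[of "Z s \<omega> + \<sigma> * D \<omega>" "Z s \<omega>"] by (intro mult_mono Xb) auto
    then show ?thesis using pos by (simp add: abs_mult power_mult_distrib mult_ac)
  qed
  have \<rho>i: "integrable M \<rho>"
  proof (rule Bochner_Integration.integrable_bound)
    show "integrable M (\<lambda>\<omega>. ?e * C * \<sigma> ^ 3 * \<bar>D \<omega>\<bar> ^ 3)" using mom(2)[of 3] by simp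
    show "\<rho> \<in> borel_measurable M" unfolding \<rho>_def by measurable
    show "AE \<omega> in M. norm (\<rho> \<omega>) \<le> norm (?e * C * \<sigma> ^ 3 * \<bar>D \<omega>\<bar> ^ 3)"
      using order_trans[OF \<rho>b abs_ge_self] by simp
  qed
  have X2i: "integrable M (\<lambda>\<omega>. X \<omega> * w2 (Z s \<omega>))"
    using Xb1(2) by (intro integrable_const_bound[of _ "?e * C"]) auto
  \<comment> \<open>Second-order Taylor expansion in the increment \<open>D\<close>, with the
    stopped weight \<open>X\<close> as a factor known at time \<open>s\<close>.\<close>
  have eq: "(if S s \<omega> \<le> K then gauss s t \<omega> else 0) =
     of_real \<sigma> * (X \<omega> * w1 (Z s \<omega>) * of_real (D \<omega> ^ 1)) + of_real (\<sigma>\<^sup>2 / 2) * (X \<omega> * w2 (Z s \<omega>) * of_real (D \<omega> ^ 2))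
     - of_real ((t - s) * (\<sigma>\<^sup>2 / 2)) * (X \<omega> * w2 (Z s \<omega>)) + \<rho> \<omega>" for \<omega>
    by (simp add: X_def gauss_def D_def[symmetric] \<rho>_def algebra_simps power2_eq_square)
  show "integrable M (\<lambda>\<omega>. if S s \<omega> \<le> K then gauss s t \<omega> else 0)"
    unfolding eq
    by (intro Bochner_Integration.integrable_add Bochner_Integration.integrable_diff integrable_mult_right i1(1) i2(1) X2i \<rho>i)
  have "(\<integral>\<omega>. (if S s \<omega> \<le> K then gauss s t \<omega> else 0) \<partial>M) =
     of_real \<sigma> * (\<integral>\<omega>. X \<omega> * w1 (Z s \<omega>) * of_real (D \<omega> ^ 1) \<partial>M)
     + of_real (\<sigma>\<^sup>2 / 2) * (\<integral>\<omega>. X \<omega> * w2 (Z s \<omega>) * of_real (D \<omega> ^ 2) \<partial>M)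
     - of_real ((t - s) * (\<sigma>\<^sup>2 / 2)) * (\<integral>\<omega>. X \<omega> * w2 (Z s \<omega>) \<partial>M) + (\<integral>\<omega>. \<rho> \<omega> \<partial>M)"
    unfolding eq
    by (simp only: Bochner_Integration.integral_add Bochner_Integration.integral_diff integral_mult_right_zero
      Bochner_Integration.integrable_add Bochner_Integration.integrable_diff integrable_mult_right i1(1) i2(1) X2i \<rho>i)
  also have "\<dots> = (\<integral>\<omega>. \<rho> \<omega> \<partial>M)"
    unfolding i1(2) i2(2) using mom(3,4) by simp
  finally have "norm (\<integral>\<omega>. (if S s \<omega> \<le> K then gauss s t \<omega> else 0) \<partial>M) = norm (\<integral>\<omega>. \<rho> \<omega> \<partial>M)" by simp
  also have "\<dots> \<le> (\<integral>\<omega>. ?e * C * \<sigma> ^ 3 * \<bar>D \<omega>\<bar> ^ 3 \<partial>M)"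
    using \<rho>i mom(2)[of 3] \<rho>b
    by (intro order_trans[OF integral_norm_bound] integral_mono) auto
  also have "\<dots> = gauss_const T * sqrt (t - s) ^ 3"
    using mom(5) by (simp add: gauss_const_def)
  finally show "norm (\<integral>\<omega>. (if S s \<omega> \<le> K then gauss s t \<omega> else 0) \<partial>M) \<le> gauss_const T * sqrt (t - s) ^ 3" .
qed

definition gen_bound :: real where
  "gen_bound = norm \<mu> * C + (\<alpha> + \<gamma> * d) * C + \<sigma>\<^sup>2 / 2 * C"

lemma norm_gen:
  assumes z: "z \<in> {0..d}"
  shows "norm (gen z) \<le> gen_bound"
proof -
  have "0 \<le> \<gamma> * z" "\<gamma> * z \<le> \<gamma> * d" using pos z by auto
  then have b: "\<bar>\<alpha> - \<gamma> * z\<bar> \<le> \<alpha> + \<gamma> * d" unfolding abs_le_iff using pos by linarith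
  have "norm (gen z) \<le> norm (\<mu> * w z) + norm (of_real (\<alpha> - \<gamma> * z) * w1 z) + norm (of_real (\<sigma>\<^sup>2 / 2) * w2 z)"
    unfolding gen_def by (intro norm_triangle_mono order_refl)
  also have "\<dots> \<le> norm \<mu> * C + (\<alpha> + \<gamma> * d) * C + \<sigma>\<^sup>2 / 2 * C"
    unfolding norm_mult norm_of_real using b w_bound w1_bound w2_bound
    by (intro add_mono mult_mono) auto
  finally show ?thesis unfolding gen_bound_def .
qed

lemma gen_bound_nonneg: "0 \<le> gen_bound"
  using C_nonneg pos by (simp add: gen_bound_def)

text \<open>The price of stopping: almost surely no cell before \<open>T\<close> is dropped outside
  this event.\<close>

definition overflow :: "real \<Rightarrow> real \<Rightarrow> real" where
  "overflow T K = measure M {\<omega> \<in> space M. K < S T \<omega>}"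

lemma overflow_tendsto_0: "0 \<le> T \<Longrightarrow> (\<lambda>m. overflow T (real m)) \<longlonglongrightarrow> 0"
proof -
  assume "0 \<le> T"
  then have [measurable]: "S T \<in> borel_measurable M" by measurable
  have "(\<lambda>m. measure M {\<omega> \<in> space M. real m < S T \<omega>}) \<longlonglongrightarrow> measure M (\<Inter>m. {\<omega> \<in> space M. real m < S T \<omega>})"
    by (intro finite_Lim_measure_decseq) (auto simp: decseq_def)
  moreover have "(\<Inter>m. {\<omega> \<in> space M. real m < S T \<omega>}) = {}"
  proof -
    have "\<exists>m. \<not> real m < S T \<omega>" for \<omega>
      using reals_Archimedean2[of "S T \<omega>"] less_asym by blast
    then show ?thesis by blast
  qed
  ultimately show ?thesis by (simp add: overflow_def)
qed


section \<open>From single cells to Dynkin's formula\<close>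

lemma functional_increment:
  "weight t \<omega> * w (Z t \<omega>) - weight s \<omega> * w (Z s \<omega>) =
     step s t \<omega> + (gauss s t \<omega> + of_real (t - s) * (weight s \<omega> * gen (Z s \<omega>)))"
  unfolding one_step_def gauss_def gen_def weight_def by (simp add: algebra_simps)

lemma measurable_step [measurable]:
  assumes "0 \<le> s" "s \<le> t"
  shows "step s t \<in> borel_measurable M"
proof -
  have t: "0 \<le> t" using assms by simp
  note [measurable] = measurable_processes[OF assms(1)] measurable_processes[OF t]
  show ?thesis unfolding one_step_def by measurable
qed

lemma measurable_stopped_sum:
  assumes "0 < T" "0 < n" "\<And>s t. 0 \<le> s \<Longrightarrow> s < t \<Longrightarrow> f s t \<in> borel_measurable M"
  shows "(\<lambda>\<omega>. stopped_sum K (\<lambda>t. S t \<omega>) T n (\<lambda>s t. f s t \<omega>)) \<in> borel_measurable M"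
  unfolding stopped_sum_def
proof (rule borel_measurable_sum)
  fix j
  note gs = grid_simps[OF assms(1,2)]
  note [measurable] = assms(3)[OF gs(4)[of j] gs(5)[of j]] measurable_processes[OF gs(4)[of j]]
  show "(\<lambda>\<omega>. if S (grid T n j) \<omega> \<le> K then f (grid T n j) (grid T n (Suc j)) \<omega> else 0) \<in> borel_measurable M"
    by measurable
qed

lemma step_expectation_tendsto_0:
  assumes T: "0 < T" and K: "0 \<le> K"
  shows "(\<lambda>n. \<integral>\<omega>. stopped_sum K (\<lambda>t. S t \<omega>) T n (\<lambda>s t. step s t \<omega>) \<partial>M) \<longlonglongrightarrow> 0"
    and "\<forall>\<^sub>F n in sequentially. integrable M (\<lambda>\<omega>. stopped_sum K (\<lambda>t. S t \<omega>) T n (\<lambda>s t. step s t \<omega>))"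
proof -
  let ?R = "\<lambda>n \<omega>. stopped_sum K (\<lambda>t. S t \<omega>) T n (\<lambda>s t. step s t \<omega>)"
  have "(\<lambda>n. T / real n) \<longlonglongrightarrow> 0" by (rule lim_const_over_n)
  then have "\<forall>\<^sub>F n in sequentially. T / real n < 1" by (rule order_tendstoD) simp
  then have "\<forall>\<^sub>F n in sequentially. 0 < n \<and> T / real n \<le> 1"
    using eventually_gt_at_top[of "0::nat"] by eventually_elim simp
  then obtain n0 where n0: "\<And>n. n0 \<le> n \<Longrightarrow> 0 < n \<and> T / real n \<le> 1"
    by (auto simp: eventually_sequentially)
  have meas: "?R n \<in> borel_measurable M" if "n0 \<le> n" for n
    using n0[OF that] T by (intro measurable_stopped_sum measurable_step) auto
  \<comment> \<open>\<open>K_large\<close> belongs to a locale that is interpreted separately for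
    each \<open>\<omega>\<close>; its value is written out here so that the constant is fixed before
    \<open>\<omega>\<close>.\<close>
  define KL where "KL = C * (exp (norm \<mu>) + 1) * (norm a + norm \<mu> + \<alpha> + \<gamma> * d + 1)
    + (exp (norm \<mu>) + 1) * C + norm \<mu> * C + (\<alpha> + \<gamma> * d) * C"
  define c where "c = exp (norm \<mu> * T) * KL * (K + 1 + T)"
  have bd: "AE \<omega> in M. \<forall>n\<ge>n0. norm (?R n \<omega>) \<le> c"
    using AE_path
  proof eventually_elim
    case (elim \<omega>)
    interpret reflected_path_test \<alpha> \<gamma> \<sigma> d x "\<lambda>t. B t \<omega>" "\<lambda>t. Z t \<omega>" "\<lambda>t. L t \<omega>" "\<lambda>t. U t \<omega>" w w1 w2 C a by fact
    have "K_large = KL" unfolding K_large_def N_def KL_def by simp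
    then have c: "c = exp (norm \<mu> * T) * K_large * (K + 1 + T)" by (simp add: c_def)
    show ?case unfolding c by (intro allI impI stopped_step_bound[OF T _ _ K]) (use n0 in blast)+
  qed
  have lim: "AE \<omega> in M. (\<lambda>n. ?R n \<omega>) \<longlonglongrightarrow> 0"
    using AE_path
  proof eventually_elim
    case (elim \<omega>)
    interpret reflected_path_test \<alpha> \<gamma> \<sigma> d x "\<lambda>t. B t \<omega>" "\<lambda>t. Z t \<omega>" "\<lambda>t. L t \<omega>" "\<lambda>t. U t \<omega>" w w1 w2 C a by fact
    show ?case using stopped_step_tendsto_0[OF T] .
  qed
  \<comment> \<open>Shifted by \<open>n0\<close>, because measurability and the bound have been
    established from there on.\<close>
  have "(\<lambda>n. \<integral>\<omega>. ?R (n + n0) \<omega> \<partial>M) \<longlonglongrightarrow> (\<integral>\<omega>. 0 \<partial>M)"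
  proof (rule integral_dominated_convergence[where w = "\<lambda>_. c"])
    show "AE \<omega> in M. (\<lambda>n. ?R (n + n0) \<omega>) \<longlonglongrightarrow> 0"
      using lim by eventually_elim (rule LIMSEQ_ignore_initial_segment)
    show "AE \<omega> in M. norm (?R (n + n0) \<omega>) \<le> c" for n
      using bd by eventually_elim simp
  qed (use meas in auto)
  then show "(\<lambda>n. \<integral>\<omega>. ?R n \<omega> \<partial>M) \<longlonglongrightarrow> 0"
    by (simp add: LIMSEQ_offset)
  show "\<forall>\<^sub>F n in sequentially. integrable M (?R n)"
    unfolding eventually_sequentially
    using bd meas by (intro exI[of _ n0] allI impI integrable_const_bound[of _ c]) (auto elim: eventually_mono)
qed

text \<open>The time integral appears as a limit of Riemann sums of expectations. Later arguments
  treat these sums term by term, which avoids joint measurability in time and sample point.\<close>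

theorem dynkin_formula:
  assumes T: "0 < T"
  shows "(\<lambda>n. \<Sum>j<n. of_real (T / real n) * (\<integral>\<omega>. weight (grid T n j) \<omega> * gen (Z (grid T n j) \<omega>) \<partial>M))
    \<longlonglongrightarrow> (\<integral>\<omega>. weight T \<omega> * w (Z T \<omega>) \<partial>M) - w x"
proof -
  let ?e = "exp (norm \<mu> * T)"
  \<comment> \<open>\<open>V\<close> is the unstopped drift sum and \<open>A\<close> its stopped
    version; \<open>Q\<close> is the stopped telescoping sum, which splits into the pathwise
    remainder \<open>R\<close>, the Gaussian part \<open>G\<close> and \<open>A\<close>.\<close>
  define V where "V n = (\<Sum>j<n. of_real (T / real n) * (\<integral>\<omega>. weight (grid T n j) \<omega> * gen (Z (grid T n j) \<omega>) \<partial>M))" for n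
  define Q where "Q K n \<omega> = stopped_sum K (\<lambda>t. S t \<omega>) T n (\<lambda>s t. weight t \<omega> * w (Z t \<omega>) - weight s \<omega> * w (Z s \<omega>))" for K n \<omega>
  define R where "R K n \<omega> = stopped_sum K (\<lambda>t. S t \<omega>) T n (\<lambda>s t. step s t \<omega>)" for K n \<omega>
  define G where "G K n \<omega> = stopped_sum K (\<lambda>t. S t \<omega>) T n (\<lambda>s t. gauss s t \<omega>)" for K n \<omega>
  define A where "A K n \<omega> = stopped_sum K (\<lambda>t. S t \<omega>) T n (\<lambda>s t. of_real (t - s) * (weight s \<omega> * gen (Z s \<omega>)))" for K n \<omega>
  define I where "I = (\<integral>\<omega>. weight T \<omega> * w (Z T \<omega>) \<partial>M) - w x"
  \<comment> \<open>The first summand pays for the drift dropped after stopping, the second for the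
    telescoping sum cut short.\<close>
  define c where "c = T * (?e * gen_bound) + 4 * C * ?e"
  have mW: "weight T \<in> borel_measurable M" "Z T \<in> borel_measurable M"
    using T by auto
  have fm: "integrable M (\<lambda>\<omega>. weight t \<omega> * w (Z t \<omega>))" if t: "0 \<le> t" "t \<le> T" for t
  proof -
    note [measurable] = measurable_processes[OF t(1)] measurable_weight[OF t(1)]
    have "norm (weight t \<omega> * w (Z t \<omega>)) \<le> ?e * C" for \<omega>
      unfolding norm_mult using t by (intro mult_mono norm_weight w_bound) auto
    then show ?thesis by (intro integrable_const_bound[of _ "?e * C"]) auto
  qed
  have gm: "integrable M (\<lambda>\<omega>. weight s \<omega> * gen (Z s \<omega>))"
    and gb: "AE \<omega> in M. norm (weight s \<omega> * gen (Z s \<omega>)) \<le> ?e * gen_bound" if s: "0 \<le> s" "s \<le> T" for s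
  proof -
    note [measurable] = measurable_processes[OF s(1)] measurable_weight[OF s(1)]
    note nw = norm_weight[OF s]
    show bd: "AE \<omega> in M. norm (weight s \<omega> * gen (Z s \<omega>)) \<le> ?e * gen_bound"
      using AE_path
    proof eventually_elim
      case (elim \<omega>)
      interpret reflected_path_test \<alpha> \<gamma> \<sigma> d x "\<lambda>t. B t \<omega>" "\<lambda>t. Z t \<omega>" "\<lambda>t. L t \<omega>" "\<lambda>t. U t \<omega>" w w1 w2 C a by fact
      show ?case unfolding norm_mult using s Z_range[OF s(1)] gen_bound_nonneg
        by (intro mult_mono nw norm_gen) auto
    qed
    show "integrable M (\<lambda>\<omega>. weight s \<omega> * gen (Z s \<omega>))"
      using bd by (intro integrable_const_bound[of _ "?e * gen_bound"]) auto
  qed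
  have initial: "(\<integral>\<omega>. weight 0 \<omega> * w (Z 0 \<omega>) \<partial>M) = w x"
  proof -
    note [measurable] = measurable_processes[of 0] measurable_weight[of 0]
    have "(\<integral>\<omega>. weight 0 \<omega> * w (Z 0 \<omega>) \<partial>M) = (\<integral>\<omega>. w x \<partial>M)"
      using AE_initial by (intro integral_cong_AE) (auto simp: weight_def)
    then show ?thesis by (simp add: prob_space)
  qed
  have main: "norm (V n - I) \<le> c * overflow T K + norm (\<integral>\<omega>. R K n \<omega> \<partial>M) + gauss_const T * (T * sqrt (T / real n))"
    if n: "0 < n" and Ri: "integrable M (R K n)" for K n
  proof -
    let ?t = "grid T n"
    note gs = grid_simps[OF T n]
    note gl = grid_le[OF T n]
    have tt: "0 \<le> ?t j" "?t j < ?t (Suc j)" "?t j \<le> T" "?t (Suc j) \<le> T" if "j < n" for j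
      using gs gl[of j] gl[of "Suc j"] that by auto
    have Aj: "integrable M (\<lambda>\<omega>. if S (?t j) \<omega> \<le> K then weight (?t j) \<omega> * gen (Z (?t j) \<omega>) else 0)"
      (is "integrable M (?Aj j)") if "j < n" for j
    proof (rule Bochner_Integration.integrable_bound[OF gm[OF tt(1,3)[OF that]]])
      note [measurable] = measurable_processes[OF tt(1)[OF that]] measurable_weight[OF tt(1)[OF that]]
      show "?Aj j \<in> borel_measurable M" by measurable
    qed auto
    have over: "AE \<omega> in M. (\<forall>j<n. S (?t j) \<omega> \<le> S T \<omega>) \<and>
        norm (Q K n \<omega> - (weight T \<omega> * w (Z T \<omega>) - weight 0 \<omega> * w (Z 0 \<omega>))) \<le> 4 * C * ?e * indicator {\<omega> \<in> space M. K < S T \<omega>} \<omega>"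
      using AE_path AE_space
    proof eventually_elim
      case (elim \<omega>)
      interpret reflected_path_test \<alpha> \<gamma> \<sigma> d x "\<lambda>t. B t \<omega>" "\<lambda>t. Z t \<omega>" "\<lambda>t. L t \<omega>" "\<lambda>t. U t \<omega>" w w1 w2 C a by fact
      have "S (?t j) \<omega> \<le> S T \<omega>" if "j < n" for j
        using L_mono U_mono tt[OF that] by (intro add_mono) auto
      moreover have "norm (Q K n \<omega> - (weight T \<omega> * w (Z T \<omega>) - weight 0 \<omega> * w (Z 0 \<omega>))) \<le> (if S T \<omega> \<le> K then 0 else 4 * C * ?e)"
        unfolding Q_def weight_def by (rule stopped_telescope_bound[OF T n])
      ultimately show ?case using elim(2) by (auto simp: indicator_def)
    qed
    have Gi: "integrable M (G K n)" unfolding G_def stopped_sum_def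
      using tt by (intro Bochner_Integration.integrable_sum gauss_expectation(1)) auto
    have A_eq: "A K n \<omega> = (\<Sum>j<n. of_real (T / real n) * ?Aj j \<omega>)" for \<omega>
      unfolding A_def stopped_sum_def using gs(3) by (intro sum.cong) auto
    have Ai: "integrable M (A K n)" unfolding A_eq
      by (intro Bochner_Integration.integrable_sum integrable_mult_right Aj) simp
    have QRGA: "Q K n \<omega> = R K n \<omega> + (G K n \<omega> + A K n \<omega>)" for \<omega>
      unfolding Q_def R_def G_def A_def functional_increment stopped_sum_add ..
    have Qi: "integrable M (Q K n)" unfolding QRGA using Ri Gi Ai by auto
    have [measurable]: "S T \<in> borel_measurable M" using measurable_processes[of T] T by auto
    have ind: "integrable M (\<lambda>\<omega>. indicator {\<omega> \<in> space M. K < S T \<omega>} \<omega> :: real)"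
      "(\<integral>\<omega>. indicator {\<omega> \<in> space M. K < S T \<omega>} \<omega> \<partial>M) = overflow T K"
      unfolding overflow_def by (simp_all add: integrable_indicator_iff less_top[symmetric])
    have 1: "norm ((\<integral>\<omega>. Q K n \<omega> \<partial>M) - I) \<le> 4 * C * ?e * overflow T K"
    proof -
      have "(\<integral>\<omega>. Q K n \<omega> \<partial>M) - I = (\<integral>\<omega>. Q K n \<omega> - (weight T \<omega> * w (Z T \<omega>) - weight 0 \<omega> * w (Z 0 \<omega>)) \<partial>M)"
        using Qi fm[of T] fm[of 0] T initial by (simp add: I_def)
      also have "norm \<dots> \<le> (\<integral>\<omega>. 4 * C * ?e * indicator {\<omega> \<in> space M. K < S T \<omega>} \<omega> \<partial>M)"
        using Qi fm[of T] fm[of 0] T over ind(1)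
        by (intro order_trans[OF integral_norm_bound] integral_mono_AE) auto
      finally show ?thesis using ind(2) by simp
    qed
    have 2: "norm (V n - (\<integral>\<omega>. A K n \<omega> \<partial>M)) \<le> T * (?e * gen_bound) * overflow T K"
    proof -
      have eq: "V n - (\<integral>\<omega>. A K n \<omega> \<partial>M) = (\<Sum>j<n. of_real (T / real n) *
          (\<integral>\<omega>. weight (?t j) \<omega> * gen (Z (?t j) \<omega>) - ?Aj j \<omega> \<partial>M))"
      proof -
        have "(\<integral>\<omega>. A K n \<omega> \<partial>M) = (\<Sum>j<n. of_real (T / real n) * (\<integral>\<omega>. ?Aj j \<omega> \<partial>M))"
          unfolding A_eq using Aj by (subst Bochner_Integration.integral_sum) (auto simp del: of_real_divide)
        moreover have "(\<integral>\<omega>. weight (?t j) \<omega> * gen (Z (?t j) \<omega>) - ?Aj j \<omega> \<partial>M) =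
           (\<integral>\<omega>. weight (?t j) \<omega> * gen (Z (?t j) \<omega>) \<partial>M) - (\<integral>\<omega>. ?Aj j \<omega> \<partial>M)" if "j < n" for j
          by (rule Bochner_Integration.integral_diff[OF gm[OF tt(1,3)[OF that]] Aj[OF that]])
        ultimately show ?thesis
          by (simp add: V_def sum_subtractf[symmetric] right_diff_distrib)
      qed
      have "norm (V n - (\<integral>\<omega>. A K n \<omega> \<partial>M)) \<le> (\<Sum>j<n. T / real n * (?e * gen_bound * overflow T K))"
        unfolding eq
      proof (rule sum_norm_le)
        fix j assume "j \<in> {..<n}"
        then have j: "j < n" by simp
        have "norm (\<integral>\<omega>. weight (?t j) \<omega> * gen (Z (?t j) \<omega>) - ?Aj j \<omega> \<partial>M) \<le>
            (\<integral>\<omega>. ?e * gen_bound * indicator {\<omega> \<in> space M. K < S T \<omega>} \<omega> \<partial>M)"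
        proof (intro order_trans[OF integral_norm_bound] integral_mono_AE)
          show "AE \<omega> in M. norm (weight (?t j) \<omega> * gen (Z (?t j) \<omega>) - ?Aj j \<omega>) \<le> ?e * gen_bound * indicator {\<omega> \<in> space M. K < S T \<omega>} \<omega>"
            using over gb[OF tt(1,3)[OF j]] AE_space
          proof eventually_elim
            case (elim \<omega>)
            have "S (?t j) \<omega> \<le> S T \<omega>" using elim(1) j by blast
            then show ?case using elim(2,3) gen_bound_nonneg by (auto simp: indicator_def)
          qed
        qed (use gm[OF tt(1,3)[OF j]] Aj[OF j] ind(1) in auto)
        then show "norm (of_real (T / real n) * (\<integral>\<omega>. weight (?t j) \<omega> * gen (Z (?t j) \<omega>) - ?Aj j \<omega> \<partial>M)) \<le> T / real n * (?e * gen_bound * overflow T K)"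
          unfolding norm_mult norm_of_real using T ind(2) by (intro mult_mono) auto
      qed
      also have "\<dots> = T * (?e * gen_bound) * overflow T K" using n by simp
      finally show ?thesis .
    qed
    \<comment> \<open>There are \<open>n\<close> cells, each contributing an error of order
      \<open>T / n\<close> to the power 3/2.\<close>
    have 3: "norm (\<integral>\<omega>. G K n \<omega> \<partial>M) \<le> gauss_const T * (T * sqrt (T / real n))"
    proof -
      have eq: "(\<integral>\<omega>. G K n \<omega> \<partial>M) = (\<Sum>j<n. \<integral>\<omega>. (if S (?t j) \<omega> \<le> K then gauss (?t j) (?t (Suc j)) \<omega> else 0) \<partial>M)"
        unfolding G_def stopped_sum_def
        using tt by (intro Bochner_Integration.integral_sum gauss_expectation(1)) auto
      have "norm (\<integral>\<omega>. G K n \<omega> \<partial>M) \<le> (\<Sum>j<n. gauss_const T * sqrt (T / real n) ^ 3)"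
        unfolding eq
      proof (rule sum_norm_le)
        fix j assume "j \<in> {..<n}"
        then show "norm (\<integral>\<omega>. (if S (?t j) \<omega> \<le> K then gauss (?t j) (?t (Suc j)) \<omega> else 0) \<partial>M) \<le> gauss_const T * sqrt (T / real n) ^ 3"
          using gauss_expectation(2)[of "?t j" "?t (Suc j)" T K] tt[of j] gs(3)[of j] by simp
      qed
      also have "\<dots> = gauss_const T * (T * sqrt (T / real n))"
        using n T by (simp add: power3_eq_cube)
      finally show ?thesis .
    qed
    have "(\<integral>\<omega>. Q K n \<omega> \<partial>M) = (\<integral>\<omega>. R K n \<omega> \<partial>M) + ((\<integral>\<omega>. G K n \<omega> \<partial>M) + (\<integral>\<omega>. A K n \<omega> \<partial>M))"
      unfolding QRGA using Ri Gi Ai by (simp add: Bochner_Integration.integral_add)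
    then have "V n - I = (V n - (\<integral>\<omega>. A K n \<omega> \<partial>M)) + ((\<integral>\<omega>. Q K n \<omega> \<partial>M) - I) - (\<integral>\<omega>. R K n \<omega> \<partial>M) - (\<integral>\<omega>. G K n \<omega> \<partial>M)"
      by simp
    then have "norm (V n - I) \<le> norm (V n - (\<integral>\<omega>. A K n \<omega> \<partial>M)) + norm ((\<integral>\<omega>. Q K n \<omega> \<partial>M) - I) + norm (\<integral>\<omega>. R K n \<omega> \<partial>M) + norm (\<integral>\<omega>. G K n \<omega> \<partial>M)"
      by (smt (verit) norm_triangle_ineq norm_triangle_ineq4)
    then show ?thesis using 1 2 3 unfolding c_def by (simp add: algebra_simps)
  qed
  have "V \<longlonglongrightarrow> I"
  proof (rule tendstoI)
    fix e :: real assume e: "0 < e"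
    \<comment> \<open>Order of the limits: the level \<open>m\<close> is fixed first to make the
      overflow small, then the mesh is refined at this level.\<close>
    have "(\<lambda>m. c * overflow T (real m)) \<longlonglongrightarrow> c * 0"
      using T by (intro tendsto_mult_left overflow_tendsto_0) simp
    then have "\<forall>\<^sub>F m in sequentially. c * overflow T (real m) < e / 2"
      using e by (intro order_tendstoD) auto
    then obtain m where m: "c * overflow T (real m) < e / 2"
      by (auto simp: eventually_sequentially)
    note R = step_expectation_tendsto_0[OF T of_nat_0_le_iff[of m], folded R_def]
    have "(\<lambda>n. sqrt (T / real n)) \<longlonglongrightarrow> sqrt 0" by (intro tendsto_real_sqrt lim_const_over_n)
    then have "(\<lambda>n. norm (\<integral>\<omega>. R (real m) n \<omega> \<partial>M) + gauss_const T * (T * sqrt (T / real n))) \<longlonglongrightarrow> norm (0::complex) + gauss_const T * (T * 0)"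
      using R(1) by (intro tendsto_intros) auto
    then have "\<forall>\<^sub>F n in sequentially. norm (\<integral>\<omega>. R (real m) n \<omega> \<partial>M) + gauss_const T * (T * sqrt (T / real n)) < e / 2"
      using e by (intro order_tendstoD) auto
    then show "\<forall>\<^sub>F n in sequentially. dist (V n) I < e"
      using R(2) eventually_gt_at_top[of "0::nat"]
    proof eventually_elim
      case (elim n)
      show ?case using main[of n "real m"] elim m by (simp add: dist_norm)
    qed
  qed
  then show ?thesis unfolding V_def I_def .
qed

end

section \<open>Families of laws with an invariant distribution\<close>

text \<open>For a non-measurable \<open>f\<close> the \<open>nn_integral\<close> is a lower
  integral, a supremum over simple functions below \<open>f\<close>. A sequence that exhausts this
  supremum has a measurable pointwise supremum that attains it.\<close>

lemma nn_integral_lower_measurable: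
  obtains g where "g \<in> borel_measurable M" "\<And>x. g x \<le> f x" "(\<integral>\<^sup>+ x. g x \<partial>M) = (\<integral>\<^sup>+ x. f x \<partial>M)"
proof -
  let ?A = "{g. simple_function M g \<and> g \<le> f}"
  have "?A \<noteq> {}" by (auto intro!: exI[of _ "\<lambda>_. 0"] simp: le_fun_def)
  then obtain F :: "nat \<Rightarrow> ennreal" where F: "range F \<subseteq> integral\<^sup>S M ` ?A" "Sup (integral\<^sup>S M ` ?A) = Sup (range F)"
    using ennreal_Sup_countable_SUP[of "integral\<^sup>S M ` ?A"] by (auto simp: image_def)
  then have "\<forall>n. \<exists>g. g \<in> ?A \<and> F n = integral\<^sup>S M g" by (auto simp: image_subset_iff)
  then obtain G where G: "\<And>n. simple_function M (G n)" "\<And>n. G n \<le> f" "\<And>n. F n = integral\<^sup>S M (G n)"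
    by (auto dest!: choice)
  define g where "g x = (SUP n. G n x)" for x
  show ?thesis
  proof
    show gm: "g \<in> borel_measurable M" unfolding g_def using G(1) by (intro borel_measurable_SUP) (auto intro: borel_measurable_simple_function)
    show le: "g x \<le> f x" for x unfolding g_def using G(2) by (auto intro!: SUP_least simp: le_fun_def)
    show "(\<integral>\<^sup>+ x. g x \<partial>M) = (\<integral>\<^sup>+ x. f x \<partial>M)"
    proof (rule antisym)
      show "(\<integral>\<^sup>+ x. g x \<partial>M) \<le> (\<integral>\<^sup>+ x. f x \<partial>M)" by (intro nn_integral_mono le)
      have "(\<integral>\<^sup>+ x. f x \<partial>M) = Sup (range F)" unfolding nn_integral_def F(2)[symmetric] ..
      also have "\<dots> \<le> (\<integral>\<^sup>+ x. g x \<partial>M)"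
      proof (rule SUP_least)
        fix n
        have "F n = (\<integral>\<^sup>+ x. G n x \<partial>M)" using G by (simp add: nn_integral_eq_simple_integral)
        also have "\<dots> \<le> (\<integral>\<^sup>+ x. g x \<partial>M)" unfolding g_def by (intro nn_integral_mono SUP_upper) simp
        finally show "F n \<le> (\<integral>\<^sup>+ x. g x \<partial>M)" .
      qed
      finally show "(\<integral>\<^sup>+ x. f x \<partial>M) \<le> (\<integral>\<^sup>+ x. g x \<partial>M)" .
    qed
  qed
qed

text \<open>The family \<open>P\<close> is not assumed to be a measurable kernel. The lower integrals of
  \<open>P y A\<close> and \<open>P y (- A)\<close> add up to 1, which forces both functions to be measurable up to
  null sets.\<close>

locale invariant_family =
  fixes \<pi> :: "real measure" and D :: "real set" and P :: "real \<Rightarrow> real measure"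
  assumes prob_pi: "prob_space \<pi>" and sets_pi: "sets \<pi> = sets borel" and AE_D: "AE y in \<pi>. y \<in> D"
    and prob_P: "\<And>y. y \<in> D \<Longrightarrow> prob_space (P y)" and sets_P: "\<And>y. y \<in> D \<Longrightarrow> sets (P y) = sets borel"
    and invariant: "\<And>A. A \<in> sets borel \<Longrightarrow> (\<integral>\<^sup>+ y\<in>D. emeasure (P y) A \<partial>\<pi>) = emeasure \<pi> A"
begin

lemma measurable_pi [simp]: "f \<in> borel_measurable \<pi> \<longleftrightarrow> f \<in> borel_measurable borel"
  by (intro iffI) (simp_all add: measurable_cong_sets[OF sets_pi refl])

lemma AE_emeasure:
  assumes A: "A \<in> sets borel"
  shows "\<exists>g\<in>borel_measurable \<pi>. (AE y in \<pi>. emeasure (P y) A = g y) \<and> (\<integral>\<^sup>+ y. g y \<partial>\<pi>) = emeasure \<pi> A"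
proof -
  interpret prob_space \<pi> by (rule prob_pi)
  have spP: "space (P y) = UNIV" if "y \<in> D" for y using sets_eq_imp_space_eq[OF sets_P[OF that]] by simp
  have sp: "space \<pi> = UNIV" using sets_eq_imp_space_eq[OF sets_pi] by simp
  have A': "- A \<in> sets borel" using A by auto
  obtain g where g: "g \<in> borel_measurable \<pi>" "\<And>y. g y \<le> emeasure (P y) A * indicator D y"
     "(\<integral>\<^sup>+ y. g y \<partial>\<pi>) = emeasure \<pi> A"
    using nn_integral_lower_measurable[of \<pi> "\<lambda>y. emeasure (P y) A * indicator D y"] invariant[OF A] by metis
  obtain g' where g': "g' \<in> borel_measurable \<pi>" "\<And>y. g' y \<le> emeasure (P y) (- A) * indicator D y"
     "(\<integral>\<^sup>+ y. g' y \<partial>\<pi>) = emeasure \<pi> (- A)"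
    using nn_integral_lower_measurable[of \<pi> "\<lambda>y. emeasure (P y) (- A) * indicator D y"] invariant[OF A'] by metis
  have total: "emeasure (P y) A + emeasure (P y) (- A) = 1" if "y \<in> D" for y
  proof -
    interpret Py: prob_space "P y" using that by (rule prob_P)
    have "emeasure (P y) A + emeasure (P y) (- A) = emeasure (P y) (A \<union> - A)"
      using A A' sets_P[OF that] by (intro plus_emeasure) auto
    then show ?thesis using Py.emeasure_space_1 spP[OF that] by simp
  qed
  have sum: "(\<integral>\<^sup>+ y. g y + g' y \<partial>\<pi>) = 1"
  proof -
    have "(\<integral>\<^sup>+ y. g y + g' y \<partial>\<pi>) = emeasure \<pi> A + emeasure \<pi> (- A)"
      using g g' by (subst nn_integral_add) auto
    also have "\<dots> = emeasure \<pi> (A \<union> - A)" using A A' sets_pi by (intro plus_emeasure) auto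
    finally show ?thesis using emeasure_space_1 sp by simp
  qed
  have le1: "g y + g' y \<le> 1" for y
  proof (cases "y \<in> D")
    case True
    then show ?thesis using add_mono[OF g(2)[of y] g'(2)[of y]] total by simp
  next
    case False
    then show ?thesis using add_mono[OF g(2)[of y] g'(2)[of y]] by simp
  qed
  \<comment> \<open>\<open>g + g'\<close> is at most 1 and has integral 1, hence equals 1 almost
    everywhere; then \<open>g\<close> cannot lie strictly below
    \<open>emeasure (P y) A\<close>.\<close>
  have "AE y in \<pi>. 1 - (g y + g' y) = 0"
  proof -
    have "(\<integral>\<^sup>+ y. 1 - (g y + g' y) \<partial>\<pi>) = (\<integral>\<^sup>+ y. 1 \<partial>\<pi>) - (\<integral>\<^sup>+ y. g y + g' y \<partial>\<pi>)"
      using g g' sum le1 by (intro nn_integral_diff) auto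
    also have "\<dots> = 0" using sum emeasure_space_1 by simp
    finally show ?thesis using g g' by (subst (asm) nn_integral_0_iff_AE) auto
  qed
  then have "AE y in \<pi>. emeasure (P y) A = g y"
    using AE_D
  proof eventually_elim
    case (elim y)
    then have 1: "g y + g' y = 1" using le1[of y] by (simp add: ennreal_minus_eq_0 antisym)
    have "emeasure (P y) A + g' y \<le> emeasure (P y) A + emeasure (P y) (- A)"
      using g'(2)[of y] elim by (intro add_left_mono) simp
    also have "\<dots> = g y + g' y" using total elim 1 by simp
    finally have "emeasure (P y) A + g' y \<le> g y + g' y" .
    \<comment> \<open>Finiteness of \<open>g' y\<close> permits its cancellation in
      \<open>ennreal\<close>.\<close>
    moreover have "g' y < \<top>" using le_less_trans[of "g' y" 1 \<top>] 1 by (metis add.commute ennreal_one_less_top le_iff_add)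
    ultimately have "emeasure (P y) A \<le> g y" by (auto simp: ennreal_add_left_cancel_le add.commute[of _ "g' y"])
    then show ?case using g(2)[of y] elim by (simp add: antisym)
  qed
  then show ?thesis using g by blast
qed

text \<open>A measurable version \<open>g\<close> travels through the induction with
  \<open>f\<close>. The exceptional null set depends on \<open>f\<close>, and the monotone limit
  unites only countably many of them.\<close>

lemma AE_nn_integral:
  fixes f :: "real \<Rightarrow> ennreal"
  assumes "f \<in> borel_measurable borel"
  shows "\<exists>g\<in>borel_measurable \<pi>. (AE y in \<pi>. (\<integral>\<^sup>+ z. f z \<partial>P y) = g y) \<and> (\<integral>\<^sup>+ y. g y \<partial>\<pi>) = (\<integral>\<^sup>+ y. f y \<partial>\<pi>)"
  using assms
proof (induction rule: borel_measurable_induct)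
  case (cong f g)
  then have "f = g" by auto
  then show ?case using cong by simp
next
  case (set A)
  obtain g where g: "g\<in>borel_measurable \<pi>" "AE y in \<pi>. emeasure (P y) A = g y" "(\<integral>\<^sup>+ y. g y \<partial>\<pi>) = emeasure \<pi> A"
    using AE_emeasure[of A] set by auto
  have "AE y in \<pi>. (\<integral>\<^sup>+ z. indicator A z \<partial>P y) = g y"
    using g(2) AE_D by eventually_elim (use set sets_P in simp)
  then show ?case using g set sets_pi by (intro bexI[of _ g]) auto
next
  case (mult u c)
  then obtain g where g: "g\<in>borel_measurable \<pi>" "AE y in \<pi>. (\<integral>\<^sup>+ z. u z \<partial>P y) = g y" "(\<integral>\<^sup>+ y. g y \<partial>\<pi>) = (\<integral>\<^sup>+ y. u y \<partial>\<pi>)" by blast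
  have "AE y in \<pi>. (\<integral>\<^sup>+ z. c * u z \<partial>P y) = c * g y"
    using g(2) AE_D
  proof eventually_elim
    case (elim y)
    then show ?case using mult.hyps by (subst nn_integral_cmult) (auto simp: measurable_cong_sets[OF sets_P refl])
  qed
  then show ?case using g mult.hyps by (intro bexI[of _ "\<lambda>y. c * g y"]) (auto simp: nn_integral_cmult)
next
  case (add u v)
  then obtain g g' where g: "g\<in>borel_measurable \<pi>" "AE y in \<pi>. (\<integral>\<^sup>+ z. u z \<partial>P y) = g y" "(\<integral>\<^sup>+ y. g y \<partial>\<pi>) = (\<integral>\<^sup>+ y. u y \<partial>\<pi>)"
    and g': "g'\<in>borel_measurable \<pi>" "AE y in \<pi>. (\<integral>\<^sup>+ z. v z \<partial>P y) = g' y" "(\<integral>\<^sup>+ y. g' y \<partial>\<pi>) = (\<integral>\<^sup>+ y. v y \<partial>\<pi>)" by blast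
  have "AE y in \<pi>. (\<integral>\<^sup>+ z. v z + u z \<partial>P y) = g' y + g y"
    using g(2) g'(2) AE_D
  proof eventually_elim
    case (elim y)
    then show ?case using add.hyps by (subst nn_integral_add) (auto simp: measurable_cong_sets[OF sets_P refl])
  qed
  then show ?case using g g' add.hyps by (intro bexI[of _ "\<lambda>y. g' y + g y"]) (auto simp: nn_integral_add)
next
  case (seq U)
  then have "\<forall>i. \<exists>g. g\<in>borel_measurable \<pi> \<and> (AE y in \<pi>. (\<integral>\<^sup>+ z. U i z \<partial>P y) = g y) \<and> (\<integral>\<^sup>+ y. g y \<partial>\<pi>) = (\<integral>\<^sup>+ y. U i y \<partial>\<pi>)" by blast
  then obtain g where g: "\<And>i. g i\<in>borel_measurable \<pi>" "\<And>i. AE y in \<pi>. (\<integral>\<^sup>+ z. U i z \<partial>P y) = g i y" "\<And>i. (\<integral>\<^sup>+ y. g i y \<partial>\<pi>) = (\<integral>\<^sup>+ y. U i y \<partial>\<pi>)"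
    by (auto dest!: choice)
  have all: "AE y in \<pi>. \<forall>i. (\<integral>\<^sup>+ z. U i z \<partial>P y) = g i y" using g(2) by (simp add: AE_all_countable)
  have AE1: "AE y in \<pi>. (\<integral>\<^sup>+ z. (SUP i. U i) z \<partial>P y) = (SUP i. g i y)"
    using all AE_D
  proof eventually_elim
    case (elim y)
    have "(\<integral>\<^sup>+ z. (SUP i. U i z) \<partial>P y) = (SUP i. \<integral>\<^sup>+ z. U i z \<partial>P y)"
      using seq.hyps elim(2) by (intro nn_integral_monotone_convergence_SUP) (auto simp: measurable_cong_sets[OF sets_P refl])
    then show ?case using elim(1) by (simp add: image_comp)
  qed
  have "(\<integral>\<^sup>+ y. (SUP i. g i y) \<partial>\<pi>) = (\<integral>\<^sup>+ y. (SUP i. U i) y \<partial>\<pi>)"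
  proof -
    have inc: "AE y in \<pi>. \<forall>i. g i y \<le> g (Suc i) y"
      using all
    proof eventually_elim
      case (elim y)
      show ?case using seq.hyps(3) unfolding elim[rule_format, symmetric]
        by (auto intro!: nn_integral_mono simp: incseq_Suc_iff le_fun_def)
    qed
    then have "AE y in \<pi>. g i y \<le> g (Suc i) y" for i by eventually_elim simp
    then have "(\<integral>\<^sup>+ y. (SUP i. g i y) \<partial>\<pi>) = (SUP i. \<integral>\<^sup>+ y. g i y \<partial>\<pi>)"
      using g(1) by (intro nn_integral_monotone_convergence_SUP_AE) auto
    also have "\<dots> = (SUP i. \<integral>\<^sup>+ y. U i y \<partial>\<pi>)" using g(3) by simp
    also have "\<dots> = (\<integral>\<^sup>+ y. (SUP i. U i y) \<partial>\<pi>)"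
      using seq.hyps by (intro nn_integral_monotone_convergence_SUP[symmetric]) auto
    finally show ?thesis by (simp add: image_comp)
  qed
  then show ?case using AE1 g(1) by (intro bexI[of _ "\<lambda>y. SUP i. g i y"]) auto
qed

text \<open>A bounded \<open>f\<close> becomes nonnegative after adding \<open>C\<close>, and the
  constant can be removed again because all measures involved have mass 1.\<close>

lemma AE_integral:
  fixes f :: "real \<Rightarrow> real"
  assumes f: "f \<in> borel_measurable borel" and C: "\<And>z. \<bar>f z\<bar> \<le> C"
  obtains g where "g \<in> borel_measurable \<pi>" "AE y in \<pi>. (\<integral>z. f z \<partial>P y) = g y" "(\<integral>y. g y \<partial>\<pi>) = (\<integral>y. f y \<partial>\<pi>)"
proof -
  interpret prob_space \<pi> by (rule prob_pi)
  have nn: "0 \<le> f z + C" for z using C[of z] by linarith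
  have "(\<lambda>z. ennreal (f z + C)) \<in> borel_measurable borel" using f by measurable
  then obtain g where g: "g \<in> borel_measurable \<pi>" "AE y in \<pi>. (\<integral>\<^sup>+ z. ennreal (f z + C) \<partial>P y) = g y"
      "(\<integral>\<^sup>+ y. g y \<partial>\<pi>) = (\<integral>\<^sup>+ z. ennreal (f z + C) \<partial>\<pi>)"
    using AE_nn_integral by blast
  have ennint: "integrable Q f" "(\<integral>\<^sup>+ z. ennreal (f z + C) \<partial>Q) = ennreal ((\<integral>z. f z \<partial>Q) + C)"
    if "prob_space Q" "sets Q = sets borel" for Q
  proof -
    interpret Q: prob_space Q by fact
    have fQ: "f \<in> borel_measurable Q" using f by (simp add: measurable_cong_sets[OF that(2) refl])
    show i: "integrable Q f" using fQ C by (intro Q.integrable_const_bound[of _ C]) auto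
    have "(\<integral>\<^sup>+ z. ennreal (f z + C) \<partial>Q) = ennreal (\<integral>z. f z + C \<partial>Q)"
      using i nn by (intro nn_integral_eq_integral) auto
    then show "(\<integral>\<^sup>+ z. ennreal (f z + C) \<partial>Q) = ennreal ((\<integral>z. f z \<partial>Q) + C)"
      using i by (simp add: Q.prob_space)
  qed
  have bd: "\<bar>\<integral>z. f z \<partial>Q\<bar> \<le> C" if "prob_space Q" "sets Q = sets borel" for Q
  proof -
    interpret Q: prob_space Q by fact
    have "\<bar>\<integral>z. f z \<partial>Q\<bar> \<le> (\<integral>z. C \<partial>Q)"
      using ennint(1)[OF that] C by (intro order_trans[OF integral_abs_bound] integral_mono) auto
    then show ?thesis by (simp add: Q.prob_space)
  qed
  have gy: "AE y in \<pi>. g y = ennreal ((\<integral>z. f z \<partial>P y) + C) \<and> \<bar>\<integral>z. f z \<partial>P y\<bar> \<le> C"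
    using g(2) AE_D by eventually_elim (use ennint(2) bd prob_P sets_P in auto)
  show ?thesis
  proof
    show "(\<lambda>y. enn2real (g y) - C) \<in> borel_measurable \<pi>" using g(1) by auto
    show "AE y in \<pi>. (\<integral>z. f z \<partial>P y) = enn2real (g y) - C"
      using gy by eventually_elim auto
    have "AE y in \<pi>. norm (enn2real (g y)) \<le> 2 * C" using gy by eventually_elim auto
    then have ig: "integrable \<pi> (\<lambda>y. enn2real (g y))" using g(1) by (intro integrable_const_bound[of _ "2 * C"]) auto
    have "ennreal (\<integral>y. enn2real (g y) \<partial>\<pi>) = (\<integral>\<^sup>+ y. ennreal (enn2real (g y)) \<partial>\<pi>)"
      using ig by (intro nn_integral_eq_integral[symmetric]) auto
    also have "\<dots> = (\<integral>\<^sup>+ y. g y \<partial>\<pi>)"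
      using gy by (intro nn_integral_cong_AE) (auto elim!: eventually_mono)
    also have "\<dots> = ennreal ((\<integral>z. f z \<partial>\<pi>) + C)" using g(3) ennint(2)[OF prob_pi sets_pi] by simp
    finally have "(\<integral>y. enn2real (g y) \<partial>\<pi>) = (\<integral>z. f z \<partial>\<pi>) + C"
      using bd[OF prob_pi sets_pi] by (subst (asm) ennreal_inj) (auto intro!: integral_nonneg_AE)
    then show "(\<integral>y. enn2real (g y) - C \<partial>\<pi>) = (\<integral>y. f y \<partial>\<pi>)" using ig by (simp add: prob_space)
  qed
qed

end

text \<open>Dynkin's formula with \<open>a = \<mu> = 0\<close> is integrated over the starting
  point. Invariance turns every term of the Riemann sum into the same integral against
  \<open>\<pi>\<close>, so the sum no longer depends on \<open>n\<close>, while the right-hand side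
  integrates to \<open>\<integral> f d\<pi> - \<integral> f d\<pi> = 0\<close>.\<close>

lemma stationary_integral_generator:
  assumes tf: "test_function w w1 w2 C"
    and pos: "\<alpha> > 0" "\<gamma> > 0" "\<sigma> > 0" "d > 0"
    and bm: "standard_brownian_motion M B"
    and stat: "stationary_distribution M B \<alpha> \<gamma> \<sigma> d \<pi>"
    and bc: "w1 0 = 0" "w1 d = 0"
  shows "(LINT z:{0..d}|\<pi>. Re (of_real (\<alpha> - \<gamma> * z) * w1 z + of_real (\<sigma>\<^sup>2 / 2) * w2 z)) = 0"
proof -
  interpret tf: test_function w w1 w2 C by (rule tf)
  interpret M: prob_space M using bm by (rule bm_prob_space)
  let ?g = "\<lambda>z. of_real (\<alpha> - \<gamma> * z) * w1 z + of_real (\<sigma>\<^sup>2 / 2) * w2 z"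
  \<comment> \<open>The cutoff makes the generator bounded on the whole line, as
    \<open>AE_integral\<close> asks, and changes nothing along solutions almost surely.\<close>
  define c where "c z = indicator {0..d} z * Re (?g z)" for z
  define f where "f z = Re (w z)" for z
  define G where "G = (\<alpha> + \<gamma> * d) * C + \<sigma>\<^sup>2 / 2 * C"
  from stat obtain Z where pi: "prob_space \<pi>" "sets \<pi> = sets borel" "AE y in \<pi>. y \<in> {0..d}"
    and sol: "\<forall>y\<in>{0..d}. \<exists>L U. doubly_reflected_OU M B \<alpha> \<gamma> \<sigma> d y (Z y) L U"
    and inv: "\<And>t A. 0 \<le> t \<Longrightarrow> A \<in> sets borel \<Longrightarrow> (\<integral>\<^sup>+ y\<in>{0..d}. emeasure M {\<omega>\<in>space M. Z y t \<omega> \<in> A} \<partial>\<pi>) = emeasure \<pi> A"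
    unfolding stationary_distribution_def by auto
  interpret pi: prob_space \<pi> by (rule pi)
  define P where "P t y = distr M borel (Z y t)" for t y
  have test: "\<exists>L U. reflected_OU_test w w1 w2 C M B (Z y) L U \<alpha> \<gamma> \<sigma> d y 0" if y: "y \<in> {0..d}" for y
  proof -
    obtain L U where "doubly_reflected_OU M B \<alpha> \<gamma> \<sigma> d y (Z y) L U" using sol y by blast
    then have "reflected_OU_test w w1 w2 C M B (Z y) L U \<alpha> \<gamma> \<sigma> d y 0"
      using pos bm bc by unfold_locales auto
    then show ?thesis by blast
  qed
  have Zm: "Z y t \<in> borel_measurable M" if y: "y \<in> {0..d}" and t: "0 \<le> t" for y t
  proof -
    obtain L U where "reflected_OU_test w w1 w2 C M B (Z y) L U \<alpha> \<gamma> \<sigma> d y 0" using test[OF y] by blast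
    then interpret T: reflected_OU_test w w1 w2 C M B "Z y" L U \<alpha> \<gamma> \<sigma> d y 0 0 .
    show ?thesis using T.measurable_processes[OF t] by simp
  qed
  have fam: "invariant_family \<pi> {0..d} (P t)" if t: "0 \<le> t" for t
  proof (rule invariant_family.intro)
    fix A :: "real set" assume A: "A \<in> sets borel"
    have "(\<integral>\<^sup>+ y\<in>{0..d}. emeasure (P t y) A \<partial>\<pi>) = (\<integral>\<^sup>+ y\<in>{0..d}. emeasure M {\<omega>\<in>space M. Z y t \<omega> \<in> A} \<partial>\<pi>)"
    proof (rule nn_integral_cong)
      fix y
      show "emeasure (P t y) A * indicator {0..d} y = emeasure M {\<omega>\<in>space M. Z y t \<omega> \<in> A} * indicator {0..d} y"
        using Zm[of y t] t A
        by (cases "y \<in> {0..d}") (auto simp: P_def emeasure_distr vimage_def Int_def conj_commute)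
    qed
    then show "(\<integral>\<^sup>+ y\<in>{0..d}. emeasure (P t y) A \<partial>\<pi>) = emeasure \<pi> A" using inv[OF t A] by simp
  next
    fix y :: real assume y: "y \<in> {0..d}"
    show "prob_space (P t y)" "sets (P t y) = sets borel"
      unfolding P_def using M.prob_space_distr[OF Zm[OF y t]] by simp_all
  qed (rule pi)+
  have cm: "c \<in> borel_measurable borel" unfolding c_def[abs_def] by measurable
  have fm: "f \<in> borel_measurable borel" unfolding f_def[abs_def] by measurable
  have fb: "\<bar>f z\<bar> \<le> C" for z unfolding f_def using abs_Re_le_cmod[of "w z"] tf.w_bound[of z] by linarith
  have G0: "0 \<le> G" unfolding G_def using pos tf.C_nonneg by simp
  have cb: "\<bar>c z\<bar> \<le> G" for z
  proof (cases "z \<in> {0..d}")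
    case True
    have "0 \<le> \<gamma> * z" "\<gamma> * z \<le> \<gamma> * d" using pos True by auto
    then have b: "\<bar>\<alpha> - \<gamma> * z\<bar> \<le> \<alpha> + \<gamma> * d" unfolding abs_le_iff using pos by linarith
    have "\<bar>c z\<bar> \<le> norm (?g z)" unfolding c_def using True abs_Re_le_cmod[of "?g z"] by simp
    also have "\<dots> \<le> norm (of_real (\<alpha> - \<gamma> * z) * w1 z) + norm (of_real (\<sigma>\<^sup>2 / 2) * w2 z)" by (rule norm_triangle_ineq)
    also have "\<dots> \<le> G" unfolding norm_mult norm_of_real G_def
      using b tf.w1_bound tf.w2_bound pos by (intro add_mono mult_mono) auto
    finally show ?thesis .
  qed (simp add: c_def G0)
  have P_int: "(\<integral>z. F z \<partial>P t y) = (\<integral>\<omega>. F (Z y t \<omega>) \<partial>M)" if "y \<in> {0..d}" "0 \<le> t" "F \<in> borel_measurable borel" for F :: "real \<Rightarrow> real" and t y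
    unfolding P_def using Zm[OF that(1,2)] that(3) by (rule integral_distr)
  have Pc: "\<bar>\<integral>z. c z \<partial>P t y\<bar> \<le> G" if "y \<in> {0..d}" "0 \<le> t" for t y
  proof -
    note [measurable] = Zm[OF that] cm
    have "\<bar>\<integral>\<omega>. c (Z y t \<omega>) \<partial>M\<bar> \<le> (\<integral>\<omega>. G \<partial>M)"
      using cb G0 by (intro order_trans[OF integral_abs_bound] integral_mono M.integrable_const_bound[of _ G]) auto
    then show ?thesis using P_int[OF that cm] by (simp add: M.prob_space)
  qed
  have dyn: "(\<lambda>n. \<Sum>j<n. (1 / real n) * (\<integral>z. c z \<partial>P (grid 1 n j) y)) \<longlonglongrightarrow> (\<integral>z. f z \<partial>P 1 y) - f y"
    if y: "y \<in> {0..d}" for y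
  proof -
    obtain L U where "reflected_OU_test w w1 w2 C M B (Z y) L U \<alpha> \<gamma> \<sigma> d y 0" using test[OF y] by blast
    then interpret T: reflected_OU_test w w1 w2 C M B "Z y" L U \<alpha> \<gamma> \<sigma> d y 0 0 .
    have gen: "T.gen = ?g" by (rule ext) (simp add: T.gen_def)
    have wt: "T.weight t \<omega> = 1" for t \<omega> by (simp add: T.weight_def)
    note D = tendsto_Re[OF T.dynkin_formula[of 1, unfolded wt mult_1_left, OF zero_less_one]]
    have gi: "integrable M (\<lambda>\<omega>. T.gen (Z y t \<omega>))" "(\<integral>\<omega>. Re (T.gen (Z y t \<omega>)) \<partial>M) = (\<integral>z. c z \<partial>P t y)" if t: "0 \<le> t" for t
    proof -
      note [measurable] = Zm[OF y t]
      have ran: "AE \<omega> in M. Z y t \<omega> \<in> {0..d}"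
        using T.AE_path
      proof eventually_elim
        case (elim \<omega>)
        then interpret reflected_path_test \<alpha> \<gamma> \<sigma> d y "\<lambda>t. B t \<omega>" "\<lambda>t. Z y t \<omega>" "\<lambda>t. L t \<omega>" "\<lambda>t. U t \<omega>" w w1 w2 C 0 0 .
        show ?case by (rule Z_range[OF t])
      qed
      show "integrable M (\<lambda>\<omega>. T.gen (Z y t \<omega>))"
        using ran T.norm_gen by (intro M.integrable_const_bound[of _ T.gen_bound]) (auto elim: eventually_mono)
      show "(\<integral>\<omega>. Re (T.gen (Z y t \<omega>)) \<partial>M) = (\<integral>z. c z \<partial>P t y)"
        unfolding P_int[OF y t cm]
      proof (rule integral_cong_AE)
        show "AE \<omega> in M. Re (T.gen (Z y t \<omega>)) = c (Z y t \<omega>)"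
          using ran by eventually_elim (simp add: c_def gen)
      qed (use cm in measurable)
    qed
    have wi: "integrable M (\<lambda>\<omega>. w (Z y 1 \<omega>))"
    proof -
      note [measurable] = Zm[OF y zero_le_one]
      show ?thesis using tf.w_bound by (intro M.integrable_const_bound[of _ C]) auto
    qed
    have g0: "0 \<le> grid 1 n j" for n j by (simp add: grid_def)
    have Re_scale: "Re (of_real r * z) = r * Re z" for r z by simp
    have "Re (of_real (1 / real n) * (\<integral>\<omega>. T.gen (Z y (grid 1 n j) \<omega>) \<partial>M)) = (1 / real n) * (\<integral>z. c z \<partial>P (grid 1 n j) y)" for n j
      by (simp only: Re_scale gi(2)[OF g0, symmetric] integral_Re[OF gi(1)[OF g0]])
    moreover have "Re ((\<integral>\<omega>. w (Z y 1 \<omega>) \<partial>M) - w y) = (\<integral>z. f z \<partial>P 1 y) - f y"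
      using integral_Re[OF wi] P_int[OF y zero_le_one fm] by (simp add: f_def)
    ultimately show ?thesis using D by (simp only: Re_sum)
  qed
  \<comment> \<open>The grid times are countable in number: one measurable version for each leaves a
    single null set to exclude.\<close>
  have "\<exists>g. \<forall>n j. g n j \<in> borel_measurable \<pi> \<and> (AE y in \<pi>. (\<integral>z. c z \<partial>P (grid 1 n j) y) = g n j y) \<and> (\<integral>y. g n j y \<partial>\<pi>) = (\<integral>y. c y \<partial>\<pi>)"
  proof -
    have "\<exists>g. g \<in> borel_measurable \<pi> \<and> (AE y in \<pi>. (\<integral>z. c z \<partial>P (grid 1 n j) y) = g y) \<and> (\<integral>y. g y \<partial>\<pi>) = (\<integral>y. c y \<partial>\<pi>)" for n j
      using invariant_family.AE_integral[OF fam cm cb, of "grid 1 n j"] by (auto simp: grid_def)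
    then show ?thesis by metis
  qed
  then obtain g where g: "\<And>n j. g n j \<in> borel_measurable \<pi>" "\<And>n j. AE y in \<pi>. (\<integral>z. c z \<partial>P (grid 1 n j) y) = g n j y"
    "\<And>n j. (\<integral>y. g n j y \<partial>\<pi>) = (\<integral>y. c y \<partial>\<pi>)" by blast
  obtain g1 where g1: "g1 \<in> borel_measurable \<pi>" "AE y in \<pi>. (\<integral>z. f z \<partial>P 1 y) = g1 y" "(\<integral>y. g1 y \<partial>\<pi>) = (\<integral>y. f y \<partial>\<pi>)"
    using invariant_family.AE_integral[OF fam fm fb, of 1] by auto
  have gall: "AE y in \<pi>. \<forall>n j. (\<integral>z. c z \<partial>P (grid 1 n j) y) = g n j y"
    using g(2) by (simp add: AE_all_countable)
  have gbd: "AE y in \<pi>. \<forall>n j. \<bar>g n j y\<bar> \<le> G"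
    using gall pi(3)
  proof eventually_elim
    case (elim y)
    have "0 \<le> grid 1 n j" for n j by (simp add: grid_def)
    from Pc[OF elim(2) this] show ?case using elim(1) by simp
  qed
  have gint: "integrable \<pi> (g n j)" for n j
    using gbd g(1) by (intro pi.integrable_const_bound[of _ G]) (auto elim!: eventually_mono)
  have sets_pi: "borel_measurable \<pi> = borel_measurable borel"
    by (rule measurable_cong_sets[OF pi(2) refl])
  have fint: "integrable \<pi> f" using fb fm by (intro pi.integrable_const_bound[of _ C]) (auto simp: sets_pi)
  have g1int: "integrable \<pi> g1"
  proof (rule pi.integrable_const_bound)
    show "AE y in \<pi>. norm (g1 y) \<le> C"
      using g1(2) pi(3)
    proof eventually_elim
      case (elim y)
      note [measurable] = Zm[OF elim(2) zero_le_one] fm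
      have "\<bar>\<integral>\<omega>. f (Z y 1 \<omega>) \<partial>M\<bar> \<le> (\<integral>\<omega>. C \<partial>M)"
        using fb tf.C_nonneg by (intro order_trans[OF integral_abs_bound] integral_mono M.integrable_const_bound[of _ C]) auto
      then show ?case using P_int[OF elim(2) zero_le_one fm] elim(1) by (simp add: M.prob_space)
    qed
  qed (rule g1)
  have "(\<lambda>n. \<integral>y. (\<Sum>j<n. (1 / real n) * g n j y) \<partial>\<pi>) \<longlonglongrightarrow> (\<integral>y. g1 y - f y \<partial>\<pi>)"
  proof (rule integral_dominated_convergence[where w = "\<lambda>_. G"])
    show "AE y in \<pi>. (\<lambda>n. \<Sum>j<n. (1 / real n) * g n j y) \<longlonglongrightarrow> g1 y - f y"
      using gall g1(2) pi(3)
    proof eventually_elim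
      case (elim y)
      show ?case using dyn[OF elim(3)] unfolding elim(2) using elim(1) by simp
    qed
    show "AE y in \<pi>. norm (\<Sum>j<n. (1 / real n) * g n j y) \<le> G" for n
      using gbd
    proof eventually_elim
      case (elim y)
      have "norm (\<Sum>j<n. (1 / real n) * g n j y) \<le> (\<Sum>j<n. (1 / real n) * G)"
      proof (rule sum_norm_le)
        fix j
        show "norm (1 / real n * g n j y) \<le> 1 / real n * G"
          using elim unfolding norm_mult by (intro mult_mono) auto
      qed
      also have "\<dots> \<le> G" using G0 by (cases "n = 0") auto
      finally show ?case .
    qed
  qed (use g(1) g1(1) fm in \<open>auto simp: sets_pi\<close>)
  moreover have "(\<integral>y. g1 y - f y \<partial>\<pi>) = 0" using g1int fint g1(3) by simp
  moreover have "(\<integral>y. (\<Sum>j<n. (1 / real n) * g n j y) \<partial>\<pi>) = (\<integral>y. c y \<partial>\<pi>)" if "0 < n" for n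
    using gint g(3) that by (subst Bochner_Integration.integral_sum) auto
  then have "\<forall>\<^sub>F n in sequentially. (\<integral>y. (\<Sum>j<n. (1 / real n) * g n j y) \<partial>\<pi>) = (\<integral>y. c y \<partial>\<pi>)"
    by (intro eventually_mono[OF eventually_gt_at_top[of "0::nat"]])
  ultimately have "(\<lambda>n. \<integral>y. c y \<partial>\<pi>) \<longlonglongrightarrow> 0"
    using Lim_transform_eventually by fastforce
  then have "(\<integral>y. c y \<partial>\<pi>) = 0" by (simp add: LIMSEQ_const_iff)
  then show ?thesis by (simp add: c_def set_lebesgue_integral_def)
qed

section \<open>The Poisson equations\<close>

text \<open>The orientation of the integral gives a two-sided derivative at negative points too;
  this matters because the clamp \<open>\<kappa>\<close> takes values in
  \<open>{-1..d + 1}\<close>.\<close>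

lemma DERIV_interval_integral:
  fixes f :: "real \<Rightarrow> real"
  assumes "continuous_on UNIV f"
  shows "((\<lambda>u. LBINT v=0..u. f v) has_real_derivative f x) (at x)"
proof -
  let ?a = "min 0 x - 1" and ?b = "max 0 x + 1"
  have "((\<lambda>u. LBINT v=ereal 0..u. f v) has_vector_derivative f x) (at x within {?a..?b})"
    by (rule interval_integral_FTC2) (auto intro: continuous_on_subset[OF assms])
  moreover have "at x within {?a..?b} = at x"
    by (rule at_within_interior) (auto simp: interior_atLeastAtMost_real)
  ultimately show ?thesis
    by (simp add: has_real_derivative_iff_has_vector_derivative zero_ereal_def)
qed

lemma DERIV_imp_continuous_on: "(\<And>x. (f has_real_derivative f' x) (at x)) \<Longrightarrow> continuous_on A f"
  by (meson DERIV_isCont continuous_at_imp_continuous_on)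

locale OU_params =
  fixes \<alpha> \<gamma> \<sigma> d :: real
  assumes pos: "\<alpha> > 0" "\<gamma> > 0" "\<sigma> > 0" "d > 0"
begin

abbreviation "W0 \<equiv> W \<alpha> \<gamma> \<sigma>"
abbreviation "q \<equiv> q_U \<alpha> \<gamma> \<sigma> d"

definition b :: "real \<Rightarrow> real" where "b z = \<alpha> - \<gamma> * z"
definition J :: "real \<Rightarrow> real" where "J u = (LBINT v=0..u. W0 v)"
text \<open>\<open>p\<close> is \<open>h'\<close>; \<open>p1\<close> and \<open>p2\<close> are its
  derivatives, obtained by solving the Poisson equation for the highest derivative and
  differentiating the result.\<close>

definition p :: "real \<Rightarrow> real" where "p u = 2 * q / \<sigma>\<^sup>2 * (J u / W0 u)"
definition p1 :: "real \<Rightarrow> real" where "p1 u = 2 / \<sigma>\<^sup>2 * (q - b u * p u)"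
definition p2 :: "real \<Rightarrow> real" where "p2 u = 2 / \<sigma>\<^sup>2 * (\<gamma> * p u - b u * p1 u)"
definition Q :: "real \<Rightarrow> real" where "Q u = (LBINT v=0..u. (p v)\<^sup>2 * W0 v)"

text \<open>The variance constant, chosen so that the Poisson equation for \<open>k\<close> below satisfies the
  Neumann condition at \<open>d\<close>.\<close>

definition \<eta>2 :: real where "\<eta>2 = \<sigma>\<^sup>2 * Q d / J d"
definition c :: "real \<Rightarrow> real" where "c u = (\<eta>2 - \<sigma>\<^sup>2 * (p u)\<^sup>2) / 2"
text \<open>The derivative of the corrector \<open>k\<close>, found with the integrating factor
  \<open>W0\<close>: the equation becomes \<open>\<sigma>\<^sup>2/2 * (r * W0)' = c * W0\<close> and
  is integrated from 0. Again \<open>r1\<close> and \<open>r2\<close> come from the equation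
  itself.\<close>

definition r :: "real \<Rightarrow> real" where "r u = 2 / \<sigma>\<^sup>2 * ((\<eta>2 * J u - \<sigma>\<^sup>2 * Q u) / 2 / W0 u)"
definition r1 :: "real \<Rightarrow> real" where "r1 u = 2 / \<sigma>\<^sup>2 * (c u - b u * r u)"
definition r2 :: "real \<Rightarrow> real" where "r2 u = 2 / \<sigma>\<^sup>2 * (- \<sigma>\<^sup>2 * p u * p1 u + \<gamma> * r u - b u * r1 u)"
definition k :: "real \<Rightarrow> real" where "k u = (LBINT v=0..u. r v)"

lemma W_pos: "W0 u > 0" by (simp add: W_def)

lemma DERIV_W [derivative_intros]: "(W0 has_real_derivative 2 / \<sigma>\<^sup>2 * b u * W0 u) (at u)"
  unfolding W_def b_def using pos
  by (auto intro!: derivative_eq_intros simp: field_simps power2_eq_square)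

lemma DERIV_J [derivative_intros]: "(J has_real_derivative W0 u) (at u)"
  unfolding J_def by (intro DERIV_interval_integral DERIV_imp_continuous_on[OF DERIV_W])

text \<open>Variation of constants: since \<open>W0' / W0 = 2 * b / \<sigma>\<^sup>2\<close>, a
  function \<open>f\<close> with \<open>f' = g * W0\<close> yields a solution \<open>y\<close> of
  \<open>\<sigma>\<^sup>2/2 * y' + b * y = g\<close>. Both Poisson equations are solved this
  way.\<close>

lemma DERIV_div_W:
  assumes "(f has_real_derivative g u * W0 u) (at u)"
  shows "((\<lambda>u. 2 / \<sigma>\<^sup>2 * (f u / W0 u)) has_real_derivative 2 / \<sigma>\<^sup>2 * (g u - b u * (2 / \<sigma>\<^sup>2 * (f u / W0 u)))) (at u)"
  using W_pos[of u] pos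
  by (auto intro!: derivative_eq_intros assms simp: field_simps power2_eq_square)

lemma DERIV_p [derivative_intros]: "(p has_real_derivative p1 u) (at u)"
proof -
  have "((\<lambda>u. q * J u) has_real_derivative q * W0 u) (at u)"
    by (auto intro!: derivative_eq_intros)
  from DERIV_div_W[of "\<lambda>u. q * J u" "\<lambda>_. q", OF this]
  show ?thesis by (simp add: p_def[abs_def] p1_def mult_ac)
qed

lemma DERIV_b [derivative_intros]: "(b has_real_derivative - \<gamma>) (at u)"
  unfolding b_def by (auto intro!: derivative_eq_intros)

lemma DERIV_p1 [derivative_intros]: "(p1 has_real_derivative p2 u) (at u)"
proof -
  have "((\<lambda>u. 2 / \<sigma>\<^sup>2 * (q - b u * p u)) has_real_derivative 2 / \<sigma>\<^sup>2 * (0 - (- \<gamma> * p u + p1 u * b u))) (at u)"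
    by (intro DERIV_cmult DERIV_diff DERIV_const DERIV_mult DERIV_b DERIV_p)
  then show ?thesis unfolding p1_def[abs_def] p2_def
    by (rule DERIV_cong) (simp add: p1_def mult.commute)
qed

lemma DERIV_Q [derivative_intros]: "(Q has_real_derivative (p u)\<^sup>2 * W0 u) (at u)"
  unfolding Q_def
  by (intro DERIV_interval_integral continuous_intros DERIV_imp_continuous_on[OF DERIV_W] DERIV_imp_continuous_on[OF DERIV_p])

lemma DERIV_c [derivative_intros]: "(c has_real_derivative - \<sigma>\<^sup>2 * p u * p1 u) (at u)"
  unfolding c_def by (auto intro!: derivative_eq_intros simp: power2_eq_square)

lemma DERIV_r [derivative_intros]: "(r has_real_derivative r1 u) (at u)"
proof -
  have "((\<lambda>u. (\<eta>2 * J u - \<sigma>\<^sup>2 * Q u) / 2) has_real_derivative c u * W0 u) (at u)"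
    by (auto intro!: derivative_eq_intros simp: c_def field_simps)
  from DERIV_div_W[of "\<lambda>u. (\<eta>2 * J u - \<sigma>\<^sup>2 * Q u) / 2" c, OF this]
  show ?thesis by (simp add: r_def[abs_def] r1_def)
qed

lemma DERIV_r1 [derivative_intros]: "(r1 has_real_derivative r2 u) (at u)"
proof -
  have "((\<lambda>u. 2 / \<sigma>\<^sup>2 * (c u - b u * r u)) has_real_derivative
      2 / \<sigma>\<^sup>2 * (- \<sigma>\<^sup>2 * p u * p1 u - (- \<gamma> * r u + r1 u * b u))) (at u)"
    by (intro DERIV_cmult DERIV_diff DERIV_const DERIV_mult DERIV_b DERIV_r DERIV_c)
  then show ?thesis unfolding r1_def[abs_def] r2_def
    by (rule DERIV_cong) (simp add: r1_def mult.commute)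
qed

lemma DERIV_k [derivative_intros]: "(k has_real_derivative r u) (at u)"
  unfolding k_def by (intro DERIV_interval_integral DERIV_imp_continuous_on[OF DERIV_r])

lemma DERIV_h [derivative_intros]: "(h \<alpha> \<gamma> \<sigma> d has_real_derivative p u) (at u)"
proof -
  have eq: "(LBINT v=0..u. W0 v / W0 u) = J u / W0 u" for u
    unfolding J_def by simp
  have "continuous_on UNIV (\<lambda>u. J u / W0 u)"
    using W_pos by (intro continuous_intros DERIV_imp_continuous_on[OF DERIV_W] DERIV_imp_continuous_on[OF DERIV_J])
      (auto simp: less_imp_neq[symmetric])
  from DERIV_cmult[OF DERIV_interval_integral[OF this], of "2 * q / \<sigma>\<^sup>2" u]
  show ?thesis unfolding h_def[abs_def] eq p_def .
qed

lemma continuous_p2: "continuous_on A p2" and continuous_r2: "continuous_on A r2"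
  unfolding p2_def r2_def
  by (intro continuous_intros DERIV_imp_continuous_on[OF DERIV_p] DERIV_imp_continuous_on[OF DERIV_p1]
    DERIV_imp_continuous_on[OF DERIV_r] DERIV_imp_continuous_on[OF DERIV_r1] DERIV_imp_continuous_on[OF DERIV_b])+

lemma at_0: "J 0 = 0" "p 0 = 0" "Q 0 = 0" "r 0 = 0" "k 0 = 0" "h \<alpha> \<gamma> \<sigma> d 0 = 0"
  by (simp_all add: J_def p_def Q_def r_def k_def h_def zero_ereal_def[symmetric])

lemma J_pos: "0 < u \<Longrightarrow> 0 < J u"
  using DERIV_pos_imp_increasing[of 0 u J] at_0 DERIV_J W_pos by metis

lemma q_pos: "0 < q"
  unfolding q_U_def using J_pos[OF pos(4)] W_pos pos by (simp add: J_def)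

text \<open>This normalisation is the origin of \<open>q_U\<close>: it is the constant for which the
  solution with \<open>h' 0 = 0\<close> has slope 1 at \<open>d\<close> and so cancels the growth of
  \<open>U\<close>.\<close>

lemma p_d: "p d = 1"
  using J_pos[OF pos(4)] W_pos[of d] pos unfolding p_def q_U_def J_def by (simp add: field_simps)

text \<open>The integrand is positive to the right of 0 but \<open>p\<close> vanishes at 0, hence
  monotonicity from the open interval. Positivity of the variance rests on this.\<close>

lemma Q_pos: "0 < u \<Longrightarrow> 0 < Q u"
proof -
  assume u: "0 < u"
  have "p v > 0" if "0 < v" for v
    unfolding p_def using J_pos[OF that] W_pos q_pos pos by simp
  then have "\<exists>y. (Q has_real_derivative y) (at v) \<and> y > 0" if "0 < v" "v < u" for v
    using DERIV_Q[of v] W_pos[of v] that by (intro exI[of _ "(p v)\<^sup>2 * W0 v"]) (simp add: less_imp_neq[symmetric])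
  from DERIV_pos_imp_increasing_open[OF u this]
  have "Q 0 < Q u" by (simp add: DERIV_imp_continuous_on[OF DERIV_Q])
  then show ?thesis using at_0 by simp
qed

lemma \<eta>2_pos: "0 < \<eta>2"
  unfolding \<eta>2_def using Q_pos J_pos pos by simp

lemma r_d: "r d = 0"
  unfolding r_def \<eta>2_def using J_pos[OF pos(4)] by (simp add: field_simps)

lemma poisson_h: "b z * p z + \<sigma>\<^sup>2 / 2 * p1 z = q"
  unfolding p1_def using pos by (simp add: field_simps)

lemma poisson_k: "b z * r z + \<sigma>\<^sup>2 / 2 * r1 z = (\<eta>2 - \<sigma>\<^sup>2 * (p z)\<^sup>2) / 2"
  unfolding r1_def c_def using pos by (simp add: field_simps)

end

section \<open>Smooth bounded extensions\<close>

text \<open>Closure under sums and products lets the bounds for \<open>exp \<phi>\<close> and its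
  derivatives be obtained without writing out constants.\<close>

definition bounded_lipschitz :: "(real \<Rightarrow> complex) \<Rightarrow> bool" where
  "bounded_lipschitz f \<longleftrightarrow> (\<exists>C. \<forall>y z. norm (f y) \<le> C \<and> norm (f z - f y) \<le> C * \<bar>z - y\<bar>)"

lemma bounded_lipschitzI:
  assumes "\<And>y. norm (f y) \<le> C" "\<And>y z. norm (f z - f y) \<le> K * \<bar>z - y\<bar>"
  shows "bounded_lipschitz f"
proof -
  have "norm (f z - f y) \<le> max C K * \<bar>z - y\<bar>" for y z
    by (rule order_trans[OF assms(2) mult_right_mono]) auto
  moreover have "norm (f y) \<le> max C K" for y using assms(1)[of y] by simp
  ultimately show ?thesis unfolding bounded_lipschitz_def by blast
qed

lemma bounded_lipschitz_deriv:
  assumes "\<And>y. (f has_vector_derivative f' y) (at y)" "\<And>y. norm (f y) \<le> C" "\<And>y. norm (f' y) \<le> K"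
  shows "bounded_lipschitz f"
  using assms by (intro bounded_lipschitzI[of f C K] vector_mean_value_bound) auto

lemma bounded_lipschitz_const: "bounded_lipschitz (\<lambda>_. c)"
  by (rule bounded_lipschitzI[of _ "norm c" 0]) auto

lemma bounded_lipschitz_add: "bounded_lipschitz f \<Longrightarrow> bounded_lipschitz g \<Longrightarrow> bounded_lipschitz (\<lambda>z. f z + g z)"
proof -
  assume "bounded_lipschitz f" "bounded_lipschitz g"
  then obtain A B where A: "\<And>y. norm (f y) \<le> A" "\<And>y z. norm (f z - f y) \<le> A * \<bar>z - y\<bar>"
    and B: "\<And>y. norm (g y) \<le> B" "\<And>y z. norm (g z - g y) \<le> B * \<bar>z - y\<bar>"
    unfolding bounded_lipschitz_def by blast
  show ?thesis
  proof (rule bounded_lipschitzI)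
    show "norm (f y + g y) \<le> A + B" for y by (intro norm_triangle_mono A B)
    have "f z + g z - (f y + g y) = (f z - f y) + (g z - g y)" for y z by simp
    then show "norm (f z + g z - (f y + g y)) \<le> (A + B) * \<bar>z - y\<bar>" for y z
      unfolding distrib_right by (metis norm_triangle_mono A(2) B(2))
  qed
qed

lemma bounded_lipschitz_mult: "bounded_lipschitz f \<Longrightarrow> bounded_lipschitz g \<Longrightarrow> bounded_lipschitz (\<lambda>z. f z * g z)"
proof -
  assume "bounded_lipschitz f" "bounded_lipschitz g"
  then obtain A B where A: "\<And>y. norm (f y) \<le> A" "\<And>y z. norm (f z - f y) \<le> A * \<bar>z - y\<bar>"
    and B: "\<And>y. norm (g y) \<le> B" "\<And>y z. norm (g z - g y) \<le> B * \<bar>z - y\<bar>"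
    unfolding bounded_lipschitz_def by blast
  have nn: "0 \<le> A" "0 \<le> B" using A(1)[of 0] B(1)[of 0] norm_ge_zero order_trans by blast+
  show ?thesis
  proof (rule bounded_lipschitzI)
    show "norm (f y * g y) \<le> A * B" for y unfolding norm_mult by (intro mult_mono A B nn norm_ge_zero)
    fix y z
    have "f z * g z - f y * g y = f z * (g z - g y) + (f z - f y) * g y" by (simp add: algebra_simps)
    then have "norm (f z * g z - f y * g y) \<le> norm (f z) * norm (g z - g y) + norm (f z - f y) * norm (g y)"
      by (metis norm_mult norm_triangle_ineq)
    also have "\<dots> \<le> A * (B * \<bar>z - y\<bar>) + (A * \<bar>z - y\<bar>) * B"
      using nn by (intro add_mono mult_mono A B) auto
    finally show "norm (f z * g z - f y * g y) \<le> (A * B + A * B) * \<bar>z - y\<bar>" by (simp add: algebra_simps)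
  qed
qed

definition smooth_bounded :: "(real \<Rightarrow> complex) \<Rightarrow> (real \<Rightarrow> complex) \<Rightarrow> (real \<Rightarrow> complex) \<Rightarrow> bool" where
  "smooth_bounded f f1 f2 \<longleftrightarrow> (\<forall>y. (f has_vector_derivative f1 y) (at y)) \<and>
     (\<forall>y. (f1 has_vector_derivative f2 y) (at y)) \<and> bounded_lipschitz f \<and> bounded_lipschitz f1 \<and> bounded_lipschitz f2"

lemma smooth_bounded_test_function:
  assumes "smooth_bounded f f1 f2"
  obtains C where "test_function f f1 f2 C"
proof -
  obtain A B D where A: "\<And>y. norm (f y) \<le> A" and B: "\<And>y. norm (f1 y) \<le> B"
    and D: "\<And>y. norm (f2 y) \<le> D" "\<And>y z. norm (f2 z - f2 y) \<le> D * \<bar>z - y\<bar>"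
    using assms unfolding smooth_bounded_def bounded_lipschitz_def by metis
  define C where "C = max A (max B D)"
  have "test_function f f1 f2 C"
  proof
    show "norm (f2 z - f2 y) \<le> C * \<bar>z - y\<bar>" for y z
      by (rule order_trans[OF D(2) mult_right_mono]) (auto simp: C_def)
  qed (use assms A B D(1) in \<open>auto simp: C_def le_max_iff_disj smooth_bounded_def\<close>)
  then show ?thesis by (rule that)
qed

lemma smooth_bounded_lincomb:
  assumes "smooth_bounded f f1 f2" "smooth_bounded g g1 g2"
  shows "smooth_bounded (\<lambda>z. c * f z + e * g z) (\<lambda>z. c * f1 z + e * g1 z) (\<lambda>z. c * f2 z + e * g2 z)"
  using assms unfolding smooth_bounded_def
  by (auto intro!: bounded_lipschitz_add bounded_lipschitz_mult bounded_lipschitz_const derivative_eq_intros)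

text \<open>\<open>exp\<close> is not Lipschitz on the plane, but \<open>f\<close> is bounded, so
  the composition has a bounded derivative.\<close>

lemma smooth_bounded_exp:
  assumes "smooth_bounded f f1 f2"
  shows "smooth_bounded (\<lambda>z. exp (f z)) (\<lambda>z. f1 z * exp (f z)) (\<lambda>z. (f2 z + f1 z * f1 z) * exp (f z))"
proof -
  have d: "(f has_vector_derivative f1 y) (at y)" "(f1 has_vector_derivative f2 y) (at y)"
    and b: "bounded_lipschitz f" "bounded_lipschitz f1" "bounded_lipschitz f2" for y using assms by (auto simp: smooth_bounded_def)
  have de: "((\<lambda>z. exp (f z)) has_vector_derivative f1 y * exp (f y)) (at y)" for y
    using field_vector_diff_chain_at[OF d(1), of exp "exp (f y)" y] DERIV_exp by (simp add: comp_def)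
  obtain A B where A: "\<And>y. norm (f y) \<le> A" and B: "\<And>y. norm (f1 y) \<le> B"
    using b unfolding bounded_lipschitz_def by metis
  have e: "norm (exp (f y)) \<le> exp A" for y
    using order_trans[OF norm_exp] A by (metis exp_le_cancel_iff)
  have be: "bounded_lipschitz (\<lambda>z. exp (f z))"
  proof (rule bounded_lipschitz_deriv[OF de e])
    show "norm (f1 y * exp (f y)) \<le> B * exp A" for y
      unfolding norm_mult by (intro mult_mono B e order_trans[OF norm_ge_zero B] norm_ge_zero)
  qed
  show ?thesis unfolding smooth_bounded_def
  proof (intro conjI allI)
    show "((\<lambda>z. f1 z * exp (f z)) has_vector_derivative (f2 y + f1 y * f1 y) * exp (f y)) (at y)" for y
      using has_vector_derivative_mult[OF d(2) de, of y] by (simp add: algebra_simps)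
  qed (intro de be bounded_lipschitz_mult bounded_lipschitz_add b)+
qed

text \<open>At the kink the difference quotient is either 0 or that of \<open>G\<close>, and the
  latter tends to \<open>G' 0 = 0\<close>. A function with a flat start can thus be glued to a
  constant.\<close>

lemma DERIV_compose_max_0:
  fixes G :: "real \<Rightarrow> real"
  assumes G: "\<And>x. (G has_real_derivative G' x) (at x)" and G0: "G' 0 = 0"
  shows "((\<lambda>z. G (max z 0)) has_real_derivative G' (max z 0)) (at z)"
proof -
  consider "z < 0" | "z = 0" | "z > 0" by linarith
  then show ?thesis
  proof cases
    case 1
    have "((\<lambda>z. G 0) has_real_derivative 0) (at z)" by simp
    then have "((\<lambda>z. G (max z 0)) has_real_derivative 0) (at z)"
      by (rule has_field_derivative_transform_within_open[of _ _ _ "{..<0}"]) (use 1 in auto)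
    then show ?thesis using 1 G0 by simp
  next
    case 2
    have "((\<lambda>h. (G (0 + h) - G 0) / h) \<longlongrightarrow> 0) (at 0)" using G[of 0] G0 by (simp add: DERIV_def)
    then have "((\<lambda>h. (G (max (0 + h) 0) - G (max 0 0)) / h) \<longlongrightarrow> 0) (at 0)"
    proof (rule tendsto_0_le[where K = 1], intro always_eventually allI)
      fix h :: real
      show "norm ((G (max (0 + h) 0) - G (max 0 0)) / h) \<le> norm ((G (0 + h) - G 0) / h) * 1"
      proof (cases "h \<le> 0")
        case True
        then have "(G (max (0 + h) 0) - G (max 0 0)) / h = 0" by simp
        then show ?thesis by (metis mult.right_neutral norm_ge_zero norm_zero)
      qed simp
    qed
    then show ?thesis using 2 G0 by (simp add: DERIV_def)
  next
    case 3
    have "((\<lambda>z. G (max z 0)) has_real_derivative G' z) (at z)"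
      by (rule has_field_derivative_transform_within_open[OF G, where S = "{0<..}"]) (use 3 in auto)
    then show ?thesis using 3 by simp
  qed
qed

lemma sin_diff_le: "\<bar>sin x - sin y\<bar> \<le> \<bar>x - y\<bar>" for x y :: real
proof -
  have "norm (complex_of_real (sin x) - complex_of_real (sin y)) \<le> 1 * \<bar>x - y\<bar>"
  proof (rule vector_mean_value_bound[of _ "\<lambda>z. of_real (cos z)"])
    show "((\<lambda>z. complex_of_real (sin z)) has_vector_derivative complex_of_real (cos z)) (at z)" for z
      by (intro has_vector_derivative_of_real DERIV_sin)
    show "norm (complex_of_real (cos z)) \<le> 1" for z by (simp only: norm_of_real abs_cos_le_one)
  qed
  then show ?thesis by (simp flip: of_real_diff)
qed

section \<open>A smooth clamp of the line to a neighbourhood of the interval\<close>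

locale smooth_clamp =
  fixes d :: real
  assumes d_pos: "0 < d"
begin

text \<open>A bounded \<open>C\<^sup>2\<close> extension of the identity of \<open>[0,d]\<close>: it equals \<open>sin z\<close> below \<open>0\<close>
  and \<open>d + sin (z - d)\<close> above \<open>d\<close>.\<close>

definition \<kappa> :: "real \<Rightarrow> real" where
  "\<kappa> z = z + (sin (max (z - d) 0) - max (z - d) 0) - (sin (max (- z) 0) - max (- z) 0)"
definition \<kappa>1 :: "real \<Rightarrow> real" where
  "\<kappa>1 z = 1 + (cos (max (z - d) 0) - 1) + (cos (max (- z) 0) - 1)"
definition \<kappa>2 :: "real \<Rightarrow> real" where
  "\<kappa>2 z = - sin (max (z - d) 0) + sin (max (- z) 0)"

lemma \<kappa>_id: "z \<in> {0..d} \<Longrightarrow> \<kappa> z = z" and \<kappa>1_id: "z \<in> {0..d} \<Longrightarrow> \<kappa>1 z = 1" and \<kappa>2_id: "z \<in> {0..d} \<Longrightarrow> \<kappa>2 z = 0"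
  by (auto simp: \<kappa>_def \<kappa>1_def \<kappa>2_def max_def)

lemma \<kappa>_range: "\<kappa> z \<in> {-1..d + 1}"
proof -
  have "z < 0 \<Longrightarrow> \<kappa> z = sin z" "z > d \<Longrightarrow> \<kappa> z = d + sin (z - d)" using d_pos by (auto simp: \<kappa>_def max_def)
  then show ?thesis
    using \<kappa>_id[of z] d_pos sin_ge_minus_one[of z] sin_le_one[of z] sin_ge_minus_one[of "z - d"] sin_le_one[of "z - d"]
    unfolding atLeastAtMost_iff by linarith
qed

text \<open>\<open>sin z - z\<close> has zero derivative at 0 and so has \<open>cos z - 1\<close>,
  which is why both \<open>\<kappa>\<close> and \<open>\<kappa>1\<close> can be glued at the ends of
  the interval.\<close>

lemma DERIV_\<kappa>: "(\<kappa> has_real_derivative \<kappa>1 z) (at z)"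
proof -
  have m: "((\<lambda>z. sin (max z 0) - max z 0) has_real_derivative cos (max z 0) - 1) (at z)" for z :: real
    by (rule DERIV_compose_max_0[of "\<lambda>z. sin z - z"]) (auto intro!: derivative_eq_intros)
  show ?thesis
    unfolding \<kappa>_def[abs_def] \<kappa>1_def
    by (rule DERIV_cong, rule DERIV_diff, rule DERIV_add, rule DERIV_ident,
        rule DERIV_chain2[OF m], (auto intro!: derivative_eq_intros)[1],
        rule DERIV_chain2[OF m, of "\<lambda>z. - z"], auto intro!: derivative_eq_intros)
qed

lemma DERIV_\<kappa>1: "(\<kappa>1 has_real_derivative \<kappa>2 z) (at z)"
proof -
  have m: "((\<lambda>z. cos (max z 0) - 1) has_real_derivative - sin (max z 0)) (at z)" for z :: real
    by (rule DERIV_compose_max_0[of "\<lambda>z. cos z - 1"]) (auto intro!: derivative_eq_intros)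
  show ?thesis
    unfolding \<kappa>1_def[abs_def] \<kappa>2_def
    by (rule DERIV_cong, rule DERIV_add, rule DERIV_add, rule DERIV_const,
        rule DERIV_chain2[OF m], (auto intro!: derivative_eq_intros)[1],
        rule DERIV_chain2[OF m, of "\<lambda>z. - z"], auto intro!: derivative_eq_intros)
qed

lemma \<kappa>1_bound: "\<bar>\<kappa>1 z\<bar> \<le> 3" and \<kappa>2_bound: "\<bar>\<kappa>2 z\<bar> \<le> 2"
proof -
  have "\<bar>1 + (a - 1) + (b - 1)\<bar> \<le> 3" "\<bar>- a + b\<bar> \<le> 2" if "\<bar>a\<bar> \<le> 1" "\<bar>b\<bar> \<le> 1" for a b :: real
    using that by linarith+
  then show "\<bar>\<kappa>1 z\<bar> \<le> 3" "\<bar>\<kappa>2 z\<bar> \<le> 2"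
    unfolding \<kappa>1_def \<kappa>2_def using abs_cos_le_one abs_sin_le_one by blast+
qed

lemma bounded_lipschitz_\<kappa>1: "bounded_lipschitz (\<lambda>z. of_real (\<kappa>1 z))"
proof (rule bounded_lipschitz_deriv[of _ "\<lambda>z. of_real (\<kappa>2 z)" 3 2])
  show "((\<lambda>z. complex_of_real (\<kappa>1 z)) has_vector_derivative complex_of_real (\<kappa>2 y)) (at y)" for y
    by (intro has_vector_derivative_of_real DERIV_\<kappa>1)
qed (use \<kappa>1_bound \<kappa>2_bound in auto)

lemma bounded_lipschitz_\<kappa>2: "bounded_lipschitz (\<lambda>z. of_real (\<kappa>2 z))"
proof (rule bounded_lipschitzI[of _ 2 2])
  show "norm (complex_of_real (\<kappa>2 z) - complex_of_real (\<kappa>2 y)) \<le> 2 * \<bar>z - y\<bar>" for y z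
  proof -
    have "\<bar>\<kappa>2 z - \<kappa>2 y\<bar> \<le> \<bar>sin (max (z - d) 0) - sin (max (y - d) 0)\<bar> + \<bar>sin (max (- z) 0) - sin (max (- y) 0)\<bar>"
    proof -
      have "\<bar>(- a + b) - (- a' + b')\<bar> \<le> \<bar>a - a'\<bar> + \<bar>b - b'\<bar>" for a b a' b' :: real by linarith
      then show ?thesis unfolding \<kappa>2_def .
    qed
    also have "\<dots> \<le> \<bar>max (z - d) 0 - max (y - d) 0\<bar> + \<bar>max (- z) 0 - max (- y) 0\<bar>"
      by (intro add_mono sin_diff_le)
    also have "\<dots> \<le> 2 * \<bar>z - y\<bar>" by (simp add: max_def abs_if)
    finally show ?thesis by (simp flip: of_real_diff)
  qed
qed (use \<kappa>2_bound in auto)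

text \<open>Only the values of \<open>F\<close> and \<open>F'\<close> on the compact interval
  \<open>{-1..d + 1}\<close> enter, and continuity bounds them there.\<close>

lemma bounded_lipschitz_compose_\<kappa>:
  assumes F: "\<And>z. (F has_real_derivative F' z) (at z)" and F': "continuous_on {-1..d + 1} F'"
  shows "bounded_lipschitz (\<lambda>z. of_real (F (\<kappa> z)))"
proof -
  have "continuous_on {-1..d + 1} F" using F by (meson DERIV_isCont continuous_at_imp_continuous_on)
  then have "bounded (F ` {-1..d + 1})" "bounded (F' ` {-1..d + 1})"
    using F' by (auto intro: compact_imp_bounded compact_continuous_image)
  then obtain A B where AB: "\<And>z. z \<in> {-1..d + 1} \<Longrightarrow> \<bar>F z\<bar> \<le> A" "\<And>z. z \<in> {-1..d + 1} \<Longrightarrow> \<bar>F' z\<bar> \<le> B"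
    unfolding bounded_iff by (metis imageI real_norm_def)
  show ?thesis
  proof (rule bounded_lipschitz_deriv[of _ "\<lambda>z. of_real (F' (\<kappa> z) * \<kappa>1 z)" A "B * 3"])
    show "((\<lambda>z. complex_of_real (F (\<kappa> z))) has_vector_derivative complex_of_real (F' (\<kappa> y) * \<kappa>1 y)) (at y)" for y
      by (intro has_vector_derivative_of_real DERIV_chain2[OF F DERIV_\<kappa>])
    show "norm (complex_of_real (F' (\<kappa> y) * \<kappa>1 y)) \<le> B * 3" for y
      unfolding norm_of_real abs_mult using AB(2)[OF \<kappa>_range[of y]] by (intro mult_mono \<kappa>1_bound) auto
    show "norm (complex_of_real (F (\<kappa> y))) \<le> A" for y using AB(1)[OF \<kappa>_range[of y]] by simp
  qed
qed

text \<open>Three derivatives of \<open>F\<close> are asked for since the second derivative of the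
  composition has to be Lipschitz; this is what \<open>p2\<close> and \<open>r2\<close> are
  for.\<close>

lemma smooth_bounded_compose_\<kappa>:
  assumes F: "\<And>z. (F has_real_derivative F1 z) (at z)" "\<And>z. (F1 has_real_derivative F2 z) (at z)" "\<And>z. (F2 has_real_derivative F3 z) (at z)"
    and cont: "continuous_on {-1..d + 1} F3"
  shows "smooth_bounded (\<lambda>z. of_real (F (\<kappa> z))) (\<lambda>z. of_real (F1 (\<kappa> z) * \<kappa>1 z))
     (\<lambda>z. of_real (F2 (\<kappa> z) * \<kappa>1 z * \<kappa>1 z + F1 (\<kappa> z) * \<kappa>2 z))"
  unfolding smooth_bounded_def
proof (intro conjI allI)
  have c: "continuous_on {-1..d + 1} F1" "continuous_on {-1..d + 1} F2"
    using F by (meson DERIV_isCont continuous_at_imp_continuous_on)+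
  note b = bounded_lipschitz_compose_\<kappa>[OF F(1) c(1)] bounded_lipschitz_compose_\<kappa>[OF F(2) c(2)] bounded_lipschitz_compose_\<kappa>[OF F(3) cont]
  show "bounded_lipschitz (\<lambda>z. of_real (F (\<kappa> z)))" "bounded_lipschitz (\<lambda>z. of_real (F1 (\<kappa> z) * \<kappa>1 z))"
    "bounded_lipschitz (\<lambda>z. of_real (F2 (\<kappa> z) * \<kappa>1 z * \<kappa>1 z + F1 (\<kappa> z) * \<kappa>2 z))"
    unfolding of_real_mult of_real_add by (intro bounded_lipschitz_add bounded_lipschitz_mult b bounded_lipschitz_\<kappa>1 bounded_lipschitz_\<kappa>2)+
  fix y
  show "((\<lambda>z. complex_of_real (F (\<kappa> z))) has_vector_derivative complex_of_real (F1 (\<kappa> y) * \<kappa>1 y)) (at y)"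
    by (intro has_vector_derivative_of_real DERIV_chain2[OF F(1) DERIV_\<kappa>])
  have "((\<lambda>z. F1 (\<kappa> z) * \<kappa>1 z) has_real_derivative F2 (\<kappa> y) * \<kappa>1 y * \<kappa>1 y + F1 (\<kappa> y) * \<kappa>2 y) (at y)"
    by (rule DERIV_cong[OF DERIV_mult[OF DERIV_chain2[OF F(2) DERIV_\<kappa>] DERIV_\<kappa>1]]) (simp add: mult.commute)
  then show "((\<lambda>z. complex_of_real (F1 (\<kappa> z) * \<kappa>1 z)) has_vector_derivative
      complex_of_real (F2 (\<kappa> y) * \<kappa>1 y * \<kappa>1 y + F1 (\<kappa> y) * \<kappa>2 y)) (at y)"
    by (rule has_vector_derivative_of_real)
qed

end

section \<open>The central limit theorem\<close>

locale OU_setting = OU_params +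
  fixes M :: "'a measure" and B :: "real \<Rightarrow> 'a \<Rightarrow> real"
  assumes bm: "standard_brownian_motion M B"
begin

sublocale smooth_clamp d using pos by unfold_locales
sublocale prob_space M using bm by (rule bm_prob_space)

lemma smooth_h: "smooth_bounded (\<lambda>z. of_real (h \<alpha> \<gamma> \<sigma> d (\<kappa> z))) (\<lambda>z. of_real (p (\<kappa> z) * \<kappa>1 z))
     (\<lambda>z. of_real (p1 (\<kappa> z) * \<kappa>1 z * \<kappa>1 z + p (\<kappa> z) * \<kappa>2 z))"
  by (rule smooth_bounded_compose_\<kappa>[OF DERIV_h DERIV_p DERIV_p1 continuous_p2])

lemma smooth_k: "smooth_bounded (\<lambda>z. of_real (k (\<kappa> z))) (\<lambda>z. of_real (r (\<kappa> z) * \<kappa>1 z))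
     (\<lambda>z. of_real (r1 (\<kappa> z) * \<kappa>1 z * \<kappa>1 z + r (\<kappa> z) * \<kappa>2 z))"
  by (rule smooth_bounded_compose_\<kappa>[OF DERIV_k DERIV_r DERIV_r1 continuous_r2])

lemma deriv_h: "deriv (h \<alpha> \<gamma> \<sigma> d) = p"
  using DERIV_h by (intro ext DERIV_imp_deriv)

text \<open>\<open>k' = r\<close> vanishes at both ends, so the generator identity applies to the
  extension of \<open>k\<close>, and on \<open>{0..d}\<close> the clamp disappears from the
  integrand.\<close>

lemma eta_U_squared_eq:
  assumes stat: "stationary_distribution M B \<alpha> \<gamma> \<sigma> d \<pi>"
  shows "eta_U_squared \<alpha> \<gamma> \<sigma> d \<pi> = \<eta>2"
proof -
  have pi: "prob_space \<pi>" "sets \<pi> = sets borel" "AE y in \<pi>. y \<in> {0..d}"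
    using stat by (auto simp: stationary_distribution_def)
  interpret pi: prob_space \<pi> by (rule pi)
  obtain C where C: "test_function (\<lambda>z. of_real (k (\<kappa> z))) (\<lambda>z. of_real (r (\<kappa> z) * \<kappa>1 z))
     (\<lambda>z. of_real (r1 (\<kappa> z) * \<kappa>1 z * \<kappa>1 z + r (\<kappa> z) * \<kappa>2 z)) C"
    using smooth_bounded_test_function[OF smooth_k] .
  have 0: "0 \<in> {0..d}" "d \<in> {0..d}" using pos by auto
  have p0: "(LINT z:{0..d}|\<pi>. Re (of_real (\<alpha> - \<gamma> * z) * of_real (r (\<kappa> z) * \<kappa>1 z) +
      of_real (\<sigma>\<^sup>2 / 2) * of_real (r1 (\<kappa> z) * \<kappa>1 z * \<kappa>1 z + r (\<kappa> z) * \<kappa>2 z))) = 0"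
    by (rule stationary_integral_generator[OF C pos bm stat])
      (use 0 \<kappa>_id at_0 r_d in simp_all)
  have "(LINT z:{0..d}|\<pi>. (\<eta>2 - \<sigma>\<^sup>2 * (p z)\<^sup>2) / 2) = 0"
  proof -
    have "(LINT z:{0..d}|\<pi>. (\<eta>2 - \<sigma>\<^sup>2 * (p z)\<^sup>2) / 2) = (LINT z:{0..d}|\<pi>. Re (of_real (\<alpha> - \<gamma> * z) * of_real (r (\<kappa> z) * \<kappa>1 z) +
      of_real (\<sigma>\<^sup>2 / 2) * of_real (r1 (\<kappa> z) * \<kappa>1 z * \<kappa>1 z + r (\<kappa> z) * \<kappa>2 z)))"
    proof (rule set_lebesgue_integral_cong)
      show "\<forall>z. z \<in> {0..d} \<longrightarrow> (\<eta>2 - \<sigma>\<^sup>2 * (p z)\<^sup>2) / 2 = Re (of_real (\<alpha> - \<gamma> * z) * of_real (r (\<kappa> z) * \<kappa>1 z) +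
        of_real (\<sigma>\<^sup>2 / 2) * of_real (r1 (\<kappa> z) * \<kappa>1 z * \<kappa>1 z + r (\<kappa> z) * \<kappa>2 z))"
      proof (intro allI impI)
        fix z assume z: "z \<in> {0..d}"
        show "(\<eta>2 - \<sigma>\<^sup>2 * (p z)\<^sup>2) / 2 = Re (of_real (\<alpha> - \<gamma> * z) * of_real (r (\<kappa> z) * \<kappa>1 z) +
          of_real (\<sigma>\<^sup>2 / 2) * of_real (r1 (\<kappa> z) * \<kappa>1 z * \<kappa>1 z + r (\<kappa> z) * \<kappa>2 z))"
          unfolding \<kappa>_id[OF z] \<kappa>1_id[OF z] \<kappa>2_id[OF z] poisson_k[symmetric] b_def by simp
      qed
    qed (use pi(2) in simp)
    then show ?thesis using p0 by simp
  qed
  moreover have pint: "set_integrable \<pi> {0..d} (\<lambda>z. (p z)\<^sup>2)"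
  proof -
    have "continuous_on {0..d} p" by (rule DERIV_imp_continuous_on[OF DERIV_p])
    then have "bounded (p ` {0..d})" by (intro compact_imp_bounded compact_continuous_image) auto
    then obtain K where K: "\<And>z. z \<in> {0..d} \<Longrightarrow> \<bar>p z\<bar> \<le> K" unfolding bounded_iff by (metis imageI real_norm_def)
    have [measurable]: "p \<in> borel_measurable borel"
      by (intro borel_measurable_continuous_onI DERIV_imp_continuous_on[OF DERIV_p])
    have "(\<lambda>z. indicator {0..d} z *\<^sub>R (p z)\<^sup>2) \<in> borel_measurable borel" by measurable
    moreover have "norm (indicator {0..d} z *\<^sub>R (p z)\<^sup>2) \<le> K\<^sup>2" for z
      using K[of z] by (auto simp: indicator_def abs_le_square_iff[symmetric])
    ultimately show ?thesis unfolding set_integrable_def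
      by (intro pi.integrable_const_bound[of _ "K\<^sup>2"]) (auto simp: measurable_cong_sets[OF pi(2) refl])
  qed
  moreover have cint: "set_integrable \<pi> {0..d} (\<lambda>z. \<eta>2)" "(LINT z:{0..d}|\<pi>. \<eta>2) = \<eta>2"
  proof -
    have m: "{0..d} \<in> sets \<pi>" using pi(2) by simp
    have "measure \<pi> {0..d} = 1" using pi(3) m by (simp add: pi.prob_eq_1)
    then show "set_integrable \<pi> {0..d} (\<lambda>z. \<eta>2)" "(LINT z:{0..d}|\<pi>. \<eta>2) = \<eta>2"
      using m by (auto simp: set_integrable_def set_lebesgue_integral_def less_top[symmetric])
  qed
  ultimately have "\<eta>2 - \<sigma>\<^sup>2 * (LINT z:{0..d}|\<pi>. (p z)\<^sup>2) = 0"
    by (simp add: set_integral_diff)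
  then show ?thesis unfolding eta_U_squared_def deriv_h by simp
qed

text \<open>Three errors: replacing \<open>w (Z T)\<close> by 1, the accumulated drift, and
  replacing \<open>w x\<close> by 1. Each carries a positive power of \<open>l\<close> outside the
  exponentials, hence \<open>err K \<theta> 0 = 0\<close>.\<close>

definition err :: "real \<Rightarrow> real \<Rightarrow> real \<Rightarrow> real" where
  "err K \<theta> l = exp (\<theta>\<^sup>2 * \<eta>2 / 2) * (exp (l\<^sup>2 * K) * (\<bar>l\<bar> * K + l\<^sup>2 * K)
       + \<theta>\<^sup>2 * (exp (l\<^sup>2 * K) * (\<sigma>\<^sup>2 / 2 * (2 * \<bar>l\<bar> * K\<^sup>2 + l\<^sup>2 * K\<^sup>2))))
     + exp (l\<^sup>2 * K) * (\<bar>l\<bar> * K + l\<^sup>2 * K)"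

lemma err_tendsto_0:
  assumes "(g \<longlongrightarrow> 0) F"
  shows "((\<lambda>t. err K \<theta> (g t)) \<longlongrightarrow> 0) F"
proof -
  have "((\<lambda>t. err K \<theta> (g t)) \<longlongrightarrow> err K \<theta> 0) F"
    unfolding err_def
    by (intro tendsto_intros tendsto_rabs_zero assms | (rule tendsto_eq_intros, rule assms))+
       (use assms in \<open>auto intro!: tendsto_eq_intros\<close>)
  then show ?thesis by (simp add: err_def)
qed

lemma bounds_on_interval:
  obtains K where "\<And>z. z \<in> {0..d} \<Longrightarrow> \<bar>h \<alpha> \<gamma> \<sigma> d z\<bar> \<le> K" "\<And>z. z \<in> {0..d} \<Longrightarrow> \<bar>k z\<bar> \<le> K"
    "\<And>z. z \<in> {0..d} \<Longrightarrow> \<bar>p z\<bar> \<le> K" "\<And>z. z \<in> {0..d} \<Longrightarrow> \<bar>r z\<bar> \<le> K" "0 \<le> K"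
proof -
  have bd: "\<exists>K. \<forall>z\<in>{0..d}. \<bar>f z\<bar> \<le> K" if "continuous_on {0..d} f" for f :: "real \<Rightarrow> real"
  proof -
    have "bounded (f ` {0..d})" using that by (intro compact_imp_bounded compact_continuous_image) auto
    then show ?thesis unfolding bounded_iff by (metis imageI real_norm_def)
  qed
  obtain K1 K2 K3 K4 where K: "\<forall>z\<in>{0..d}. \<bar>h \<alpha> \<gamma> \<sigma> d z\<bar> \<le> K1" "\<forall>z\<in>{0..d}. \<bar>k z\<bar> \<le> K2"
      "\<forall>z\<in>{0..d}. \<bar>p z\<bar> \<le> K3" "\<forall>z\<in>{0..d}. \<bar>r z\<bar> \<le> K4"
    using bd[OF DERIV_imp_continuous_on[OF DERIV_h]] bd[OF DERIV_imp_continuous_on[OF DERIV_k]]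
      bd[OF DERIV_imp_continuous_on[OF DERIV_p]] bd[OF DERIV_imp_continuous_on[OF DERIV_r]] by metis
  show ?thesis
    by (rule that[of "\<bar>K1\<bar> + \<bar>K2\<bar> + \<bar>K3\<bar> + \<bar>K4\<bar>"]) (use K in fastforce)+
qed

lemma integral_norm_bound_ae:
  fixes f :: "'a \<Rightarrow> complex"
  assumes "AE \<omega> in M. norm (f \<omega>) \<le> K"
  shows "norm (\<integral>\<omega>. f \<omega> \<partial>M) \<le> K"
proof (cases "integrable M f")
  case True
  have "norm (\<integral>\<omega>. f \<omega> \<partial>M) \<le> (\<integral>\<omega>. K \<partial>M)"
    using True assms by (intro order_trans[OF integral_norm_bound] integral_mono_AE) auto
  then show ?thesis by (simp add: prob_space)
next
  \<comment> \<open>A non-integrable function has integral 0 by convention; what remains is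
    \<open>0 \<le> K\<close>, which the almost sure bound forces on a probability space.\<close>
  case False
  have "AE \<omega> in M. 0 \<le> K" using assms by eventually_elim (rule order_trans[OF norm_ge_zero])
  then have "0 \<le> K" by simp
  then show ?thesis using False by (simp add: not_integrable_integral_eq)
qed

text \<open>Apart from the deterministic factor \<open>exp (\<theta>\<^sup>2 * \<eta>2 / 2)\<close>
  the weight at \<open>T\<close> is the character whose expectation is sought. Since
  \<open>l\<^sup>2 * T = \<theta>\<^sup>2\<close>, a drift of size
  \<open>l\<^sup>2 * \<Gamma>\<close> per unit time accumulates to
  \<open>\<theta>\<^sup>2 * \<Gamma>\<close> up to that factor, and \<open>\<Gamma>\<close> is
  itself of order \<open>l\<close>.\<close>

lemma char_estimate:
  fixes \<theta> :: real
  assumes OU: "doubly_reflected_OU M B \<alpha> \<gamma> \<sigma> d x Z L U" and x: "x \<in> {0..d}"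
    and K: "\<And>z. z \<in> {0..d} \<Longrightarrow> \<bar>h \<alpha> \<gamma> \<sigma> d z\<bar> \<le> K" "\<And>z. z \<in> {0..d} \<Longrightarrow> \<bar>k z\<bar> \<le> K"
    "\<And>z. z \<in> {0..d} \<Longrightarrow> \<bar>p z\<bar> \<le> K" "\<And>z. z \<in> {0..d} \<Longrightarrow> \<bar>r z\<bar> \<le> K" "0 \<le> K"
    and T: "0 < T"
  defines "l \<equiv> \<theta> / sqrt T"
  shows "norm ((\<integral>\<omega>. iexp (l * (U T \<omega> - q * T)) \<partial>M) * of_real (exp (\<theta>\<^sup>2 * \<eta>2 / 2)) - 1) \<le> err K \<theta> l"
proof -
  let ?h = "h \<alpha> \<gamma> \<sigma> d"
  have l2T: "l\<^sup>2 * T = \<theta>\<^sup>2" using T by (simp add: l_def power_divide)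
  define ci where "ci = \<i> * complex_of_real l"
  define ck where "ck = - complex_of_real (l\<^sup>2)"
  define \<phi> where "\<phi> z = ci * of_real (?h (\<kappa> z)) + ck * of_real (k (\<kappa> z))" for z
  define \<phi>1 where "\<phi>1 z = ci * of_real (p (\<kappa> z) * \<kappa>1 z) + ck * of_real (r (\<kappa> z) * \<kappa>1 z)" for z
  define \<phi>2 where "\<phi>2 z = ci * of_real (p1 (\<kappa> z) * \<kappa>1 z * \<kappa>1 z + p (\<kappa> z) * \<kappa>2 z)
     + ck * of_real (r1 (\<kappa> z) * \<kappa>1 z * \<kappa>1 z + r (\<kappa> z) * \<kappa>2 z)" for z
  define w where "w z = exp (\<phi> z)" for z
  define w1 where "w1 z = \<phi>1 z * exp (\<phi> z)" for z
  define w2 where "w2 z = (\<phi>2 z + \<phi>1 z * \<phi>1 z) * exp (\<phi> z)" for z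
  \<comment> \<open>\<open>- ci * q\<close> removes the linear growth of \<open>U\<close>, and
    \<open>l\<^sup>2 * \<eta>2 / 2\<close> compensates the Gaussian decay of the characteristic
    function.\<close>
  define \<mu> where "\<mu> = - ci * of_real q + of_real (l\<^sup>2 * \<eta>2 / 2)"
  have "smooth_bounded \<phi> \<phi>1 \<phi>2"
    unfolding \<phi>_def[abs_def] \<phi>1_def[abs_def] \<phi>2_def[abs_def] by (rule smooth_bounded_lincomb[OF smooth_h smooth_k])
  then obtain C where "test_function w w1 w2 C"
    using smooth_bounded_test_function[OF smooth_bounded_exp]
    unfolding w_def[abs_def] w1_def[abs_def] w2_def[abs_def] by blast
  then interpret tf: test_function w w1 w2 C .
  have dd: "d \<in> {0..d}" "0 \<in> {0..d}" using pos by auto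
  interpret R: reflected_OU_test w w1 w2 C M B Z L U \<alpha> \<gamma> \<sigma> d x ci \<mu>
  proof
    show "w1 d = ci * w d" using dd at_0
      by (simp add: w1_def w_def \<phi>1_def \<kappa>_id \<kappa>1_id p_d r_d)
    show "w1 0 = 0" using dd by (simp add: w1_def \<phi>1_def \<kappa>_id \<kappa>1_id at_0)
    show "Re ci = 0" by (simp add: ci_def)
  qed (use pos bm OU in auto)
  let ?e = "exp (\<theta>\<^sup>2 * \<eta>2 / 2)" and ?m = "exp (l\<^sup>2 * K)"
  define \<Gamma> where "\<Gamma> = ?m * (\<sigma>\<^sup>2 / 2 * (2 * \<bar>l\<bar> * K\<^sup>2 + l\<^sup>2 * K\<^sup>2))"
  define \<rho> where "\<rho> = ?m * (\<bar>l\<bar> * K + l\<^sup>2 * K)"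
  have Re\<phi>: "Re (\<phi> z) \<le> l\<^sup>2 * K" if z: "z \<in> {0..d}" for z
  proof -
    have "Re (\<phi> z) = l\<^sup>2 * (- k z)" using z by (simp add: \<phi>_def ci_def ck_def \<kappa>_id)
    also have "\<dots> \<le> l\<^sup>2 * K" using K(2)[OF z] by (intro mult_left_mono) auto
    finally show ?thesis .
  qed
  have w_norm: "norm (w z) \<le> ?m" if "z \<in> {0..d}" for z
    using Re\<phi>[OF that] by (simp add: w_def)
  have w_near: "norm (w z - 1) \<le> \<rho>" if z: "z \<in> {0..d}" for z
  proof -
    have "norm (w z - 1) \<le> ?m * norm (\<phi> z)"
      unfolding w_def using K(5) by (intro exp_minus_one_bounds(1) Re\<phi> z) simp
    also have "norm (\<phi> z) \<le> norm (ci * of_real (?h z)) + norm (ck * of_real (k z))"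
      unfolding \<phi>_def \<kappa>_id[OF z] by (rule norm_triangle_ineq)
    also have "\<dots> \<le> \<bar>l\<bar> * K + l\<^sup>2 * K"
      using K(1,2)[OF z] by (auto simp: ci_def ck_def norm_mult norm_power intro!: add_mono mult_left_mono)
    finally show ?thesis unfolding \<rho>_def by simp
  qed
  have gen: "R.gen z = w z * of_real (\<sigma>\<^sup>2 / 2) * (2 * ci * ck * of_real (p z * r z) + ck\<^sup>2 * of_real ((r z)\<^sup>2))"
    if z: "z \<in> {0..d}" for z
  proof -
    have ph: "of_real (b z) * of_real (p z) + of_real (\<sigma>\<^sup>2 / 2) * of_real (p1 z) = (of_real q :: complex)"
      unfolding poisson_h[symmetric, of z] by simp
    have pk: "of_real (b z) * of_real (r z) + of_real (\<sigma>\<^sup>2 / 2) * of_real (r1 z) = (of_real \<eta>2 - of_real (\<sigma>\<^sup>2) * (of_real (p z))\<^sup>2) / (2 :: complex)"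
      using arg_cong[OF poisson_k[of z], of complex_of_real] by simp
    have "R.gen z = w z * (\<mu> + of_real (b z) * (ci * of_real (p z) + ck * of_real (r z))
       + of_real (\<sigma>\<^sup>2 / 2) * (ci * of_real (p1 z) + ck * of_real (r1 z) + (ci * of_real (p z) + ck * of_real (r z))\<^sup>2))"
      unfolding R.gen_def w1_def w2_def w_def \<phi>1_def \<phi>2_def b_def \<kappa>_id[OF z] \<kappa>1_id[OF z] \<kappa>2_id[OF z]
      by (simp add: algebra_simps power2_eq_square)
    also have "\<dots> = w z * (\<mu> + ci * (of_real (b z) * of_real (p z) + of_real (\<sigma>\<^sup>2 / 2) * of_real (p1 z))
       + ck * (of_real (b z) * of_real (r z) + of_real (\<sigma>\<^sup>2 / 2) * of_real (r1 z))
       + of_real (\<sigma>\<^sup>2 / 2) * (ci * of_real (p z) + ck * of_real (r z))\<^sup>2)"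
      by (simp add: algebra_simps)
    also have "\<dots> = w z * of_real (\<sigma>\<^sup>2 / 2) * (2 * ci * ck * of_real (p z * r z) + ck\<^sup>2 * of_real ((r z)\<^sup>2))"
    proof -
      \<comment> \<open>The coefficient of \<open>k\<close> is the square of that of
        \<open>h\<close>: this lets \<open>\<sigma>\<^sup>2/2 * (ci * p z)\<^sup>2\<close> cancel
        against the right-hand side of the equation for \<open>k\<close>.\<close>
      have ci2: "ci\<^sup>2 = ck" unfolding ci_def ck_def by (simp add: power_mult_distrib)
      have \<mu>: "\<mu> = - ci * of_real q - ck * of_real \<eta>2 / 2" unfolding \<mu>_def ck_def by simp
      have "\<mu> + ci * of_real q + ck * ((of_real \<eta>2 - of_real (\<sigma>\<^sup>2) * (of_real (p z))\<^sup>2) / 2)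
         + of_real (\<sigma>\<^sup>2 / 2) * (ci * of_real (p z) + ck * of_real (r z))\<^sup>2
        = of_real (\<sigma>\<^sup>2 / 2) * (2 * ci * ck * of_real (p z * r z) + ck\<^sup>2 * of_real ((r z)\<^sup>2))"
        unfolding \<mu> power2_sum power_mult_distrib ci2 by (simp add: field_simps)
      then show ?thesis unfolding ph pk by (simp only: mult.assoc)
    qed
    finally show ?thesis .
  qed
  have gen_norm: "norm (R.gen z) \<le> l\<^sup>2 * \<Gamma>" if z: "z \<in> {0..d}" for z
  proof -
    have pr: "\<bar>p z * r z\<bar> \<le> K\<^sup>2" "\<bar>(r z)\<^sup>2\<bar> \<le> K\<^sup>2"
      unfolding power2_eq_square abs_mult using K(3,4)[OF z] K(5) by (intro mult_mono; simp)+
    have "norm (R.gen z) = norm (w z) * (\<sigma>\<^sup>2 / 2) * norm (2 * ci * ck * of_real (p z * r z) + ck\<^sup>2 * of_real ((r z)\<^sup>2))"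
      unfolding gen[OF z] norm_mult norm_of_real by simp
    also have "\<dots> \<le> ?m * (\<sigma>\<^sup>2 / 2) * (2 * \<bar>l\<bar> * l\<^sup>2 * K\<^sup>2 + (l\<^sup>2)\<^sup>2 * K\<^sup>2)"
    proof (intro mult_mono w_norm z)
      have "norm (2 * ci * ck * of_real (p z * r z) + ck\<^sup>2 * of_real ((r z)\<^sup>2)) \<le>
          norm (2 * ci * ck * of_real (p z * r z)) + norm (ck\<^sup>2 * of_real ((r z)\<^sup>2))" by (rule norm_triangle_ineq)
      also have "\<dots> = 2 * \<bar>l\<bar> * l\<^sup>2 * \<bar>p z * r z\<bar> + (l\<^sup>2)\<^sup>2 * \<bar>(r z)\<^sup>2\<bar>"
        by (simp add: ci_def ck_def norm_mult norm_power power_mult_distrib abs_mult)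
      also have "\<dots> \<le> 2 * \<bar>l\<bar> * l\<^sup>2 * K\<^sup>2 + (l\<^sup>2)\<^sup>2 * K\<^sup>2"
        using pr by (intro add_mono mult_left_mono) auto
      finally show "norm (2 * ci * ck * of_real (p z * r z) + ck\<^sup>2 * of_real ((r z)\<^sup>2)) \<le> 2 * \<bar>l\<bar> * l\<^sup>2 * K\<^sup>2 + (l\<^sup>2)\<^sup>2 * K\<^sup>2" .
    qed auto
    also have "\<dots> = l\<^sup>2 * \<Gamma>" unfolding \<Gamma>_def by (simp add: power2_eq_square algebra_simps)
    finally show ?thesis .
  qed
  have wt: "norm (R.weight t \<omega>) \<le> ?e" if t: "0 \<le> t" "t \<le> T" for t \<omega>
  proof -
    have "norm (R.weight t \<omega>) = exp (l\<^sup>2 * \<eta>2 / 2 * t)" unfolding R.weight_def by (simp add: \<mu>_def ci_def)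
    also have "\<dots> \<le> exp (l\<^sup>2 * \<eta>2 / 2 * T)" using t \<eta>2_pos by (simp add: mult_left_mono)
    also have "l\<^sup>2 * \<eta>2 / 2 * T = \<theta>\<^sup>2 * \<eta>2 / 2" unfolding l2T[symmetric] by simp
    finally show ?thesis .
  qed
  have Zran: "AE \<omega> in M. \<forall>t\<ge>0. Z t \<omega> \<in> {0..d}"
    using OU by (auto simp: doubly_reflected_OU_def elim: eventually_mono)
  have G0: "0 \<le> \<Gamma>" "0 \<le> \<rho>" unfolding \<Gamma>_def \<rho>_def using K(5) by auto
  have step: "norm (\<integral>\<omega>. R.weight t \<omega> * R.gen (Z t \<omega>) \<partial>M) \<le> ?e * (l\<^sup>2 * \<Gamma>)" if t: "0 \<le> t" "t \<le> T" for t
  proof (rule integral_norm_bound_ae)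
    show "AE \<omega> in M. norm (R.weight t \<omega> * R.gen (Z t \<omega>)) \<le> ?e * (l\<^sup>2 * \<Gamma>)"
      using Zran
    proof eventually_elim
      case (elim \<omega>)
      have "Z t \<omega> \<in> {0..d}" using elim t by blast
      then show ?case unfolding norm_mult using G0 by (intro mult_mono wt t gen_norm) auto
    qed
  qed
  note [measurable] = R.measurable_processes[OF less_imp_le[OF T]] R.measurable_weight(1)[OF less_imp_le[OF T]]
  define I where "I = (\<integral>\<omega>. R.weight T \<omega> * w (Z T \<omega>) \<partial>M)"
  define E where "E = (\<integral>\<omega>. R.weight T \<omega> \<partial>M)"
  have 1: "norm (I - w x) \<le> \<theta>\<^sup>2 * (?e * \<Gamma>)"
    unfolding I_def
  proof (rule Lim_norm_ubound[OF _ R.dynkin_formula[OF T]])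
    show "\<forall>\<^sub>F n in sequentially. norm (\<Sum>j<n. of_real (T / real n) * (\<integral>\<omega>. R.weight (grid T n j) \<omega> * R.gen (Z (grid T n j) \<omega>) \<partial>M)) \<le> \<theta>\<^sup>2 * (?e * \<Gamma>)"
      using eventually_gt_at_top[of "0::nat"]
    proof eventually_elim
      case (elim n)
      have "norm (\<Sum>j<n. of_real (T / real n) * (\<integral>\<omega>. R.weight (grid T n j) \<omega> * R.gen (Z (grid T n j) \<omega>) \<partial>M)) \<le> (\<Sum>j<n. T / real n * (?e * (l\<^sup>2 * \<Gamma>)))"
      proof (rule sum_norm_le)
        fix j assume "j \<in> {..<n}"
        then have "0 \<le> grid T n j" "grid T n j \<le> T"
          using grid_simps(4)[OF T elim] grid_le[OF T elim] by auto
        then show "norm (of_real (T / real n) * (\<integral>\<omega>. R.weight (grid T n j) \<omega> * R.gen (Z (grid T n j) \<omega>) \<partial>M)) \<le> T / real n * (?e * (l\<^sup>2 * \<Gamma>))"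
          unfolding norm_mult norm_of_real using T by (intro mult_mono step) auto
      qed
      also have "\<dots> = (l\<^sup>2 * T) * (?e * \<Gamma>)" using elim by simp
      finally show ?case unfolding l2T .
    qed
  qed simp
  have w_int: "integrable M (R.weight T)" "integrable M (\<lambda>\<omega>. R.weight T \<omega> * w (Z T \<omega>))"
  proof -
    have b: "norm (R.weight T \<omega> * w (Z T \<omega>)) \<le> ?e * C" for \<omega>
      unfolding norm_mult using T by (intro mult_mono wt tf.w_bound) auto
    show "integrable M (R.weight T)" using wt[of T] T by (intro integrable_const_bound[of _ ?e]) auto
    show "integrable M (\<lambda>\<omega>. R.weight T \<omega> * w (Z T \<omega>))" using b by (intro integrable_const_bound[of _ "?e * C"]) auto
  qed
  have 2: "norm (I - E) \<le> ?e * \<rho>"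
  proof -
    have "I - E = (\<integral>\<omega>. R.weight T \<omega> * (w (Z T \<omega>) - 1) \<partial>M)"
      unfolding I_def E_def using w_int by (simp add: right_diff_distrib)
    also have "norm \<dots> \<le> ?e * \<rho>"
    proof (rule integral_norm_bound_ae)
      show "AE \<omega> in M. norm (R.weight T \<omega> * (w (Z T \<omega>) - 1)) \<le> ?e * \<rho>"
        using Zran
      proof eventually_elim
        case (elim \<omega>)
        have "Z T \<omega> \<in> {0..d}" using elim T by simp
        then show ?case unfolding norm_mult using G0 T by (intro mult_mono wt w_near) auto
      qed
    qed
    finally show ?thesis .
  qed
  have E: "E = (\<integral>\<omega>. iexp (l * (U T \<omega> - q * T)) \<partial>M) * of_real ?e"
  proof -
    have "R.weight T \<omega> = iexp (l * (U T \<omega> - q * T)) * of_real ?e" for \<omega>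
    proof -
      have "ci * of_real (U T \<omega>) + \<mu> * of_real T = \<i> * of_real (l * (U T \<omega> - q * T)) + of_real (l\<^sup>2 * \<eta>2 / 2 * T)"
        unfolding \<mu>_def ci_def by (simp add: algebra_simps)
      also have "l\<^sup>2 * \<eta>2 / 2 * T = \<theta>\<^sup>2 * \<eta>2 / 2" unfolding l2T[symmetric] by simp
      finally show ?thesis by (simp only: R.weight_def exp_add exp_of_real)
    qed
    then have "R.weight T = (\<lambda>\<omega>. iexp (l * (U T \<omega> - q * T)) * of_real ?e)" by (rule ext)
    then show ?thesis unfolding E_def by (simp only: integral_mult_left_zero)
  qed
  have "norm (E - 1) \<le> norm (I - E) + norm (I - w x) + norm (w x - 1)"
    using norm_triangle_ineq4[of "I - w x" "I - E"] norm_triangle_ineq[of "E - w x" "w x - 1"] by simp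
  also have "\<dots> \<le> ?e * \<rho> + \<theta>\<^sup>2 * (?e * \<Gamma>) + \<rho>" using 1 2 w_near[OF x] by linarith
  also have "\<dots> = err K \<theta> l" unfolding err_def \<rho>_def \<Gamma>_def by (simp add: algebra_simps)
  finally show ?thesis unfolding E .
qed

text \<open>Taken along sequences because Levy's continuity theorem speaks of them; dividing by the
  factor \<open>?e\<close> isolates the limit.\<close>

lemma char_tendsto:
  assumes OU: "doubly_reflected_OU M B \<alpha> \<gamma> \<sigma> d x Z L U" and x: "x \<in> {0..d}"
    and X: "filterlim X at_top sequentially" "\<And>n. 0 < X n"
  shows "(\<lambda>n. char (distr M borel (\<lambda>\<omega>. (U (X n) \<omega> - q * X n) / sqrt (X n))) \<theta>) \<longlonglongrightarrow> exp (- (\<theta>\<^sup>2 * \<eta>2 / 2))"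
proof -
  let ?e = "complex_of_real (exp (\<theta>\<^sup>2 * \<eta>2 / 2))"
  define \<psi> where "\<psi> n = char (distr M borel (\<lambda>\<omega>. (U (X n) \<omega> - q * X n) / sqrt (X n))) \<theta>" for n
  obtain K where K: "\<And>z. z \<in> {0..d} \<Longrightarrow> \<bar>h \<alpha> \<gamma> \<sigma> d z\<bar> \<le> K" "\<And>z. z \<in> {0..d} \<Longrightarrow> \<bar>k z\<bar> \<le> K"
    "\<And>z. z \<in> {0..d} \<Longrightarrow> \<bar>p z\<bar> \<le> K" "\<And>z. z \<in> {0..d} \<Longrightarrow> \<bar>r z\<bar> \<le> K" "0 \<le> K"
    using bounds_on_interval by blast
  have \<psi>: "\<psi> n = (\<integral>\<omega>. iexp (\<theta> / sqrt (X n) * (U (X n) \<omega> - q * X n)) \<partial>M)" for n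
  proof -
    have "U (X n) \<in> borel_measurable (brownian_filtration M B (X n))"
      using OU X(2)[of n] by (auto simp: doubly_reflected_OU_def adapted_process_def less_imp_le)
    then have [measurable]: "U (X n) \<in> borel_measurable M" by (rule measurable_brownian_filtration[OF bm])
    show ?thesis unfolding \<psi>_def char_def by (subst integral_distr) (auto simp: field_simps)
  qed
  have "(\<lambda>n. \<psi> n * ?e - 1) \<longlonglongrightarrow> 0"
  proof (rule Lim_null_comparison)
    show "\<forall>\<^sub>F n in sequentially. norm (\<psi> n * ?e - 1) \<le> err K \<theta> (\<theta> / sqrt (X n))"
      unfolding \<psi> by (intro always_eventually allI char_estimate[OF OU x K X(2)])
    have "filterlim (\<lambda>n. sqrt (X n)) at_top sequentially"
      using X(1) by (rule filterlim_compose[OF sqrt_at_top])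
    then show "(\<lambda>n. err K \<theta> (\<theta> / sqrt (X n))) \<longlonglongrightarrow> 0"
      by (intro err_tendsto_0 real_tendsto_divide_at_top[OF tendsto_const])
  qed
  then have "(\<lambda>n. ((\<psi> n * ?e - 1) + 1) / ?e) \<longlonglongrightarrow> (0 + 1) / ?e"
    by (intro tendsto_intros) auto
  then show ?thesis unfolding \<psi>_def[symmetric] by (simp add: exp_minus inverse_eq_divide)
qed

end

section \<open>The normal law and the passage to continuous time\<close>

lemma normal_law_standardize:
  assumes "0 < v"
  shows "distr (normal_law m v) lborel (\<lambda>x. (x - m) / sqrt v) = std_normal_distribution"
    and "real_distribution (normal_law m v)"
proof -
  interpret prob_space "normal_law m v"
    unfolding normal_law_def using assms by (intro prob_space_normal_density) simp
  show "real_distribution (normal_law m v)"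
    by unfold_locales (auto simp: normal_law_def)
  have "distributed (normal_law m v) lborel (\<lambda>x. x) (normal_density m (sqrt v))"
    unfolding distributed_def normal_law_def by (auto intro!: measure_eqI simp: emeasure_distr)
  then have "distributed (normal_law m v) lborel (\<lambda>x. (x - m) / sqrt v) std_normal_density"
    using assms by (subst (asm) normal_standard_normal_convert) auto
  then show "distr (normal_law m v) lborel (\<lambda>x. (x - m) / sqrt v) = std_normal_distribution"
    by (rule distributed_distr_eq_density)
qed

lemma char_normal_law:
  assumes "0 < v"
  shows "char (normal_law 0 v) \<theta> = exp (- (\<theta>\<^sup>2 * v / 2))"
proof -
  have "char (normal_law 0 v) \<theta> = (\<integral>x. iexp ((\<theta> * sqrt v) * ((x - 0) / sqrt v)) \<partial>normal_law 0 v)"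
    using assms by (simp add: char_def)
  also have "\<dots> = (\<integral>x. iexp ((\<theta> * sqrt v) * x) \<partial>distr (normal_law 0 v) lborel (\<lambda>x. (x - 0) / sqrt v))"
    by (subst integral_distr) (auto simp: normal_law_def)
  also have "\<dots> = char std_normal_distribution (\<theta> * sqrt v)"
    unfolding normal_law_standardize(1)[OF assms] char_def ..
  also have "\<dots> = of_real (exp (- (\<theta>\<^sup>2 * v / 2)))"
    using assms unfolding char_std_normal_distribution power_mult_distrib real_sqrt_pow2[OF less_imp_le[OF assms]] by simp
  finally show ?thesis by (simp only: exp_of_real)
qed

theorem proposition5p2:
  fixes M :: "'a measure" and B Z L U :: "real \<Rightarrow> 'a \<Rightarrow> real"
    and \<pi> :: "real measure" and \<alpha> \<gamma> \<sigma> d x :: real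
  assumes "\<alpha> > 0" and "\<gamma> > 0" and "\<sigma> > 0" and "d > \<alpha> / \<gamma>" and "x \<in> {0..d}"
    and "standard_brownian_motion M B"
    and "doubly_reflected_OU M B \<alpha> \<gamma> \<sigma> d x Z L U"
    and "stationary_distribution M B \<alpha> \<gamma> \<sigma> d \<pi>"
  shows "converges_in_law
           (\<lambda>t. distr M borel (\<lambda>\<omega>. (U t \<omega> - q_U \<alpha> \<gamma> \<sigma> d * t) / sqrt t))
           (normal_law 0 (eta_U_squared \<alpha> \<gamma> \<sigma> d \<pi>)) at_top"
proof -
  have "0 < d" using assms(1,2,4) by (metis divide_pos_pos order_less_trans)
  then interpret OU_setting \<alpha> \<gamma> \<sigma> d M B using assms by unfold_locales auto
  have eta: "eta_U_squared \<alpha> \<gamma> \<sigma> d \<pi> = \<eta>2" using assms(8) by (rule eta_U_squared_eq)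
  define \<mu> where "\<mu> t = distr M borel (\<lambda>\<omega>. (U t \<omega> - q * t) / sqrt t)" for t
  \<comment> \<open>Convergence along every positive sequence tending to infinity;
    \<open>at_top\<close> on the reals is recovered from sequences afterwards.\<close>
  have conv: "weak_conv_m (\<lambda>n. \<mu> (X n)) (normal_law 0 \<eta>2)"
    if X: "filterlim X at_top sequentially" "\<And>n. 0 < X n" for X
  proof (rule levy_continuity)
    show "real_distribution (\<mu> (X n))" for n
    proof -
      have "U (X n) \<in> borel_measurable (brownian_filtration M B (X n))"
        using assms(7) X(2)[of n] by (auto simp: doubly_reflected_OU_def adapted_process_def less_imp_le)
      then have [measurable]: "U (X n) \<in> borel_measurable M" by (rule measurable_brownian_filtration[OF bm])
      show ?thesis unfolding \<mu>_def by (intro real_distribution_distr) measurable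
    qed
    show "real_distribution (normal_law 0 \<eta>2)" by (rule normal_law_standardize(2)[OF \<eta>2_pos])
    show "(\<lambda>n. char (\<mu> (X n)) \<theta>) \<longlonglongrightarrow> char (normal_law 0 \<eta>2) \<theta>" for \<theta>
      unfolding \<mu>_def char_normal_law[OF \<eta>2_pos] by (rule char_tendsto[OF assms(7,5) X])
  qed
  show ?thesis unfolding converges_in_law_def eta \<mu>_def[symmetric]
  proof (intro allI impI tendsto_at_topI_sequentially)
    fix y and X :: "nat \<Rightarrow> real"
    assume y: "isCont (cdf (normal_law 0 \<eta>2)) y" and X: "filterlim X at_top sequentially"
    \<comment> \<open>An arbitrary sequence may start with nonpositive times, to which
      \<open>conv\<close> does not apply; it agrees with \<open>max 1 (X n)\<close> from some index
      on.\<close>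
    have ev: "\<forall>\<^sub>F n in sequentially. max 1 (X n) = X n"
      using filterlim_at_top_dense[THEN iffD1, OF X, rule_format, of 1] by eventually_elim simp
    have "filterlim (\<lambda>n. max 1 (X n)) at_top sequentially"
      using X ev by (subst filterlim_cong[OF refl refl ev])
    then have "weak_conv_m (\<lambda>n. \<mu> (max 1 (X n))) (normal_law 0 \<eta>2)" by (rule conv) simp
    then have "(\<lambda>n. cdf (\<mu> (max 1 (X n))) y) \<longlonglongrightarrow> cdf (normal_law 0 \<eta>2) y"
      using y by (simp add: weak_conv_m_def weak_conv_def)
    then show "(\<lambda>n. cdf (\<mu> (X n)) y) \<longlonglongrightarrow> cdf (normal_law 0 \<eta>2) y"
      by (rule Lim_transform_eventually) (use ev in \<open>auto elim: eventually_mono\<close>)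
  qed
qed

end
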